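(* Every diagram of type (III, III) is $C^{\infty}$-equivalent to a diagram in the following normal form: $$f_{1}(x_1, y_1)=x_{1}+y_{1},\quad \gamma_{1}(x_1,y_1)=(x_{1}, y_{1}^{2}),$$ $$f_{2}(x_2, y_2)=x_{2}+y_{2}+\theta (x_{2}, y_{2}),\quad \gamma_{2}(x_2,y_2)=(x_{2}^{2}, y_{2}),$$ where $\theta$ is an arbitrary function germ in the maximal ideal $\mathcal{M}_{x_{2}, y_{2}}$ (of the ring of smooth function germs on $(\mathbb{R}^2,0)$ in the variables $(x_2,y_2)$) satisfying $\theta (x_{2}, 0)=\theta (0, y_{2})=0$.
   Context: One considers diagrams of $C^{\infty}$ map germs $(\mathbb{R},0) \xleftarrow{f_1} (\mathbb{R}^{2},0) \xrightarrow{\gamma_1} (\mathbb{R}^2,0) \xleftarrow{\gamma_2} (\mathbb{R}^{2},0) \xrightarrow{f_2} (\mathbb{R},0)$. Two such diagrams $(f_1^{j}, \gamma_1^{j}; f_2^{j}, \gamma_2^{j})$, $j=1,2$, are $C^{\infty}$-equivalent if there exist $C^{\infty}$-diffeomorphism germs $h_i:(\mathbb{R},0)\to(\mathbb{R},0)$, $H_i:(\mathbb{R}^2,0)\to(\mathbb{R}^2,0)$ ($i=1,2$) and $K:(\mathbb{R}^2,0)\to(\mathbb{R}^2,0)$ with $h_i\circ f_i^1 = f_i^2\circ H_i$ and $K\circ\gamma_i^1 = \gamma_i^2\circ H_i$ for $i=1,2$. A pair $(f,\gamma)$, $(\mathbb{R},0)\xleftarrow{f}(\mathbb{R}^2,0)\xrightarrow{\gamma}(\mathbb{R}^2,0)$,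 is of type (III) if $f$ is a submersion, $\gamma$ is a fold, $f$ restricted to the singular set $S_\gamma$ of $\gamma$ is regular, and $(f,\gamma):(\mathbb{R}^2,0)\to(\mathbb{R}^3,0)$ is regular. A diagram is of type (III, III) if $(f_1,\gamma_1)$ and $(f_2,\gamma_2)$ are both of type (III) and the discriminant curves $\gamma_1(S_{\gamma_1})$ and $\gamma_2(S_{\gamma_2})$ are transversal at $0$. *)

theory Defs
  imports "HOL-Analysis.Analysis"
begin

fun iter_dd :: "'a::real_normed_vector list \<Rightarrow> ('a \<Rightarrow> 'b::real_normed_vector) \<Rightarrow> 'a \<Rightarrow> 'b" where
  "iter_dd [] f = f"
| "iter_dd (v # vs) f = (\<lambda>x. frechet_derivative (iter_dd vs f) (at x) v)"

definition smooth_on :: "'a::real_normed_vector set \<Rightarrow> ('a \<Rightarrow> 'b::real_normed_vector) \<Rightarrow> bool" where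
  "smooth_on U f \<longleftrightarrow> open U \<and> (\<forall>vs. \<forall>x\<in>U. iter_dd vs f differentiable (at x))"

definition smooth_germ :: "('a::real_normed_vector \<Rightarrow> 'b::real_normed_vector) \<Rightarrow> bool" where
  "smooth_germ f \<longleftrightarrow> (\<exists>U. 0 \<in> U \<and> smooth_on U f)"

definition diffeo_germ :: "('a::real_normed_vector \<Rightarrow> 'a) \<Rightarrow> bool" where
  "diffeo_germ h \<longleftrightarrow> h 0 = 0 \<and> smooth_germ h \<and>
     (\<exists>g. g 0 = 0 \<and> smooth_germ g \<and> (\<forall>\<^sub>F x in nhds 0. g (h x) = x) \<and> (\<forall>\<^sub>F y in nhds 0. h (g y) = y))"

definition fold_germ :: "(real \<times> real \<Rightarrow> real \<times> real) \<Rightarrow> bool" where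
  "fold_germ \<gamma> \<longleftrightarrow> \<gamma> 0 = 0 \<and> smooth_germ \<gamma> \<and>
     (\<exists>\<phi> \<psi>. diffeo_germ \<phi> \<and> diffeo_germ \<psi> \<and>
        (\<forall>\<^sub>F p in nhds 0. \<psi> (\<gamma> p) = (\<lambda>(x, y). (x, y ^ 2)) (\<phi> p)))"

definition sing_set :: "(real \<times> real \<Rightarrow> real \<times> real) \<Rightarrow> (real \<times> real) set" where
  "sing_set \<gamma> = {p. \<not> surj (frechet_derivative \<gamma> (at p))}"

definition param_curve :: "(real \<times> real) set \<Rightarrow> (real \<Rightarrow> real \<times> real) \<Rightarrow> bool" where
  "param_curve S c \<longleftrightarrow> c 0 = 0 \<and> smooth_germ c \<and> frechet_derivative c (at 0) 1 \<noteq> 0 \<and>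
     (\<exists>U \<epsilon>. open U \<and> 0 \<in> U \<and> \<epsilon> > 0 \<and> c ` {-\<epsilon><..<\<epsilon>} \<subseteq> U \<and> S \<inter> U = c ` {-\<epsilon><..<\<epsilon>})"

definition typeIII :: "(real \<times> real \<Rightarrow> real) \<Rightarrow> (real \<times> real \<Rightarrow> real \<times> real) \<Rightarrow> bool" where
  "typeIII f \<gamma> \<longleftrightarrow>
     f 0 = 0 \<and> smooth_germ f \<and> surj (frechet_derivative f (at 0)) \<comment> \<open>f submersion\<close>
     \<and> fold_germ \<gamma>
     \<and> (\<exists>c. param_curve (sing_set \<gamma>) c \<and> frechet_derivative (f \<circ> c) (at 0) 1 \<noteq> 0) \<comment> \<open>f|S regular\<close>
     \<and> inj (frechet_derivative (\<lambda>p. (f p, \<gamma> p)) (at 0))"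

definition discr_transversal :: "(real \<times> real \<Rightarrow> real \<times> real) \<Rightarrow> (real \<times> real \<Rightarrow> real \<times> real) \<Rightarrow> bool" where
  "discr_transversal \<gamma>1 \<gamma>2 \<longleftrightarrow>
     (\<exists>c1 c2. param_curve (sing_set \<gamma>1) c1 \<and> param_curve (sing_set \<gamma>2) c2 \<and>
        (let u = frechet_derivative (\<gamma>1 \<circ> c1) (at 0) 1; v = frechet_derivative (\<gamma>2 \<circ> c2) (at 0) 1
         in fst u * snd v - snd u * fst v \<noteq> 0))"

definition typeIII_III ::
  "(real \<times> real \<Rightarrow> real) \<Rightarrow> (real \<times> real \<Rightarrow> real \<times> real) \<Rightarrow>
   (real \<times> real \<Rightarrow> real) \<Rightarrow> (real \<times> real \<Rightarrow> real \<times> real) \<Rightarrow> bool" where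
  "typeIII_III f1 \<gamma>1 f2 \<gamma>2 \<longleftrightarrow> typeIII f1 \<gamma>1 \<and> typeIII f2 \<gamma>2 \<and> discr_transversal \<gamma>1 \<gamma>2"

definition diagram_equiv ::
  "(real \<times> real \<Rightarrow> real) \<Rightarrow> (real \<times> real \<Rightarrow> real \<times> real) \<Rightarrow>
   (real \<times> real \<Rightarrow> real) \<Rightarrow> (real \<times> real \<Rightarrow> real \<times> real) \<Rightarrow>
   (real \<times> real \<Rightarrow> real) \<Rightarrow> (real \<times> real \<Rightarrow> real \<times> real) \<Rightarrow>
   (real \<times> real \<Rightarrow> real) \<Rightarrow> (real \<times> real \<Rightarrow> real \<times> real) \<Rightarrow> bool" where
  "diagram_equiv f1 \<gamma>1 f2 \<gamma>2 g1 \<delta>1 g2 \<delta>2 \<longleftrightarrow>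
     (\<exists>(h1 :: real \<Rightarrow> real) (h2 :: real \<Rightarrow> real) H1 H2 K.
        diffeo_germ h1 \<and> diffeo_germ h2 \<and> diffeo_germ H1 \<and> diffeo_germ H2 \<and> diffeo_germ K \<and>
        (\<forall>\<^sub>F p in nhds 0. h1 (f1 p) = g1 (H1 p)) \<and>
        (\<forall>\<^sub>F p in nhds 0. h2 (f2 p) = g2 (H2 p)) \<and>
        (\<forall>\<^sub>F p in nhds 0. K (\<gamma>1 p) = \<delta>1 (H1 p)) \<and>
        (\<forall>\<^sub>F p in nhds 0. K (\<gamma>2 p) = \<delta>2 (H2 p)))"

end

theory Submission
  imports Defs
begin

text \<open>
  Source coordinates make \<open>\<gamma>1 = (x, y\<^sup>2)\<close> and \<open>\<gamma>2 = (x\<^sup>2, y)\<close> at once: after \<open>\<gamma>1\<close> is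
  normalised, transversality makes the discriminant of \<open>\<gamma>2\<close> a graph \<open>X = d(Y)\<close>, which is
  sheared to \<open>X = 0\<close>.  By Whitney's theorem on even functions
  \<open>h1 (f1 (x, y)) = a (x, y\<^sup>2) + y b (x, y\<^sup>2)\<close> with smooth \<open>a\<close>, \<open>b\<close>, so the target map
  \<open>K = (a, Y b\<^sup>2)\<close> and its lift \<open>(a, y b)\<close> turn \<open>f1\<close> into \<open>x + y\<close>.  Whatever diffeomorphism \<open>h1\<close> is
  used, \<open>K\<close> preserves the line \<open>X = 0\<close> as soon as \<open>h1 (f1 (0, y)) = y k (y\<^sup>2)\<close> is odd; the remaining
  freedom is therefore one positive function \<open>k\<close>.  The lift of \<open>K\<close> through \<open>\<gamma>2\<close> acts on the two axes by
  explicit formulas in \<open>k\<close>, and the requirement that some \<open>h2\<close> make \<open>f2\<close> equal to the coordinate on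
  both axes becomes, for \<open>\<kappa> = ln k\<close>, a linear functional equation
  \<open>\<kappa> (y) = \<rho> (y) + \<kappa> (p (y)) / 4\<close> with \<open>p (0) = p' (0) = 0\<close>.  It has a smooth solution: the obvious
  series converges, and the derivative of a solution solves an equation of the same type.

  In Whitney's theorem the values of \<open>a\<close> are only prescribed for \<open>Y \<ge> 0\<close>; a Borel series with the
  Taylor coefficients of \<open>f\<close> along \<open>y = 0\<close> extends them to \<open>Y < 0\<close>.
\<close>

subsection \<open>Smooth maps\<close>

text \<open>The obstacle is that a single \<open>K\<close> serves both functions. Let
  \<open>r\<close> and \<open>s\<close> compare the values of each function on its two axes: near 0,
  g1 (x, 0) = g1 (0, r x) and g2 (0, y) = g2 (s y, 0), with r x = x R(x) and s y = y S(y). On the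
  line Y = 0 the map \<open>K\<close> multiplies X by R(X) k(r(X)^2), and on X = 0 it multiplies Y
  by k(Y)^2. Since \<gamma>2 squares x, the lift of \<open>K\<close> carries the square root of the
  first factor. The vanishing of \<theta> on the first axis fixes \<open>h2\<close>; its vanishing
  on the second axis then demands S(y) sqrt(R(s(y)^2) k(p y)) = k(y)^2, where p y = (r(s(y)^2))^2.
  Logarithms give the coefficient 1/4: one half comes from the root and one half from the square.
  The map \<open>p\<close> vanishes to order four because the passage through either fold squares
  once. Roots and logarithms require R(0) and S(0) to be positive, so the signs of the source
  coordinates are adjusted beforehand.\<close>

fun ck :: "nat \<Rightarrow> 'a::real_normed_vector set \<Rightarrow> ('a \<Rightarrow> 'b::real_normed_vector) \<Rightarrow> bool" where
  "ck 0 U f \<longleftrightarrow> continuous_on U f"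
| "ck (Suc n) U f \<longleftrightarrow> (\<forall>x\<in>U. f differentiable (at x)) \<and>
     (\<forall>v. ck n U (\<lambda>x. frechet_derivative f (at x) v))"

lemma ck_cong:
  assumes "open U" "\<And>x. x \<in> U \<Longrightarrow> f x = g x" "ck n U f"
  shows "ck n U g"
  using assms(2,3)
proof (induction n arbitrary: f g)
  case 0
  then show ?case by (metis ck.simps(1) continuous_on_cong)
next
  case (Suc n)
  have d: "(g has_derivative frechet_derivative f (at x)) (at x)" if "x \<in> U" for x
  proof (rule has_derivative_transform_within_open[OF _ assms(1) that])
    show "(f has_derivative frechet_derivative f (at x)) (at x)"
      using Suc.prems that by (simp add: frechet_derivative_works[symmetric])
  qed (use Suc.prems in auto)
  then have e: "frechet_derivative f (at x) = frechet_derivative g (at x)" if "x \<in> U" for x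
    using frechet_derivative_at that by blast
  have "ck n U (\<lambda>x. frechet_derivative g (at x) v)" for v
    by (rule Suc.IH[of "\<lambda>x. frechet_derivative f (at x) v"]) (use Suc.prems e in auto)
  then show ?case using d by (auto simp: differentiable_def)
qed

text \<open>Derivatives are unique on an open set, so any \<open>D\<close> produced by the
  derivative rules may replace the choice made by \<open>frechet_derivative\<close>. Most closure
  properties enter the recursion of \<open>ck\<close> through this rule.\<close>

lemma ck_SucI:
  assumes "open U" "\<And>x. x \<in> U \<Longrightarrow> (f has_derivative D x) (at x)"
    and "\<And>v. ck n U (\<lambda>x. D x v)"
  shows "ck (Suc n) U f"
proof -
  have "ck n U (\<lambda>x. frechet_derivative f (at x) v)" for v
    by (rule ck_cong[OF assms(1) _ assms(3)[of v]])
       (use assms(2) frechet_derivative_at in metis)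
  then show ?thesis using assms(2) by (auto simp: differentiable_def)
qed

lemma ck_Suc_has_derivative:
  assumes "ck (Suc n) U f" "x \<in> U"
  shows "(f has_derivative frechet_derivative f (at x)) (at x)"
  using assms frechet_derivative_works by auto

lemma ck_Suc_imp_ck: "ck (Suc n) U f \<Longrightarrow> ck n U f"
proof (induction n arbitrary: f)
  case 0
  then show ?case
    by (simp add: continuous_at_imp_continuous_on differentiable_imp_continuous_within)
qed auto

lemma ck_mono: "ck n U f \<Longrightarrow> m \<le> n \<Longrightarrow> ck m U f"
  by (induction n) (auto simp: le_Suc_eq simp del: ck.simps dest: ck_Suc_imp_ck)

lemma ck_imp_continuous_on: "ck n U f \<Longrightarrow> continuous_on U f"
  using ck_mono[of n U f 0] by simp

lemma ck_subset: "ck n U f \<Longrightarrow> V \<subseteq> U \<Longrightarrow> ck n V f"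
  by (induction n arbitrary: f) (auto intro: continuous_on_subset)

lemma iter_dd_append: "iter_dd (vs @ ws) f = iter_dd vs (iter_dd ws f)"
  by (induction vs) auto

text \<open>The head of the list in \<open>iter_dd\<close> is the derivative taken last, whereas
  \<open>ck\<close> peels off the one taken first; \<open>iter_dd_append\<close> reconciles the two
  orders. The gain is a notion of finite order, on which product rule, chain rule and bootstrapping
  can be proved by induction.\<close>

lemma smooth_on_iff_ck: "smooth_on U f \<longleftrightarrow> open U \<and> (\<forall>n. ck n U f)"
proof -
  have 1: "iter_dd vs f differentiable (at x)" if "\<forall>n. ck n U f" "x \<in> U" for vs x
  proof -
    have "\<forall>n. ck n U (iter_dd vs f)"
    proof (induction vs)
      case (Cons v vs)
      then have "ck (Suc n) U (iter_dd vs f)" for n by blast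
      then show ?case by simp
    qed (use that in auto)
    then have "ck (Suc 0) U (iter_dd vs f)" by blast
    then show ?thesis using that(2) by simp
  qed
  have "ck n U f" if "\<forall>vs. \<forall>x\<in>U. iter_dd vs f differentiable (at x)" for n
    using that
  proof (induction n arbitrary: f)
    case 0
    have "\<forall>x\<in>U. f differentiable (at x)" using 0[rule_format, of _ "[]"] by simp
    then show ?case
      by (simp add: continuous_at_imp_continuous_on differentiable_imp_continuous_within)
  next
    case (Suc n)
    have "f differentiable (at x)" if "x \<in> U" for x
      using Suc.prems that by (metis iter_dd.simps(1))
    moreover have "ck n U (\<lambda>x. frechet_derivative f (at x) v)" for v
    proof (rule Suc.IH, intro allI)
      fix vs
      show "\<forall>x\<in>U. iter_dd vs (\<lambda>x. frechet_derivative f (at x) v) differentiable (at x)"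
        using Suc.prems[rule_format, of _ "vs @ [v]"] by (simp add: iter_dd_append)
    qed
    ultimately show ?case by simp
  qed
  then show ?thesis using 1 unfolding smooth_on_def by blast
qed

lemma ck_const: "ck n U (\<lambda>x. c)"
proof (induction n arbitrary: c)
  case (Suc n)
  then show ?case by (simp add: frechet_derivative_const)
qed auto

lemma ck_linear:
  assumes "open U" "bounded_linear L"
  shows "ck n U L"
proof (cases n)
  case 0
  then show ?thesis using assms linear_continuous_on by auto
next
  case (Suc m)
  show ?thesis unfolding Suc
    by (rule ck_SucI[where D="\<lambda>x. L"])
       (auto simp: assms bounded_linear_imp_has_derivative ck_const)
qed

lemma ck_add:
  assumes "open U" "ck n U f" "ck n U g"
  shows "ck n U (\<lambda>x. f x + g x)"
  using assms(2,3)
proof (induction n arbitrary: f g)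
  case 0
  then show ?case by (auto intro: continuous_intros)
next
  case (Suc n)
  show ?case
  proof (rule ck_SucI[OF assms(1)])
    show "((\<lambda>x. f x + g x) has_derivative
        (\<lambda>v. frechet_derivative f (at x) v + frechet_derivative g (at x) v)) (at x)" if "x \<in> U" for x
      by (intro has_derivative_add ck_Suc_has_derivative[OF Suc.prems(1) that]
          ck_Suc_has_derivative[OF Suc.prems(2) that])
  qed (use Suc in auto)
qed

text \<open>The product rule gives two terms of the same bilinear shape, each with one factor
  differentiated, so the induction over arbitrary \<open>f\<close> and \<open>g\<close>
  closes.\<close>

lemma ck_bilinear:
  assumes "bounded_bilinear B" "open U" "ck n U f" "ck n U g"
  shows "ck n U (\<lambda>x. B (f x) (g x))"
  using assms(3,4)
proof (induction n arbitrary: f g)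
  case 0
  then show ?case
    by (auto intro: bounded_bilinear.continuous_on[OF assms(1)])
next
  case (Suc n)
  show ?case
  proof (rule ck_SucI[OF assms(2)])
    show "((\<lambda>x. B (f x) (g x)) has_derivative
        (\<lambda>v. B (f x) (frechet_derivative g (at x) v) + B (frechet_derivative f (at x) v) (g x))) (at x)"
      if "x \<in> U" for x
      by (intro bounded_bilinear.FDERIV[OF assms(1)] ck_Suc_has_derivative[OF Suc.prems(1) that]
          ck_Suc_has_derivative[OF Suc.prems(2) that])
    show "ck n U (\<lambda>x. B (f x) (frechet_derivative g (at x) v) + B (frechet_derivative f (at x) v) (g x))" for v
      by (intro ck_add[OF assms(2)] Suc.IH) (use Suc.prems ck_Suc_imp_ck in auto)
  qed
qed

lemmas ck_scaleR = ck_bilinear[OF bounded_bilinear_scaleR]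
lemmas ck_mult = ck_bilinear[OF bounded_bilinear_mult]
lemmas ck_inner = ck_bilinear[OF bounded_bilinear_inner]

lemma ck_sum:
  assumes "open U" "\<And>i. i \<in> I \<Longrightarrow> ck n U (f i)"
  shows "ck n U (\<lambda>x. \<Sum>i\<in>I. f i x)"
  using assms(2)
proof (induction I rule: infinite_finite_induct)
  case (insert i I)
  then show ?case by (simp add: ck_add[OF assms(1)])
qed (auto simp: ck_const)

text \<open>In the chain rule the outer derivative is taken in a direction that varies with x, while
  \<open>ck\<close> speaks of fixed directions only. Expanding that direction in the basis of the
  intermediate space reduces to fixed ones, which is why this space is Euclidean.\<close>

lemma ck_compose:
  fixes f :: "'a::real_normed_vector \<Rightarrow> 'b::euclidean_space"
    and g :: "'b \<Rightarrow> 'c::real_normed_vector"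
  assumes U: "open U" and V: "open V" and "ck n V g" "ck n U f" and sub: "f ` U \<subseteq> V"
  shows "ck n U (\<lambda>x. g (f x))"
  using assms(3,4)
proof (induction n arbitrary: g)
  case 0
  then show ?case using sub continuous_on_compose2 by auto
next
  case (Suc n)
  have lin: "linear (frechet_derivative g (at y))" if "y \<in> V" for y
    using ck_Suc_has_derivative[OF Suc.prems(1) that] has_derivative_linear by blast
  have expand: "frechet_derivative g (at (f x)) w =
      (\<Sum>b\<in>Basis. (w \<bullet> b) *\<^sub>R frechet_derivative g (at (f x)) b)" if "x \<in> U" for x w
  proof -
    have "f x \<in> V" using that sub by auto
    then interpret linear "frechet_derivative g (at (f x))" by (rule lin)
    have "frechet_derivative g (at (f x)) w = frechet_derivative g (at (f x)) (\<Sum>b\<in>Basis. (w \<bullet> b) *\<^sub>R b)"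
      by (simp add: euclidean_representation)
    then show ?thesis by (simp add: sum scale)
  qed
  show ?case
  proof (rule ck_SucI[OF U])
    show "((\<lambda>x. g (f x)) has_derivative
       (\<lambda>v. \<Sum>b\<in>Basis. (frechet_derivative f (at x) v \<bullet> b) *\<^sub>R frechet_derivative g (at (f x)) b)) (at x)"
      if "x \<in> U" for x
    proof -
      have "((\<lambda>x. g (f x)) has_derivative
         (\<lambda>v. frechet_derivative g (at (f x)) (frechet_derivative f (at x) v))) (at x)"
        by (rule has_derivative_compose[OF ck_Suc_has_derivative[OF Suc.prems(2) that]
              ck_Suc_has_derivative[OF Suc.prems(1)]]) (use that sub in auto)
      then show ?thesis
        by (rule has_derivative_eq_rhs) (rule ext, rule expand[OF that])
    qed
    have "ck n U (\<lambda>x. frechet_derivative g (at (f x)) b)" for b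
      by (rule Suc.IH) (use Suc.prems ck_Suc_imp_ck in auto)
    then show "ck n U (\<lambda>x. \<Sum>b\<in>Basis. (frechet_derivative f (at x) v \<bullet> b) *\<^sub>R
        frechet_derivative g (at (f x)) b)" for v
      using Suc.prems(2) by (intro ck_sum ck_scaleR ck_inner ck_const U) auto
  qed
qed

lemma ck_Pair:
  assumes "open U" "ck n U f" "ck n U g"
  shows "ck n U (\<lambda>x. (f x, g x))"
  using assms(2,3)
proof (induction n arbitrary: f g)
  case 0
  then show ?case by (auto intro: continuous_intros)
next
  case (Suc n)
  show ?case
  proof (rule ck_SucI[OF assms(1)])
    show "((\<lambda>x. (f x, g x)) has_derivative
        (\<lambda>v. (frechet_derivative f (at x) v, frechet_derivative g (at x) v))) (at x)" if "x \<in> U" for x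
      by (intro has_derivative_Pair ck_Suc_has_derivative[OF Suc.prems(1) that]
          ck_Suc_has_derivative[OF Suc.prems(2) that])
  qed (use Suc in auto)
qed

text \<open>When the derivative is built from the function itself, every degree of smoothness
  yields the next one.\<close>

lemma smooth_on_bootstrap:
  assumes "open U" "\<And>x. x \<in> U \<Longrightarrow> (f has_derivative D x) (at x)"
    and "\<And>n v. ck n U f \<Longrightarrow> ck n U (\<lambda>x. D x v)"
  shows "smooth_on U f"
proof -
  have "ck n U f" for n
  proof (induction n)
    case 0
    have "f differentiable (at x)" if "x \<in> U" for x
      using assms(2)[OF that] by (auto simp: differentiable_def)
    then show ?case
      by (simp add: continuous_at_imp_continuous_on differentiable_imp_continuous_within)
  next
    case (Suc n)
    then show ?case using ck_SucI assms by blast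
  qed
  then show ?thesis using smooth_on_iff_ck assms(1) by blast
qed

lemma smooth_on_open: "smooth_on U f \<Longrightarrow> open U"
  by (simp add: smooth_on_def)

lemma smooth_on_subset: "smooth_on U f \<Longrightarrow> open V \<Longrightarrow> V \<subseteq> U \<Longrightarrow> smooth_on V f"
  unfolding smooth_on_def by blast

lemma smooth_on_cong: "smooth_on U f \<Longrightarrow> (\<And>x. x \<in> U \<Longrightarrow> f x = g x) \<Longrightarrow> smooth_on U g"
  using ck_cong smooth_on_iff_ck by metis

lemma smooth_on_const: "open U \<Longrightarrow> smooth_on U (\<lambda>x. c)"
  by (simp add: smooth_on_iff_ck ck_const)

lemma smooth_on_linear: "open U \<Longrightarrow> bounded_linear L \<Longrightarrow> smooth_on U L"
  by (simp add: smooth_on_iff_ck ck_linear)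

lemma smooth_on_add: "smooth_on U f \<Longrightarrow> smooth_on U g \<Longrightarrow> smooth_on U (\<lambda>x. f x + g x)"
  by (simp add: smooth_on_iff_ck ck_add)

lemma smooth_on_mult:
  fixes f :: "'a::real_normed_vector \<Rightarrow> 'b::real_normed_algebra"
  shows "smooth_on U f \<Longrightarrow> smooth_on U g \<Longrightarrow> smooth_on U (\<lambda>x. f x * g x)"
  by (simp add: smooth_on_iff_ck ck_mult)

lemma smooth_on_Pair: "smooth_on U f \<Longrightarrow> smooth_on U g \<Longrightarrow> smooth_on U (\<lambda>x. (f x, g x))"
  by (simp add: smooth_on_iff_ck ck_Pair)

lemma smooth_on_compose:
  fixes f :: "'a::real_normed_vector \<Rightarrow> 'b::euclidean_space"
  shows "smooth_on V g \<Longrightarrow> smooth_on U f \<Longrightarrow> f ` U \<subseteq> V \<Longrightarrow> smooth_on U (\<lambda>x. g (f x))"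
  unfolding smooth_on_iff_ck using ck_compose by blast

lemma smooth_on_minus: "smooth_on U f \<Longrightarrow> smooth_on U (\<lambda>x. - f x)"
  for f :: "'a::real_normed_vector \<Rightarrow> real"
  using smooth_on_mult[OF smooth_on_const[of U "-1"], of f] smooth_on_open by auto

lemma smooth_on_diff: "smooth_on U f \<Longrightarrow> smooth_on U g \<Longrightarrow> smooth_on U (\<lambda>x. f x - g x)"
  for f :: "'a::real_normed_vector \<Rightarrow> real"
  using smooth_on_add[of U f "\<lambda>x. - g x"] smooth_on_minus[of U g] by simp

lemma smooth_on_power: "smooth_on U f \<Longrightarrow> smooth_on U (\<lambda>x. f x ^ n)"
  for f :: "'a::real_normed_vector \<Rightarrow> real"
  by (induction n) (auto intro: smooth_on_mult smooth_on_const smooth_on_open)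

lemma smooth_on_sum:
  "open U \<Longrightarrow> (\<And>i. i \<in> I \<Longrightarrow> smooth_on U (f i)) \<Longrightarrow> smooth_on U (\<lambda>x. \<Sum>i\<in>I. f i x)"
  by (simp add: smooth_on_iff_ck ck_sum)

lemma smooth_on_has_derivative:
  "smooth_on U f \<Longrightarrow> x \<in> U \<Longrightarrow> (f has_derivative frechet_derivative f (at x)) (at x)"
  by (meson ck_Suc_has_derivative smooth_on_iff_ck)

lemma smooth_on_directional:
  "smooth_on U f \<Longrightarrow> smooth_on U (\<lambda>x. frechet_derivative f (at x) v)"
  unfolding smooth_on_iff_ck by (metis ck.simps(2))

lemma smooth_on_continuous: "smooth_on U f \<Longrightarrow> continuous_on U f"
  by (meson ck_imp_continuous_on smooth_on_iff_ck)

lemma smooth_on_exp: "smooth_on UNIV (exp :: real \<Rightarrow> real)"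
  by (rule smooth_on_bootstrap[where D="\<lambda>x v. exp x * v"])
     (auto simp: has_field_derivative_def[symmetric] intro!: ck_mult ck_const derivative_eq_intros)

lemma smooth_on_inverse: "smooth_on (- {0}) (inverse :: real \<Rightarrow> real)"
proof (rule smooth_on_bootstrap[where D="\<lambda>x v. - (inverse x * v * inverse x)"])
  show "ck n (- {0}) (\<lambda>x. - (inverse x * v * inverse x))"
    if "ck n (- {0}) (inverse :: real \<Rightarrow> real)" for n and v :: real
    using ck_mult[OF open_Compl[OF closed_singleton]
        ck_mult[OF open_Compl[OF closed_singleton] that ck_const[of n _ "-v"]] that]
    by simp
qed (auto intro!: has_derivative_inverse')

lemma smooth_on_ln: "smooth_on {0<..} (ln :: real \<Rightarrow> real)"
proof (rule smooth_on_bootstrap[where D="\<lambda>x v. inverse x * v"])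
  have "ck n {0<..} (inverse :: real \<Rightarrow> real)" for n
    by (rule ck_subset[of n "-{0}"]) (use smooth_on_inverse in \<open>auto simp: smooth_on_iff_ck\<close>)
  then show "ck n {0<..} (\<lambda>x. inverse x * v)" for n and v :: real
    by (intro ck_mult ck_const) auto
qed (auto simp: has_field_derivative_def[symmetric] divide_inverse intro!: derivative_eq_intros)

lemma smooth_on_sqrt: "smooth_on {0<..} sqrt"
proof (rule smooth_on_cong)
  show "smooth_on {0<..} (\<lambda>x::real. exp ((1/2) * ln x))"
    by (rule smooth_on_compose[OF smooth_on_exp])
       (auto simp del: times_divide_eq_left intro!: smooth_on_mult smooth_on_ln smooth_on_const)
  show "exp ((1/2) * ln x) = sqrt x" if "x \<in> {0<..}" for x
    using that powr_half_sqrt[of x] by (simp add: powr_def)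
qed

subsection \<open>Germs\<close>

lemma smooth_germI: "smooth_on U f \<Longrightarrow> 0 \<in> U \<Longrightarrow> smooth_germ f"
  unfolding smooth_germ_def by blast

lemma smooth_germ_common_domain:
  assumes "smooth_germ f" "smooth_germ g"
  obtains U where "0 \<in> U" "smooth_on U f" "smooth_on U g"
proof -
  obtain U V where U: "0 \<in> U" "smooth_on U f" and V: "0 \<in> V" "smooth_on V g"
    using assms unfolding smooth_germ_def by blast
  have o: "open (U \<inter> V)" using U V by (simp add: open_Int smooth_on_open)
  show ?thesis
    using that[of "U \<inter> V"] smooth_on_subset[OF U(2) o] smooth_on_subset[OF V(2) o] U V by auto
qed

text \<open>Here \<open>f 0\<close> may differ from 0, as needed for \<open>sqrt\<close> and
  \<open>ln\<close>, which are smooth only away from the origin.\<close>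

lemma smooth_germ_compose_on:
  fixes f :: "'a::real_normed_vector \<Rightarrow> 'b::euclidean_space"
  assumes "smooth_on V g" "smooth_germ f" "f 0 \<in> V"
  shows "smooth_germ (\<lambda>x. g (f x))"
proof -
  obtain U where U: "0 \<in> U" "smooth_on U f" using assms(2) unfolding smooth_germ_def by blast
  have o: "open (U \<inter> f -` V)"
    using smooth_on_open[OF U(2)] smooth_on_open[OF assms(1)] smooth_on_continuous[OF U(2)]
    by (simp add: continuous_open_preimage)
  have "smooth_on (U \<inter> f -` V) (\<lambda>x. g (f x))"
    by (rule smooth_on_compose[OF assms(1) smooth_on_subset[OF U(2) o]]) auto
  then show ?thesis using U assms(3) by (auto intro: smooth_germI)
qed

lemma smooth_germ_compose:
  fixes f :: "'a::real_normed_vector \<Rightarrow> 'b::euclidean_space"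
  assumes "smooth_germ g" "smooth_germ f" "f 0 = 0"
  shows "smooth_germ (\<lambda>x. g (f x))"
  using assms smooth_germ_compose_on[of _ g f] by (auto simp: smooth_germ_def[of g])

lemma smooth_germ_const: "smooth_germ (\<lambda>x. c)"
  by (rule smooth_germI[of UNIV]) (auto intro: smooth_on_const)

lemma smooth_germ_linear: "bounded_linear L \<Longrightarrow> smooth_germ L"
  by (rule smooth_germI[of UNIV]) (auto intro: smooth_on_linear)

lemma smooth_germ_ident: "smooth_germ (\<lambda>x. x)"
  by (rule smooth_germ_linear) (rule bounded_linear_ident)

lemma smooth_germ_fst: "smooth_germ f \<Longrightarrow> smooth_germ (\<lambda>x. fst (f x))"
  for f :: "'a::real_normed_vector \<Rightarrow> 'b::euclidean_space \<times> 'c::euclidean_space"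
  by (rule smooth_germ_compose_on[of UNIV fst]) (auto intro!: smooth_on_linear bounded_linear_fst)

lemma smooth_germ_snd: "smooth_germ f \<Longrightarrow> smooth_germ (\<lambda>x. snd (f x))"
  for f :: "'a::real_normed_vector \<Rightarrow> 'b::euclidean_space \<times> 'c::euclidean_space"
  by (rule smooth_germ_compose_on[of UNIV snd]) (auto intro!: smooth_on_linear bounded_linear_snd)

lemma smooth_germ_add: "smooth_germ f \<Longrightarrow> smooth_germ g \<Longrightarrow> smooth_germ (\<lambda>x. f x + g x)"
  by (erule (1) smooth_germ_common_domain) (rule smooth_germI[OF smooth_on_add])

lemma smooth_germ_mult: "smooth_germ f \<Longrightarrow> smooth_germ g \<Longrightarrow> smooth_germ (\<lambda>x. f x * g x)"
  for f :: "'a::real_normed_vector \<Rightarrow> real"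
  by (erule (1) smooth_germ_common_domain) (rule smooth_germI[OF smooth_on_mult])

lemma smooth_germ_diff: "smooth_germ f \<Longrightarrow> smooth_germ g \<Longrightarrow> smooth_germ (\<lambda>x. f x - g x)"
  for f :: "'a::real_normed_vector \<Rightarrow> real"
  by (erule (1) smooth_germ_common_domain) (rule smooth_germI[OF smooth_on_diff])

lemma smooth_germ_minus: "smooth_germ f \<Longrightarrow> smooth_germ (\<lambda>x. - f x)"
  for f :: "'a::real_normed_vector \<Rightarrow> real"
  using smooth_germ_mult[OF smooth_germ_const[of "-1"]] by auto

lemma smooth_germ_power: "smooth_germ f \<Longrightarrow> smooth_germ (\<lambda>x. f x ^ n)"
  for f :: "'a::real_normed_vector \<Rightarrow> real"
  unfolding smooth_germ_def using smooth_on_power by blast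

lemma smooth_germ_Pair: "smooth_germ f \<Longrightarrow> smooth_germ g \<Longrightarrow> smooth_germ (\<lambda>x. (f x, g x))"
  by (erule (1) smooth_germ_common_domain) (rule smooth_germI[OF smooth_on_Pair])

lemma smooth_germ_sqrt: "smooth_germ f \<Longrightarrow> f 0 > 0 \<Longrightarrow> smooth_germ (\<lambda>x. sqrt (f x))"
  by (rule smooth_germ_compose_on[OF smooth_on_sqrt]) auto

lemma smooth_germ_ln: "smooth_germ f \<Longrightarrow> f 0 > 0 \<Longrightarrow> smooth_germ (\<lambda>x. ln (f x :: real))"
  by (rule smooth_germ_compose_on[OF smooth_on_ln]) auto

lemma smooth_germ_exp: "smooth_germ f \<Longrightarrow> smooth_germ (\<lambda>x. exp (f x :: real))"
  by (rule smooth_germ_compose_on[OF smooth_on_exp]) auto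

lemmas smooth_germ_intros = smooth_germ_const smooth_germ_ident smooth_germ_fst smooth_germ_snd
  smooth_germ_add smooth_germ_mult smooth_germ_diff smooth_germ_minus smooth_germ_power
  smooth_germ_Pair

lemma smooth_germ_has_derivative:
  "smooth_germ f \<Longrightarrow> (f has_derivative frechet_derivative f (at 0)) (at 0)"
  unfolding smooth_germ_def using smooth_on_has_derivative by blast

lemma smooth_germ_tendsto: "smooth_germ f \<Longrightarrow> (f \<longlongrightarrow> f 0) (nhds 0)"
  using smooth_germ_has_derivative[of f] has_derivative_continuous[of f _ 0 UNIV]
  by (simp add: continuous_at_imp_continuous_at_within continuous_within tendsto_at_iff_tendsto_nhds)

lemma smooth_germ_eventually_compose:
  assumes "smooth_germ f" "f 0 = 0" "\<forall>\<^sub>F y in nhds 0. P y"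
  shows "\<forall>\<^sub>F x in nhds 0. P (f x)"
  using smooth_germ_tendsto[OF assms(1)] assms(2,3) eventually_compose_filterlim by fastforce

section \<open>Partial derivatives of functions on the plane\<close>

definition pdx :: "(real \<times> real \<Rightarrow> real) \<Rightarrow> real \<times> real \<Rightarrow> real" where
  "pdx f p = frechet_derivative f (at p) (1, 0)"

definition pdy :: "(real \<times> real \<Rightarrow> real) \<Rightarrow> real \<times> real \<Rightarrow> real" where
  "pdy f p = frechet_derivative f (at p) (0, 1)"

lemma has_derivative_pdx_pdy:
  assumes "(f has_derivative f') (at p)"
  shows "(f has_derivative (\<lambda>v. pdx f p * fst v + pdy f p * snd v)) (at p)"
proof -
  have eq: "f' = frechet_derivative f (at p)" using assms frechet_derivative_at by blast
  interpret linear f' using assms has_derivative_linear by blast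
  have "f' v = pdx f p * fst v + pdy f p * snd v" for v
  proof -
    have "v = fst v *\<^sub>R (1, 0) + snd v *\<^sub>R (0, 1)" by (cases v) auto
    then have "f' v = fst v *\<^sub>R f' (1, 0) + snd v *\<^sub>R f' (0, 1)"
      by (metis add scale)
    then show ?thesis by (simp add: pdx_def pdy_def eq)
  qed
  then show ?thesis using assms by (metis (no_types, lifting) ext)
qed

lemma smooth_on_has_derivative_pd:
  "smooth_on U f \<Longrightarrow> p \<in> U \<Longrightarrow> (f has_derivative (\<lambda>v. pdx f p * fst v + pdy f p * snd v)) (at p)"
  using smooth_on_has_derivative has_derivative_pdx_pdy by blast

lemma smooth_germ_has_derivative_pd:
  "smooth_germ f \<Longrightarrow> (f has_derivative (\<lambda>v. pdx f 0 * fst v + pdy f 0 * snd v)) (at 0)"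
  using smooth_germ_has_derivative has_derivative_pdx_pdy by blast

lemma pd_eqI:
  assumes "(f has_derivative (\<lambda>v. a * fst v + b * snd v)) (at p)"
  shows "pdx f p = a" "pdy f p = b"
  using frechet_derivative_at[OF assms] unfolding pdx_def pdy_def
  by (metis (no_types, lifting) fst_conv snd_conv mult_zero_right mult.right_neutral add.right_neutral add_0)+

lemma smooth_on_pdx: "smooth_on U f \<Longrightarrow> smooth_on U (pdx f)"
  unfolding pdx_def[abs_def] by (rule smooth_on_directional)

lemma smooth_on_pdy: "smooth_on U f \<Longrightarrow> smooth_on U (pdy f)"
  unfolding pdy_def[abs_def] by (rule smooth_on_directional)

subsection \<open>Inverse function theorem\<close>

text \<open>With \<open>j\<close> the inverse determinant, the first two equations say that the
  adjugate formula is a left inverse and the last two that it is a right inverse. The former feeds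
  the inverse function theorem at 0, the latter identifies the derivative of the local inverse at
  nearby points.\<close>

lemma cramer_2x2:
  fixes j :: real
  assumes "j * (A * D - B * C) = 1"
  shows "j * (D * (A * x + B * y) - B * (C * x + D * y)) = x"
    and "j * (A * (C * x + D * y) - C * (A * x + B * y)) = y"
    and "A * (j * (D * x - B * y)) + B * (j * (A * y - C * x)) = x"
    and "C * (j * (D * x - B * y)) + D * (j * (A * y - C * x)) = y"
  using assms by algebra+

text \<open>The inverse function theorem supplies a differentiable local inverse \<open>g\<close>.
  By Cramer's rule its derivative at y is \<open>C v (g y)\<close> with \<open>C v\<close> smooth,
  so every order of smoothness of \<open>g\<close> yields the next.\<close>

lemma diffeo_germ_PairI:
  fixes a b :: "real \<times> real \<Rightarrow> real"
  assumes a: "smooth_germ a" "a 0 = 0" and b: "smooth_germ b" "b 0 = 0"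
    and J: "pdx a 0 * pdy b 0 - pdy a 0 * pdx b 0 \<noteq> 0"
  shows "diffeo_germ (\<lambda>p. (a p, b p))"
proof -
  define H where "H = (\<lambda>p. (a p, b p))"
  obtain U where U: "0 \<in> U" "smooth_on U a" "smooth_on U b"
    using smooth_germ_common_domain[OF a(1) b(1)] by blast
  have oU: "open U" using U smooth_on_open by blast
  define H' where "H' p = (\<lambda>v. (pdx a p * fst v + pdy a p * snd v, pdx b p * fst v + pdy b p * snd v))" for p
  have bl: "bounded_linear (H' p)" for p
    unfolding H'_def by (intro bounded_linear_intros)
  have derH: "(H has_derivative H' p) (at p)" if "p \<in> U" for p
    unfolding H_def H'_def using U that by (intro has_derivative_Pair smooth_on_has_derivative_pd)
  define D where "D p = Blinfun (H' p)" for p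
  have D: "blinfun_apply (D p) = H' p" for p
    unfolding D_def using bl by (simp add: bounded_linear_Blinfun_apply)
  define j where "j = inverse (pdx a 0 * pdy b 0 - pdy a 0 * pdx b 0)"
  define G' where "G' = (\<lambda>v::real\<times>real. (j * (pdy b 0 * fst v - pdy a 0 * snd v), j * (pdx a 0 * snd v - pdx b 0 * fst v)))"
  have blG: "bounded_linear G'" unfolding G'_def by (intro bounded_linear_intros bounded_linear_const_mult bounded_linear_sub)
  have inv: "Blinfun G' o\<^sub>L D 0 = id_blinfun"
  proof (rule blinfun_eqI)
    fix v
    have "j * (pdx a 0 * pdy b 0 - pdy a 0 * pdx b 0) = 1" using J by (simp add: j_def)
    then have "G' (H' 0 v) = v"
      unfolding G'_def H'_def by (simp only: fst_conv snd_conv cramer_2x2 prod.collapse)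
    then show "blinfun_apply (Blinfun G' o\<^sub>L D 0) v = blinfun_apply id_blinfun v"
      using blG by (simp add: D bounded_linear_Blinfun_apply)
  qed
  have cont: "continuous_on U D"
  proof (rule continuous_on_blinfun_componentwise)
    fix i :: "real \<times> real"
    show "continuous_on U (\<lambda>x. blinfun_apply (D x) i)"
      unfolding D H'_def
      by (intro continuous_intros smooth_on_continuous smooth_on_pdx smooth_on_pdy U)
  qed
  obtain U' V g g' where U': "open U'" "U' \<subseteq> U" "0 \<in> U'" and V: "open V" "H 0 \<in> V"
    and hom: "homeomorphism U' V H g"
    and derg: "\<And>y. y \<in> V \<Longrightarrow> (g has_derivative (g' y)) (at y)"
    and g': "\<And>y. y \<in> V \<Longrightarrow> g' y = inv (blinfun_apply (D (g y)))"
    and bij: "\<And>y. y \<in> V \<Longrightarrow> bij (blinfun_apply (D (g y)))"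
    using inverse_function_theorem[OF oU derH[folded D] cont U(1) inv] by metis
  have H0: "H 0 = 0" using a b by (simp add: H_def zero_prod_def)
  have gV: "g y \<in> U'" "H (g y) = y" if "y \<in> V" for y
    using hom that unfolding homeomorphism_def by auto
  have HU: "H x \<in> V" "g (H x) = x" if "x \<in> U'" for x
    using hom that unfolding homeomorphism_def by auto
  define det where "det p = pdx a p * pdy b p - pdy a p * pdx b p" for p
  have det: "det (g y) \<noteq> 0" if "y \<in> V" for y
  proof
    assume 0: "det (g y) = 0"
    have inj: "inj (H' (g y))" using bij[OF that] D by (simp add: bij_def)
    let ?p = "g y"
    \<comment> \<open>Up to sign these are the columns of the adjugate matrix. If the determinant
      vanished they would lie in the kernel, and injectivity would force all four partial
      derivatives to be 0.\<close>
    have "H' ?p (pdy b ?p, - pdx b ?p) = H' ?p 0" "H' ?p (pdy a ?p, - pdx a ?p) = H' ?p 0"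
      using 0 by (auto simp: H'_def det_def mult.commute)
    then have "(pdy b ?p, - pdx b ?p) = 0" "(pdy a ?p, - pdx a ?p) = 0"
      using inj by (metis injD)+
    then have "H' ?p (1,0) = H' ?p 0" by (simp add: H'_def zero_prod_def)
    then show False using inj by (metis injD Pair_inject zero_neq_one zero_prod_def)
  qed
  define C where "C v p = (inverse (det p) * (pdy b p * fst v - pdy a p * snd v),
      inverse (det p) * (pdx a p * snd v - pdx b p * fst v))" for v p
  have g'_eq: "g' y v = C v (g y)" if "y \<in> V" for y v
  proof -
    have "inverse (det (g y)) * (pdx a (g y) * pdy b (g y) - pdy a (g y) * pdx b (g y)) = 1"
      using det[OF that] by (simp add: det_def)
    then have "H' (g y) (C v (g y)) = v"
      unfolding H'_def C_def by (simp only: fst_conv snd_conv cramer_2x2 prod.collapse)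
    then show ?thesis
      using g'[OF that] bij[OF that] D by (metis bij_inv_eq_iff)
  qed
  have smg: "smooth_on V g"
  proof (rule smooth_on_bootstrap[OF V(1)])
    show "(g has_derivative (\<lambda>v. C v (g y))) (at y)" if "y \<in> V" for y
      using derg[OF that] g'_eq[OF that] by (metis (no_types, lifting) ext)
    show "ck n V (\<lambda>y. C v (g y))" if "ck n V g" for n v
    proof (rule ck_compose[OF V(1) _ _ that])
      define W where "W = U \<inter> det -` (- {0})"
      have smdet: "smooth_on U det" unfolding det_def[abs_def]
        by (intro smooth_on_diff smooth_on_mult smooth_on_pdx smooth_on_pdy U)
      show "open W" unfolding W_def
        using smooth_on_continuous[OF smdet] oU by (simp add: continuous_open_preimage open_Compl)
      then have sub: "smooth_on W f" if "smooth_on U f" for f :: "real \<times> real \<Rightarrow> real"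
        using that smooth_on_subset W_def by blast
      have "smooth_on W (\<lambda>p. inverse (det p))"
        by (rule smooth_on_compose[OF smooth_on_inverse sub[OF smdet]]) (auto simp: W_def)
      moreover have "smooth_on W (pdx a)" "smooth_on W (pdy a)" "smooth_on W (pdx b)" "smooth_on W (pdy b)"
        by (intro sub smooth_on_pdx smooth_on_pdy U)+
      ultimately have "smooth_on W (C v)" unfolding C_def[abs_def]
        by (intro smooth_on_Pair smooth_on_mult smooth_on_diff smooth_on_const \<open>open W\<close>)
      then show "ck n W (C v)" using smooth_on_iff_ck by blast
      show "g ` V \<subseteq> W" using gV det U'(2) by (auto simp: W_def)
    qed
  qed
  have "\<forall>\<^sub>F x in nhds 0. g (H x) = x" "\<forall>\<^sub>F y in nhds 0. H (g y) = y"
    using U' V gV HU H0 by (auto simp: eventually_nhds)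
  moreover have "g 0 = 0" using HU(2)[OF U'(3)] H0 by simp
  moreover have "smooth_germ H" unfolding H_def by (intro smooth_germ_Pair a b)
  moreover have "smooth_germ g" using smg V H0 smooth_germI by metis
  ultimately show ?thesis using H0 unfolding diffeo_germ_def H_def[symmetric] by blast
qed

text \<open>Crossing \<open>h\<close> with the identity reduces the line to the plane; the inverse
  on the line is the first component of the planar inverse along the first axis.\<close>

lemma diffeo_germ_realI:
  fixes h :: "real \<Rightarrow> real"
  assumes h: "smooth_germ h" "h 0 = 0" and d: "(h has_real_derivative c) (at 0)" "c \<noteq> 0"
  shows "diffeo_germ h"
proof -
  define H where "H = (\<lambda>p::real\<times>real. (h (fst p), snd p))"
  have d1: "((\<lambda>p. h (fst p)) has_derivative (\<lambda>v. c * fst v + 0 * snd v)) (at (0::real\<times>real))"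
    using has_derivative_compose[OF has_derivative_fst[OF has_derivative_ident], of h "\<lambda>v. c * v" "0::real\<times>real" UNIV] d(1)
    by (simp add: has_field_derivative_def)
  have d2: "(snd has_derivative (\<lambda>v. 0 * fst v + 1 * snd v)) (at (0::real\<times>real))"
    by (auto intro!: derivative_eq_intros)
  have "diffeo_germ H" unfolding H_def
    by (rule diffeo_germ_PairI)
       (use d(2) h in \<open>auto simp: pd_eqI[OF d1] pd_eqI[OF d2] intro!: smooth_germ_intros smooth_germ_compose[OF h(1)]\<close>)
  then obtain G where G: "G 0 = 0" "smooth_germ G" "\<forall>\<^sub>F x in nhds 0. G (H x) = x"
      "\<forall>\<^sub>F y in nhds 0. H (G y) = y" unfolding diffeo_germ_def by blast
  define g where "g t = fst (G (t, 0))" for t :: real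
  have sg: "smooth_germ g" unfolding g_def[abs_def]
    by (intro smooth_germ_fst smooth_germ_compose[OF G(2)] smooth_germ_intros)
       (simp add: zero_prod_def)
  have emb: "smooth_germ (\<lambda>t::real. (t, 0::real))" by (intro smooth_germ_intros)
  have "\<forall>\<^sub>F t in nhds 0. h (g t) = t"
    using smooth_germ_eventually_compose[OF emb _ G(4)]
    by (rule eventually_mono) (auto simp: H_def g_def zero_prod_def)
  moreover have "\<forall>\<^sub>F t in nhds 0. g (h t) = t"
    using smooth_germ_eventually_compose[OF emb _ G(3)]
    by (rule eventually_mono) (auto simp: H_def g_def zero_prod_def)
  moreover have "g 0 = 0" using G(1) by (simp add: g_def zero_prod_def)
  ultimately show ?thesis using h sg unfolding diffeo_germ_def by blast
qed

section \<open>Composition, inversion and derivatives of diffeomorphism germs\<close>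

lemma diffeo_germ_compose:
  fixes f g :: "'a::euclidean_space \<Rightarrow> 'a"
  assumes "diffeo_germ f" "diffeo_germ g"
  shows "diffeo_germ (\<lambda>x. g (f x))"
proof -
  obtain f' where f: "f 0 = 0" "smooth_germ f" "f' 0 = 0" "smooth_germ f'"
    "\<forall>\<^sub>F x in nhds 0. f' (f x) = x" "\<forall>\<^sub>F y in nhds 0. f (f' y) = y"
    using assms(1) unfolding diffeo_germ_def by blast
  obtain g' where g: "g 0 = 0" "smooth_germ g" "g' 0 = 0" "smooth_germ g'"
    "\<forall>\<^sub>F x in nhds 0. g' (g x) = x" "\<forall>\<^sub>F y in nhds 0. g (g' y) = y"
    using assms(2) unfolding diffeo_germ_def by blast
  have "\<forall>\<^sub>F x in nhds 0. f' (g' (g (f x))) = x"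
    using smooth_germ_eventually_compose[OF f(2,1) g(5)] f(5) by eventually_elim simp
  moreover have "\<forall>\<^sub>F x in nhds 0. g (f (f' (g' x))) = x"
    using smooth_germ_eventually_compose[OF g(4,3) f(6)] g(6) by eventually_elim simp
  moreover have "smooth_germ (\<lambda>x. g (f x))" "smooth_germ (\<lambda>x. f' (g' x))"
    using f g by (auto intro: smooth_germ_compose)
  ultimately show ?thesis unfolding diffeo_germ_def using f g
    by (intro conjI exI[of _ "\<lambda>x. f' (g' x)"]) auto
qed

lemma diffeo_germ_inverse:
  assumes "diffeo_germ f"
  obtains g where "diffeo_germ g" "\<forall>\<^sub>F x in nhds 0. g (f x) = x" "\<forall>\<^sub>F y in nhds 0. f (g y) = y"
  using assms unfolding diffeo_germ_def by blast

lemma diffeo_germ_smooth: "diffeo_germ f \<Longrightarrow> smooth_germ f"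
  and diffeo_germ_zero: "diffeo_germ f \<Longrightarrow> f 0 = 0"
  by (auto simp: diffeo_germ_def)

lemma diffeo_germ_inj_derivative:
  fixes f :: "'a::euclidean_space \<Rightarrow> 'a"
  assumes "diffeo_germ f" "(f has_derivative D) (at 0)"
  shows "inj D" "surj D"
proof -
  obtain g where g: "diffeo_germ g" "\<forall>\<^sub>F x in nhds 0. g (f x) = x"
    using diffeo_germ_inverse[OF assms(1)] by metis
  have f0: "f 0 = 0" using assms(1) by (rule diffeo_germ_zero)
  define E where "E = frechet_derivative g (at 0)"
  have "(g has_derivative E) (at (f 0))"
    unfolding E_def f0 by (rule smooth_germ_has_derivative[OF diffeo_germ_smooth[OF g(1)]])
  from has_derivative_compose[OF assms(2) this]
  have 1: "((\<lambda>x. g (f x)) has_derivative (\<lambda>v. E (D v))) (at 0)" .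
  obtain S where S: "open S" "0 \<in> S" "\<And>x. x \<in> S \<Longrightarrow> g (f x) = x"
    using g(2) unfolding eventually_nhds by blast
  have "((\<lambda>x. x) has_derivative (\<lambda>v. E (D v))) (at 0)"
    by (rule has_derivative_transform_within_open[OF 1 S(1,2)]) (use S in auto)
  then have "E (D v) = v" for v
    using has_derivative_unique[OF _ has_derivative_ident, of _ 0] by metis
  then show "inj D" by (metis injI)
  moreover have "linear D" using assms(2) has_derivative_linear by blast
  ultimately show "surj D" using linear_injective_imp_surjective by blast
qed

subsection \<open>Hadamard division\<close>

lemma ck_Suc_pdI:
  assumes "open U" "\<And>p. p \<in> U \<Longrightarrow> (f has_derivative (\<lambda>v. fx p * fst v + fy p * snd v)) (at p)"
    and "ck n U fx" "ck n U fy"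
  shows "ck (Suc n) U (f :: real \<times> real \<Rightarrow> real)"
  by (rule ck_SucI[OF assms(1,2)]) (auto intro!: ck_add ck_mult ck_const assms)

lemma ck_Suc_pd:
  assumes "ck (Suc n) U f"
  shows "ck n U (pdx f)" "ck n U (pdy f)"
  using assms by (auto simp: pdx_def[abs_def] pdy_def[abs_def])

text \<open>Differentiating \<open>\<phi> (x, t * y)\<close> in y brings out a factor t, so the
  induction has to be carried out for all weights t^m at once.\<close>

lemma ck_fiber_integral:
  fixes \<phi> :: "real \<times> real \<Rightarrow> real"
  assumes U: "open U" "convex U" and star: "\<And>x y t. (x, y) \<in> U \<Longrightarrow> 0 \<le> t \<Longrightarrow> t \<le> 1 \<Longrightarrow> (x, t * y) \<in> U"
    and "ck n U \<phi>"
  shows "ck n U (\<lambda>p. integral (cbox 0 1) (\<lambda>t. t ^ m * \<phi> (fst p, t * snd p)))"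
  using assms(4)
proof (induction n arbitrary: \<phi> m)
  have contI: "continuous_on (U \<times> cbox 0 1) (\<lambda>(p, t). t ^ k * \<psi> (fst p, t * snd p))"
    if "continuous_on U \<psi>" for k :: nat and \<psi> :: "real \<times> real \<Rightarrow> real"
    unfolding case_prod_unfold
    by (intro continuous_intros continuous_on_compose2[OF that])
       (auto simp: mem_box intro!: star)
  {
    case 0
    then show ?case using integral_continuous_on_param[OF contI] by simp
  next
    case (Suc n)
    have c: "continuous_on U \<phi>" "continuous_on U (pdx \<phi>)" "continuous_on U (pdy \<phi>)"
      using Suc.prems ck_imp_continuous_on ck_Suc_pd by blast+
    \<comment> \<open>The derivative of the integrand in p, packaged as a bounded linear map, so
      that it can be integrated over t as in the Leibniz rule and evaluated at a vector
      afterwards.\<close>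
    define fx :: "real \<times> real \<Rightarrow> real \<Rightarrow> (real \<times> real) \<Rightarrow>\<^sub>L real" where "fx p t = (t ^ m * pdx \<phi> (fst p, t * snd p)) *\<^sub>R fst_blinfun
        + (t ^ Suc m * pdy \<phi> (fst p, t * snd p)) *\<^sub>R snd_blinfun" for p :: "real \<times> real" and t :: real
    have contfx: "continuous_on (U \<times> cbox 0 1) (\<lambda>(p, t). fx p t)"
      using contI[OF c(2), of m] contI[OF c(3), of "Suc m"]
      unfolding fx_def case_prod_unfold
      by (intro continuous_on_add continuous_on_scaleR continuous_on_const)
    have sect: "continuous_on (cbox 0 1) (h p)"
      if "continuous_on (U \<times> cbox 0 1) (\<lambda>(p, t). h p t)" "p \<in> U"
      for h :: "real \<times> real \<Rightarrow> real \<Rightarrow> 'z::real_normed_vector" and p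
    proof -
      have "continuous_on (cbox 0 1) (\<lambda>t. (\<lambda>(p, t). h p t) (p, t))"
        by (rule continuous_on_compose2[OF that(1)]) (use that(2) in \<open>auto intro!: continuous_intros\<close>)
      then show ?thesis by simp
    qed
    let ?I = "\<lambda>k \<psi> p. integral (cbox 0 1) (\<lambda>t. t ^ k * \<psi> (fst p, t * snd p))"
    show ?case
    proof (rule ck_Suc_pdI[OF U(1)])
      fix p assume p: "p \<in> U"
      have "((\<lambda>p. ?I m \<phi> p) has_derivative blinfun_apply (integral (cbox 0 1) (fx p))) (at p within U)"
      proof (rule leibniz_rule[OF _ _ contfx p U(2)])
        fix q :: "real \<times> real" and t :: real assume q: "q \<in> U" and t: "t \<in> cbox 0 1"
        have "(fst q, t * snd q) \<in> U" using star[of "fst q" "snd q" t] q t by (auto simp: mem_box)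
        then have d\<phi>: "(\<phi> has_derivative (\<lambda>v. pdx \<phi> (fst q, t * snd q) * fst v + pdy \<phi> (fst q, t * snd q) * snd v))
            (at (fst q, t * snd q))"
          by (rule has_derivative_pdx_pdy[OF ck_Suc_has_derivative[OF Suc.prems]])
        have "((\<lambda>v. (fst v, t * snd v)) has_derivative (\<lambda>v. (fst v, t * snd v))) (at q)"
          by (auto intro!: derivative_eq_intros)
        from has_derivative_compose[OF this d\<phi>]
        have "((\<lambda>q. \<phi> (fst q, t * snd q)) has_derivative
          (\<lambda>v. pdx \<phi> (fst q, t * snd q) * fst v + pdy \<phi> (fst q, t * snd q) * (t * snd v))) (at q)"
          by simp
        from has_derivative_mult_right[OF this, of "t ^ m"]
        have "((\<lambda>q. t ^ m * \<phi> (fst q, t * snd q)) has_derivative blinfun_apply (fx q t)) (at q)"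
          by (rule has_derivative_eq_rhs)
             (auto simp: fx_def blinfun.add_left blinfun.scaleR_left algebra_simps)
        then show "((\<lambda>q. t ^ m * \<phi> (fst q, t * snd q)) has_derivative blinfun_apply (fx q t)) (at q within U)"
          by (rule has_derivative_at_withinI)
      next
        fix q assume "q \<in> U"
        then show "(\<lambda>t. t ^ m * \<phi> (fst q, t * snd q)) integrable_on cbox 0 1"
          by (intro integrable_continuous sect[OF contI[OF c(1)]])
      qed
      then have d: "(?I m \<phi> has_derivative blinfun_apply (integral (cbox 0 1) (fx p))) (at p)"
        using at_within_open[OF p U(1)] by simp
      have "blinfun_apply (integral (cbox 0 1) (fx p)) v = ?I m (pdx \<phi>) p * fst v + ?I (Suc m) (pdy \<phi>) p * snd v" for v
      proof -
        have i: "fx p integrable_on cbox 0 1"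
          by (intro integrable_continuous sect[OF contfx] p)
        have i1: "(\<lambda>t. t ^ m * pdx \<phi> (fst p, t * snd p) * fst v) integrable_on cbox 0 1"
          by (intro integrable_on_mult_left integrable_continuous sect[OF contI[OF c(2)]] p)
        have i2: "(\<lambda>t. t ^ Suc m * pdy \<phi> (fst p, t * snd p) * snd v) integrable_on cbox 0 1"
          by (intro integrable_on_mult_left integrable_continuous sect[OF contI[OF c(3)]] p)
        have "blinfun_apply (integral (cbox 0 1) (fx p)) v = integral (cbox 0 1) (\<lambda>t. blinfun_apply (fx p t) v)"
          by (rule blinfun_apply_integral[OF i])
        also have "\<dots> = integral (cbox 0 1) (\<lambda>t. t ^ m * pdx \<phi> (fst p, t * snd p) * fst v
            + t ^ Suc m * pdy \<phi> (fst p, t * snd p) * snd v)"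
          by (simp add: fx_def blinfun.add_left blinfun.scaleR_left)
        also have "\<dots> = integral (cbox 0 1) (\<lambda>t. t ^ m * pdx \<phi> (fst p, t * snd p) * fst v)
            + integral (cbox 0 1) (\<lambda>t. t ^ Suc m * pdy \<phi> (fst p, t * snd p) * snd v)"
          by (rule integral_add[OF i1 i2])
        finally show ?thesis by (simp only: integral_mult_left)
      qed
      then show "(?I m \<phi> has_derivative (\<lambda>v. ?I m (pdx \<phi>) p * fst v + ?I (Suc m) (pdy \<phi>) p * snd v)) (at p)"
        using d by presburger
    qed (use Suc.IH ck_Suc_pd[OF Suc.prems] in blast)+
  }
qed

text \<open>Integrate the derivative of t \<mapsto> f (x, t y) over [0, 1]: the chain rule makes y a
  common factor, and what remains is the integral of \<open>pdy f\<close> along the vertical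
  segment, which the star condition keeps inside \<open>U\<close>.\<close>

lemma hadamard_division:
  fixes f :: "real \<times> real \<Rightarrow> real"
  assumes U: "convex U" and star: "\<And>x y t. (x, y) \<in> U \<Longrightarrow> 0 \<le> t \<Longrightarrow> t \<le> 1 \<Longrightarrow> (x, t * y) \<in> U"
    and f: "smooth_on U f" and zero: "\<And>x. (x, 0) \<in> U \<Longrightarrow> f (x, 0) = 0"
  obtains g where "smooth_on U g" "\<And>x y. (x, y) \<in> U \<Longrightarrow> f (x, y) = y * g (x, y)"
    "\<And>x. (x, 0) \<in> U \<Longrightarrow> g (x, 0) = pdy f (x, 0)"
proof
  \<comment> \<open>The factor \<open>t ^ 0\<close> only brings the integrand into the form of
    \<open>ck_fiber_integral\<close>.\<close>
  define g where "g p = integral (cbox 0 1) (\<lambda>t. t ^ 0 * pdy f (fst p, t * snd p))" for p :: "real \<times> real"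
  have oU: "open U" using f by (rule smooth_on_open)
  show "smooth_on U g"
    unfolding smooth_on_iff_ck g_def[abs_def]
    by (intro conjI allI oU ck_fiber_integral[OF oU U star])
       (use smooth_on_pdy[OF f] in \<open>auto simp: smooth_on_iff_ck\<close>)
  show "g (x, 0) = pdy f (x, 0)" for x by (simp add: g_def)
  show "f (x, y) = y * g (x, y)" if p: "(x, y) \<in> U" for x y
  proof -
    have "((\<lambda>t. y * pdy f (x, t * y)) has_integral (f (x, 1 * y) - f (x, 0 * y))) {0..1}"
    proof (rule fundamental_theorem_of_calculus)
      fix t :: real assume t: "t \<in> {0..1}"
      have "((\<lambda>t. (x, t * y)) has_derivative (\<lambda>s. (0, s * y))) (at t)"
        by (auto intro!: derivative_eq_intros)
      from has_derivative_compose[OF this smooth_on_has_derivative_pd[OF f, of "(x, t * y)"]]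
      have "((\<lambda>t. f (x, t * y)) has_derivative (\<lambda>s. pdy f (x, t * y) * (s * y))) (at t)"
        using star[OF p, of t] t by simp
      then have "((\<lambda>t. f (x, t * y)) has_derivative (\<lambda>s. s *\<^sub>R (y * pdy f (x, t * y)))) (at t)"
        by (rule has_derivative_eq_rhs) (simp add: mult_ac)
      then show "((\<lambda>t. f (x, t * y)) has_vector_derivative y * pdy f (x, t * y)) (at t within {0..1})"
        unfolding has_vector_derivative_def by (rule has_derivative_at_withinI)
    qed simp
    then have "integral {0..1} (\<lambda>t. y * pdy f (x, t * y)) = f (x, 1 * y) - f (x, 0 * y)"
      by (rule integral_unique)
    moreover have "f (x, 0) = 0" using zero star[OF p, of 0] by simp
    ultimately show ?thesis by (simp add: g_def)
  qed
qed

lemma smooth_germ_box: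
  fixes f :: "real \<times> real \<Rightarrow> 'a::real_normed_vector"
  assumes "smooth_germ f"
  obtains r where "r > 0" "smooth_on ({-r<..<r} \<times> {-r<..<r}) f"
proof -
  obtain U where U: "0 \<in> U" "smooth_on U f" using assms unfolding smooth_germ_def by blast
  have "open U" using U smooth_on_open by blast
  then obtain A B where AB: "open A" "open B" "(0::real, 0::real) \<in> A \<times> B" "A \<times> B \<subseteq> U"
    using U(1) open_prod_elim[of U 0] by (metis zero_prod_def)
  obtain a where a: "a > 0" "\<And>x. \<bar>x\<bar> < a \<Longrightarrow> x \<in> A"
    using AB(1,3) unfolding open_dist dist_real_def by (auto simp: abs_minus_commute)
  obtain b where b: "b > 0" "\<And>x. \<bar>x\<bar> < b \<Longrightarrow> x \<in> B"
    using AB(2,3) unfolding open_dist dist_real_def by (auto simp: abs_minus_commute)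
  let ?r = "min a b"
  have "{-?r<..<?r} \<times> {-?r<..<?r} \<subseteq> A \<times> B" using a(2) b(2) by auto
  then have "{-?r<..<?r} \<times> {-?r<..<?r} \<subseteq> U" using AB(4) by blast
  then show ?thesis
    using that[of ?r] smooth_on_subset[OF U(2)] a b by (simp add: open_Times)
qed

lemma eventually_box:
  assumes "r > 0" "\<And>x y. \<bar>x\<bar> < r \<Longrightarrow> \<bar>y\<bar> < r \<Longrightarrow> P (x, y)"
  shows "\<forall>\<^sub>F p in nhds (0 :: real \<times> real). P p"
  unfolding eventually_nhds
  by (rule exI[of _ "{-r<..<r} \<times> {-r<..<r}"]) (use assms in \<open>auto simp: open_Times zero_prod_def\<close>)

lemma star_box: "(x, y) \<in> A \<times> {-r<..<r} \<Longrightarrow> 0 \<le> t \<Longrightarrow> t \<le> 1 \<Longrightarrow> (x, t * y) \<in> A \<times> {-r<..<r::real}"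
proof -
  assume a: "(x, y) \<in> A \<times> {-r<..<r}" "0 \<le> t" "t \<le> 1"
  then have "\<bar>t * y\<bar> \<le> \<bar>y\<bar>" by (simp add: abs_mult mult_left_le_one_le)
  then show ?thesis using a by auto
qed

lemma hadamard_division_germ:
  fixes f :: "real \<times> real \<Rightarrow> real"
  assumes f: "smooth_germ f" and zero: "\<forall>\<^sub>F x in nhds 0. f (x, 0) = 0"
  obtains g where "smooth_germ g" "\<forall>\<^sub>F p in nhds 0. f p = snd p * g p" "g 0 = pdy f 0"
proof -
  obtain s where s: "s > 0" "smooth_on ({-s<..<s} \<times> {-s<..<s}) f" by (rule smooth_germ_box[OF f])
  obtain d where d: "d > 0" "\<And>x. \<bar>x\<bar> < d \<Longrightarrow> f (x, 0) = 0"
    using zero unfolding eventually_nhds_metric dist_real_def by auto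
  define r where "r = min s d"
  let ?U = "{-r<..<r} \<times> {-r<..<r}"
  have sm: "smooth_on ?U f" by (rule smooth_on_subset[OF s(2)]) (auto simp: r_def open_Times)
  have r: "r > 0" using s d by (simp add: r_def)
  obtain g where g: "smooth_on ?U g" "\<And>x y. (x, y) \<in> ?U \<Longrightarrow> f (x, y) = y * g (x, y)"
      "\<And>x. (x, 0) \<in> ?U \<Longrightarrow> g (x, 0) = pdy f (x, 0)"
  proof (rule hadamard_division[OF _ _ sm])
    show "convex ?U" by (intro convex_Times) auto
    show "(x, t * y) \<in> ?U" if "(x, y) \<in> ?U" "0 \<le> t" "t \<le> 1" for x y t
      using that by (rule star_box)
  qed (use d in \<open>auto simp: r_def\<close>)
  show ?thesis
  proof (rule that)
    show "smooth_germ g" by (rule smooth_germI[OF g(1)]) (use r in \<open>auto simp: zero_prod_def\<close>)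
    show "\<forall>\<^sub>F p in nhds 0. f p = snd p * g p"
      by (rule eventually_box[OF r]) (auto intro!: g(2))
    show "g 0 = pdy f 0" using g(3)[of 0] r by (simp add: zero_prod_def)
  qed
qed

subsection \<open>Gluing flat functions\<close>

text \<open>This rewrites a function of the source variable y in the target variable Y = y^2 of the
  fold. The half plane Y < 0, which the fold does not reach, receives the value 0.\<close>

definition half_plane_glue :: "(real \<times> real \<Rightarrow> real) \<Rightarrow> real \<times> real \<Rightarrow> real" where
  "half_plane_glue z p = (if snd p > 0 then z (fst p, sqrt (snd p)) else 0)"

text \<open>Flatness along y = 0 is expressed by smooth divisibility by all powers of y instead of
  vanishing derivatives. Differentiation and division by y then act on the quotients, without
  estimates, and the case n = 0 contains smoothness itself.\<close>

definition flat_on :: "(real \<times> real) set \<Rightarrow> (real \<times> real \<Rightarrow> real) \<Rightarrow> bool" where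
  "flat_on U z \<longleftrightarrow> (\<forall>n. \<exists>w. smooth_on U w \<and> (\<forall>p\<in>U. z p = snd p ^ n * w p))"

lemma flat_on_smooth: "flat_on U z \<Longrightarrow> smooth_on U z"
  unfolding flat_on_def by (drule spec[of _ 0]) (auto intro: smooth_on_cong)

lemma flat_on_pdx:
  assumes "flat_on U z" shows "flat_on U (pdx z)"
  unfolding flat_on_def
proof
  fix n
  obtain w where w: "smooth_on U w" "\<And>p. p \<in> U \<Longrightarrow> z p = snd p ^ n * w p"
    using assms unfolding flat_on_def by blast
  have "pdx z p = snd p ^ n * pdx w p" if p: "p \<in> U" for p
  proof -
    have "((\<lambda>p. snd p ^ n * w p) has_derivative (\<lambda>v. (snd p ^ n * pdx w p) * fst v
        + (snd p ^ n * pdy w p + of_nat n * snd p ^ (n - 1) * w p) * snd v)) (at p)"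
      by (rule has_derivative_eq_rhs)
         (rule derivative_intros smooth_on_has_derivative_pd[OF w(1) p] refl | auto simp: algebra_simps)+
    then have "(z has_derivative (\<lambda>v. (snd p ^ n * pdx w p) * fst v
        + (snd p ^ n * pdy w p + of_nat n * snd p ^ (n - 1) * w p) * snd v)) (at p)"
      by (rule has_derivative_transform_within_open[OF _ smooth_on_open[OF w(1)] p]) (simp add: w(2))
    then show ?thesis by (rule pd_eqI)
  qed
  then show "\<exists>w. smooth_on U w \<and> (\<forall>p\<in>U. pdx z p = snd p ^ n * w p)"
    using smooth_on_pdx[OF w(1)] by blast
qed

text \<open>The operator d/dY in the target becomes (1 / 2y) d/dy in the source when Y = y^2; flat
  functions are closed under it.\<close>

lemma flat_on_pdy_div:
  assumes "flat_on U z" shows "flat_on U (\<lambda>p. pdy z p / (2 * snd p))"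
  unfolding flat_on_def
proof
  fix n
  \<comment> \<open>One power is lost to differentiation and one to division. The third makes
    \<open>w'\<close> vanish at y = 0, in agreement with the value 0 of a division by zero even when
    n = 0.\<close>
  obtain w where w: "smooth_on U w" "\<And>p. p \<in> U \<Longrightarrow> z p = snd p ^ (n + 3) * w p"
    using assms unfolding flat_on_def by blast
  define w' where "w' p = (snd p ^ 2 * pdy w p + of_nat (n + 3) * (snd p * w p)) * (1/2)" for p
  have "pdy z p / (2 * snd p) = snd p ^ n * w' p" if p: "p \<in> U" for p
  proof -
    have "((\<lambda>p. snd p ^ (n + 3) * w p) has_derivative (\<lambda>v. (snd p ^ (n + 3) * pdx w p) * fst v
        + (snd p ^ (n + 3) * pdy w p + of_nat (n + 3) * snd p ^ (n + 3 - 1) * w p) * snd v)) (at p)"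
      by (rule has_derivative_eq_rhs)
         (rule derivative_intros smooth_on_has_derivative_pd[OF w(1) p] refl | auto simp: algebra_simps)+
    then have "(z has_derivative (\<lambda>v. (snd p ^ (n + 3) * pdx w p) * fst v
        + (snd p ^ (n + 3) * pdy w p + of_nat (n + 3) * snd p ^ (n + 3 - 1) * w p) * snd v)) (at p)"
      by (rule has_derivative_transform_within_open[OF _ smooth_on_open[OF w(1)] p]) (simp add: w(2))
    then have "pdy z p = snd p ^ (n + 3) * pdy w p + of_nat (n + 3) * snd p ^ (n + 3 - 1) * w p"
      by (rule pd_eqI)
    also have "\<dots> = snd p ^ (n + 3) * pdy w p + of_nat (n + 3) * snd p ^ (n + 2) * w p"
      by simp
    also have "\<dots> = 2 * snd p * (snd p ^ n * w' p)"
      by (simp add: w'_def power_add power2_eq_square power3_eq_cube algebra_simps)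
    finally show ?thesis
      by (cases "snd p = 0") (auto simp: w'_def)
  qed
  moreover have "smooth_on U snd"
    by (rule smooth_on_linear[OF smooth_on_open[OF w(1)] bounded_linear_snd])
  then have "smooth_on U w'" unfolding w'_def[abs_def]
    by (intro smooth_on_mult smooth_on_add smooth_on_power smooth_on_const smooth_on_pdy w(1)
        smooth_on_open[OF w(1)])
  ultimately show "\<exists>w. smooth_on U w \<and> (\<forall>p\<in>U. pdy z p / (2 * snd p) = snd p ^ n * w p)"
    by blast
qed

text \<open>Both partial derivatives of a glued function are glued functions of flat functions
  again, so that differentiability alone will give smoothness by induction. Only the line Y = 0
  requires an estimate.\<close>

lemma half_plane_glue_has_derivative:
  assumes r: "r > 0" and A: "open A" and flat: "flat_on (A \<times> {-r<..<r}) z"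
    and p: "p \<in> A \<times> {..<r\<^sup>2}"
  shows "(half_plane_glue z has_derivative (\<lambda>v. half_plane_glue (pdx z) p * fst v
      + half_plane_glue (\<lambda>p. pdy z p / (2 * snd p)) p * snd v)) (at p)"
proof -
  obtain x y where xy: "p = (x, y)" "x \<in> A" "y < r\<^sup>2" using p by auto
  consider "y > 0" | "y < 0" | "y = 0" by linarith
  then show ?thesis
  proof cases
    case 1
    let ?q = "(x, sqrt y)"
    have "sqrt y < r" using xy(3) r 1 by (simp add: real_less_lsqrt)
    then have q: "?q \<in> A \<times> {-r<..<r}" using xy(2) r 1 by (auto intro: order_less_le_trans[of _ 0])
    have "((\<lambda>p. (fst p, sqrt (snd p))) has_derivative (\<lambda>v. (fst v, snd v / (2 * sqrt y)))) (at p)"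
      using 1 xy(1) by (auto intro!: derivative_eq_intros simp: field_simps)
    from has_derivative_compose[OF this, of z] smooth_on_has_derivative_pd[OF flat_on_smooth[OF flat] q]
      xy(1)
    have "((\<lambda>p. z (fst p, sqrt (snd p))) has_derivative
       (\<lambda>v. pdx z ?q * fst v + pdy z ?q * (snd v / (2 * sqrt y)))) (at p)"
      by fastforce
    then have "(half_plane_glue z has_derivative
       (\<lambda>v. pdx z ?q * fst v + pdy z ?q * (snd v / (2 * sqrt y)))) (at p)"
    proof (rule has_derivative_transform_within_open[where s="UNIV \<times> {0<..}"])
      show "open (UNIV \<times> {0<..} :: (real \<times> real) set)" by (intro open_Times) auto
    qed (use 1 xy(1) in \<open>auto simp: half_plane_glue_def\<close>)
    then show ?thesis using 1 by (simp add: half_plane_glue_def xy(1))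
  next
    case 2
    have "((\<lambda>p. 0) has_derivative (\<lambda>v. 0)) (at p)" by simp
    then have "(half_plane_glue z has_derivative (\<lambda>v. 0)) (at p)"
    proof (rule has_derivative_transform_within_open[where s="UNIV \<times> {..<0}"])
      show "open (UNIV \<times> {..<0} :: (real \<times> real) set)" by (intro open_Times) auto
    qed (use 2 xy(1) in \<open>auto simp: half_plane_glue_def\<close>)
    then show ?thesis using 2 by (simp add: half_plane_glue_def xy(1))
  next
    case 3
    \<comment> \<open>The fourth power is chosen because y^4 = Y^2: the glued function is bounded by
      a multiple of Y^2 near p, hence has derivative 0 there.\<close>
    obtain w where w: "smooth_on (A \<times> {-r<..<r}) w" "\<And>p. p \<in> A \<times> {-r<..<r} \<Longrightarrow> z p = snd p ^ 4 * w p"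
      using flat unfolding flat_on_def by blast
    have "isCont w p"
      by (rule continuous_on_interior[OF smooth_on_continuous[OF w(1)]])
         (use xy r 3 interior_open[OF smooth_on_open[OF w(1)]] in auto)
    then obtain d where d: "d > 0" "\<And>q. dist q p < d \<Longrightarrow> dist (w q) (w p) < 1"
      unfolding continuous_at_eps_delta using zero_less_one by blast
    define C where "C = \<bar>w p\<bar> + 1"
    have small: "\<forall>\<^sub>F q in nhds p. q \<in> A \<times> {..<r\<^sup>2}"
      by (rule eventually_nhds_in_open) (use p A in \<open>auto intro: open_Times\<close>)
    have "((\<lambda>q. (fst q, sqrt (max 0 (snd q)))) \<longlongrightarrow> (fst p, sqrt (max 0 (snd p)))) (nhds p)"
      by (intro tendsto_intros filterlim_ident)
    then have "\<forall>\<^sub>F q in nhds p. dist (fst q, sqrt (max 0 (snd q))) p < d"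
      using d(1) xy(1) 3 by (auto dest!: tendstoD)
    with small have bound: "\<forall>\<^sub>F q in nhds p. \<bar>half_plane_glue z q\<bar> \<le> C * (snd q)\<^sup>2"
    proof eventually_elim
      case (elim q)
      show ?case
      proof (cases "snd q > 0")
        case True
        let ?s = "(fst q, sqrt (snd q))"
        have "sqrt (snd q) < r" using elim(1) r True by (auto simp: real_less_lsqrt)
        then have "?s \<in> A \<times> {-r<..<r}" using elim(1) r True by (auto intro: order_less_le_trans[of _ 0])
        then have "z ?s = sqrt (snd q) ^ 4 * w ?s" using w(2) by auto
        also have "sqrt (snd q) ^ 4 = (snd q)\<^sup>2"
          using True by (metis power2_eq_square mult_2 numeral_Bit0 power_mult real_sqrt_pow2 less_imp_le
              numeral_times_numeral semiring_norm(12) semiring_norm(13))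
        finally have "half_plane_glue z q = (snd q)\<^sup>2 * w ?s" using True by (simp add: half_plane_glue_def)
        moreover have "\<bar>w ?s\<bar> \<le> C" using d(2)[of ?s] elim(2) True by (auto simp: C_def dist_real_def max_def)
        ultimately show ?thesis by (simp add: abs_mult) (metis mult.commute mult_left_mono zero_le_power2)
      next
        case False
        then show ?thesis by (simp add: half_plane_glue_def C_def)
      qed
    qed
    have "(half_plane_glue z has_derivative (\<lambda>v. 0)) (at p)"
      unfolding has_derivative_at_within
    proof (intro conjI)
      have z0: "half_plane_glue z p = 0" by (simp add: half_plane_glue_def xy(1) 3)
      show "((\<lambda>q. (half_plane_glue z q - half_plane_glue z p - 0) /\<^sub>R norm (q - p)) \<longlongrightarrow> 0) (at p)"
      proof (rule Lim_null_comparison)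
        have "\<forall>\<^sub>F q in at p. \<bar>half_plane_glue z q\<bar> \<le> C * (snd q)\<^sup>2"
          using bound by (simp add: eventually_nhds_conv_at)
        moreover have "\<forall>\<^sub>F q in at p. q \<noteq> p" by (simp add: eventually_at_filter)
        ultimately show "\<forall>\<^sub>F q in at p. norm ((half_plane_glue z q - half_plane_glue z p - 0) /\<^sub>R norm (q - p))
            \<le> C * norm (q - p)"
        proof eventually_elim
          case (elim q)
          have n: "norm (q - p) > 0" using elim by simp
          have "\<bar>snd q\<bar> \<le> norm (q - p)" using norm_snd_le[where x="fst (q - p)" and y="snd (q - p)"]
            unfolding prod.collapse by (simp add: xy(1) 3)
          then have "(snd q)\<^sup>2 \<le> (norm (q - p))\<^sup>2" by (metis abs_ge_zero power2_abs power_mono)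
          then have "\<bar>half_plane_glue z q\<bar> \<le> C * (norm (q - p))\<^sup>2"
            using elim(1) by (smt (verit) C_def mult_left_mono abs_ge_zero)
          then show ?case using n by (simp add: z0 field_simps power2_eq_square)
        qed
        show "((\<lambda>q. C * norm (q - p)) \<longlongrightarrow> 0) (at p)"
          by (auto intro!: tendsto_eq_intros)
      qed
    qed auto
    then show ?thesis using 3 by (simp add: half_plane_glue_def xy(1))
  qed
qed

lemma half_plane_glue_smooth:
  assumes r: "r > 0" and A: "open A" and flat: "flat_on (A \<times> {-r<..<r}) z"
  shows "smooth_on (A \<times> {..<r\<^sup>2}) (half_plane_glue z)"
proof -
  have o: "open (A \<times> {..<r\<^sup>2})" using A by (intro open_Times) auto
  have "ck n (A \<times> {..<r\<^sup>2}) (half_plane_glue z)" for n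
    using flat
  proof (induction n arbitrary: z)
    case 0
    show ?case using half_plane_glue_has_derivative[OF r A 0]
      by (auto intro!: continuous_at_imp_continuous_on has_derivative_continuous)
  next
    case (Suc n)
    show ?case
      by (rule ck_Suc_pdI[OF o half_plane_glue_has_derivative[OF r A Suc.prems]])
         (auto intro!: Suc flat_on_pdx flat_on_pdy_div)
  qed
  then show ?thesis using o smooth_on_iff_ck by blast
qed

subsection \<open>Borel's theorem with a parameter\<close>

lemma smooth_on_ident: "open U \<Longrightarrow> smooth_on U (\<lambda>x. x)"
  by (intro smooth_on_linear bounded_linear_ident)

lemma smooth_on_fst: "open U \<Longrightarrow> smooth_on U fst"
  by (intro smooth_on_linear bounded_linear_fst)

lemma smooth_on_snd: "open U \<Longrightarrow> smooth_on U snd"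
  by (intro smooth_on_linear bounded_linear_snd)

lemma smooth_on_real_has_derivative:
  fixes f :: "real \<Rightarrow> real"
  assumes "smooth_on U f" "x \<in> U"
  shows "(f has_real_derivative deriv f x) (at x)"
proof -
  have "f differentiable (at x)"
    using smooth_on_has_derivative[OF assms] by (auto simp: differentiable_def)
  then show ?thesis
    by (auto simp: real_differentiable_def dest: DERIV_imp_deriv)
qed

lemma smooth_on_deriv:
  fixes f :: "real \<Rightarrow> real"
  assumes "smooth_on U f"
  shows "smooth_on U (deriv f)"
proof (rule smooth_on_cong[OF smooth_on_directional[OF assms, of 1]])
  fix x assume "x \<in> U"
  then have "(f has_derivative (*) (deriv f x)) (at x)"
    using smooth_on_real_has_derivative[OF assms] by (simp add: has_field_derivative_def)
  from frechet_derivative_at[OF this] show "frechet_derivative f (at x) 1 = deriv f x"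
    by (metis mult.right_neutral)
qed

lemma smooth_on_funpow_deriv:
  "smooth_on U f \<Longrightarrow> smooth_on U ((deriv ^^ n) f)" for f :: "real \<Rightarrow> real"
  by (induction n) (auto intro: smooth_on_deriv)

lemma ck_Suc_realI:
  fixes f :: "real \<Rightarrow> real"
  assumes "open U" "\<And>x. x \<in> U \<Longrightarrow> (f has_real_derivative f' x) (at x)" "ck n U f'"
  shows "ck (Suc n) U f"
  by (rule ck_SucI[OF assms(1) assms(2)[unfolded has_field_derivative_def]])
     (auto intro!: ck_mult ck_const assms)

lemma smooth_on_Un: "smooth_on U f \<Longrightarrow> smooth_on V f \<Longrightarrow> smooth_on (U \<union> V) f"
  by (auto simp: smooth_on_def)

section \<open>The flat exponential and a cutoff function\<close>

definition flat_exp :: "nat \<Rightarrow> real \<Rightarrow> real" where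
  "flat_exp m t = (if t > 0 then exp (- (1 / t)) / t ^ m else 0)"

text \<open>The exponent \<open>m\<close> makes the family closed under differentiation. At 0 the
  difference quotient from the right is s^(m+1) / exp s with s = 1/t, which tends to 0 as s tends to
  infinity.\<close>

lemma flat_exp_has_derivative:
  "(flat_exp m has_real_derivative flat_exp (m + 2) t - m * flat_exp (Suc m) t) (at t)"
proof -
  consider "t > 0" | "t < 0" | "t = 0" by linarith
  then show ?thesis
  proof cases
    case 1
    have "((\<lambda>t. exp (- (1 / t)) / t ^ m) has_real_derivative
        flat_exp (m + 2) t - m * flat_exp (Suc m) t) (at t)"
    proof (cases m)
      case 0
      then show ?thesis using 1
        by (auto intro!: derivative_eq_intros simp: flat_exp_def field_simps power2_eq_square)
    next
      case (Suc l)
      have "((\<lambda>t. exp (- (1 / t)) / t ^ Suc l) has_real_derivative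
        ((exp (- (1 / t)) * (1 / t\<^sup>2)) * t ^ Suc l - exp (- (1 / t)) * (Suc l * t ^ l)) / (t ^ Suc l * t ^ Suc l)) (at t)"
        using 1 by (auto intro!: derivative_eq_intros simp: power2_eq_square simp del: power_Suc)
      then show ?thesis
        unfolding Suc
        by (rule DERIV_cong) (use 1 in \<open>simp add: flat_exp_def field_simps power2_eq_square\<close>)
    qed
    then show ?thesis
      by (rule has_field_derivative_transform_within_open[where S="{0<..}"])
         (use 1 in \<open>auto simp: flat_exp_def\<close>)
  next
    case 2
    have "((\<lambda>t. 0) has_real_derivative flat_exp (m + 2) t - m * flat_exp (Suc m) t) (at t)"
      using 2 by (simp add: flat_exp_def)
    then show ?thesis
      by (rule has_field_derivative_transform_within_open[where S="{..<0}"])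
         (use 2 in \<open>auto simp: flat_exp_def\<close>)
  next
    case 3
    have "((\<lambda>t. inverse t ^ Suc m / exp (inverse t)) \<longlongrightarrow> (0::real)) (at_right 0)"
      by (rule filterlim_compose[OF tendsto_power_div_exp_0 filterlim_inverse_at_top_right])
    then have "((\<lambda>t. (flat_exp m t - flat_exp m 0) / (t - 0)) \<longlongrightarrow> 0) (at_right 0)"
      by (rule Lim_transform_eventually)
         (auto simp: eventually_at_right_field flat_exp_def exp_minus field_simps intro!: exI[of _ 1])
    moreover have "((\<lambda>t. (flat_exp m t - flat_exp m 0) / (t - 0)) \<longlongrightarrow> 0) (at_left 0)"
      by (rule Lim_transform_eventually[OF tendsto_const])
         (auto simp: eventually_at_left_field flat_exp_def intro!: exI[of _ "-1"])
    ultimately have "((\<lambda>t. (flat_exp m t - flat_exp m 0) / (t - 0)) \<longlongrightarrow> 0) (at 0)"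
      by (rule filterlim_split_at_real[rotated])
    then show ?thesis using 3 by (simp add: has_field_derivative_iff flat_exp_def)
  qed
qed

lemma smooth_on_flat_exp: "smooth_on UNIV (flat_exp m)"
proof -
  have "ck n UNIV (flat_exp m)" for n
  proof (induction n arbitrary: m)
    case 0
    show ?case
      by (auto intro!: continuous_at_imp_continuous_on DERIV_isCont flat_exp_has_derivative)
  next
    case (Suc n)
    have "ck n UNIV (\<lambda>t. flat_exp (m + 2) t + (- real m) * flat_exp (Suc m) t)"
      by (intro ck_add ck_mult ck_const Suc) auto
    then have "ck n UNIV (\<lambda>t. flat_exp (m + 2) t - real m * flat_exp (Suc m) t)" by simp
    then show ?case by (rule ck_Suc_realI[OF open_UNIV flat_exp_has_derivative])
  qed
  then show ?thesis by (simp add: smooth_on_iff_ck)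
qed

text \<open>A cutoff equal to 1 on [-1, 1] and to 0 beyond distance 2. The arguments 4 - t^2 and t^2
  - 1 are never both nonpositive, so the denominator is positive everywhere.\<close>

definition bump :: "real \<Rightarrow> real" where
  "bump t = flat_exp 0 (4 - t\<^sup>2) * inverse (flat_exp 0 (4 - t\<^sup>2) + flat_exp 0 (t\<^sup>2 - 1))"

lemma bump_eq_1: "\<bar>t\<bar> \<le> 1 \<Longrightarrow> bump t = 1"
  using abs_square_le_1[of t] by (auto simp: bump_def flat_exp_def)

lemma bump_eq_0: "\<bar>t\<bar> > 2 \<Longrightarrow> bump t = 0"
proof -
  assume "\<bar>t\<bar> > 2"
  then have "2\<^sup>2 < \<bar>t\<bar>\<^sup>2" by (intro power_strict_mono) auto
  then show ?thesis by (simp add: bump_def flat_exp_def)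
qed

lemma smooth_on_bump: "smooth_on UNIV bump"
proof -
  have id: "smooth_on UNIV (\<lambda>t::real. t)" by (intro smooth_on_ident open_UNIV)
  have s: "smooth_on UNIV (\<lambda>t. flat_exp 0 (4 - t\<^sup>2))" "smooth_on UNIV (\<lambda>t. flat_exp 0 (t\<^sup>2 - 1))"
    by (auto intro!: smooth_on_compose[OF smooth_on_flat_exp] smooth_on_diff smooth_on_power smooth_on_const id)
  have "flat_exp 0 (4 - t\<^sup>2) + flat_exp 0 (t\<^sup>2 - 1) > 0" for t
    by (simp add: flat_exp_def add_pos_pos)
  then have "smooth_on UNIV (\<lambda>t. inverse (flat_exp 0 (4 - t\<^sup>2) + flat_exp 0 (t\<^sup>2 - 1)))"
    by (intro smooth_on_compose[OF smooth_on_inverse] smooth_on_add s) (auto simp: less_le)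
  then show ?thesis unfolding bump_def[abs_def] by (intro smooth_on_mult s)
qed

lemma compact_support_derivs_bounded:
  fixes f :: "real \<Rightarrow> real"
  assumes f: "smooth_on UNIV f" and supp: "\<And>t. \<bar>t\<bar> > c \<Longrightarrow> f t = 0"
  shows "\<exists>B\<ge>0. \<forall>t. \<bar>(deriv ^^ j) f t\<bar> \<le> B"
proof -
  have z: "(deriv ^^ j) f t = 0" if "\<bar>t\<bar> > c" for t
    using that
  proof (induction j arbitrary: t)
    case 0
    then show ?case using supp by simp
  next
    case (Suc j)
    have o: "open {t::real. \<bar>t\<bar> > c}" by (intro open_Collect_less continuous_intros)
    have "((\<lambda>t. 0) has_real_derivative 0) (at t)" by simp
    then have "((deriv ^^ j) f has_real_derivative 0) (at t)"
      by (rule has_field_derivative_transform_within_open[OF _ o]) (use Suc in auto)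
    then show ?case by (simp add: DERIV_imp_deriv)
  qed
  have "continuous_on {-c..c} ((deriv ^^ j) f)"
    using smooth_on_continuous[OF smooth_on_funpow_deriv[OF f]] continuous_on_subset by blast
  then have "bounded ((deriv ^^ j) f ` {-c..c})"
    by (intro compact_imp_bounded compact_continuous_image) auto
  then obtain B where B: "\<And>t. t \<in> {-c..c} \<Longrightarrow> \<bar>(deriv ^^ j) f t\<bar> \<le> B"
    unfolding bounded_iff real_norm_def by blast
  have "\<bar>(deriv ^^ j) f t\<bar> \<le> max B 0" for t
  proof (cases "\<bar>t\<bar> > c")
    case False
    then have "t \<in> {-c..c}" by auto
    then show ?thesis using B[of t] by simp
  qed (simp add: z)
  then show ?thesis by (intro exI[of _ "max B 0"]) auto
qed

text \<open>The second indices of \<open>u\<close> and \<open>v\<close> count derivatives. The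
  series with indices i, j has as partial derivatives the series with i + 1, j and with i, j + 1,
  and all of them converge uniformly by comparison with a geometric series. The bound may begin at a
  k depending on i and j, since high derivatives of early terms need not be small.\<close>

lemma product_series_smooth:
  fixes u v :: "nat \<Rightarrow> nat \<Rightarrow> real \<Rightarrow> real"
  assumes I: "open I" "convex I" "I \<noteq> {}"
    and u: "\<And>k i x. x \<in> I \<Longrightarrow> (u k i has_real_derivative u k (Suc i) x) (at x)"
    and v: "\<And>k j y. (v k j has_real_derivative v k (Suc j) y) (at y)"
    and bound: "\<And>i j. \<forall>\<^sub>F k in sequentially. \<forall>x\<in>I. \<forall>y. \<bar>u k i x * v k j y\<bar> \<le> (1/2) ^ k"
  shows "smooth_on (I \<times> UNIV) (\<lambda>p. \<Sum>k. u k 0 (fst p) * v k 0 (snd p))"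
    and "x \<in> I \<Longrightarrow> summable (\<lambda>k. u k i x * v k j y)"
proof -
  define S where "S i j p = (\<Sum>k. u k i (fst p) * v k j (snd p))" for i j and p :: "real \<times> real"
  let ?A = "I \<times> (UNIV :: real set)"
  have oA: "open ?A" and cA: "convex ?A" using I by (auto intro: open_Times convex_Times)
  have b': "\<forall>\<^sub>F k in sequentially. \<forall>p\<in>?A. norm (u k i (fst p) * v k j (snd p)) \<le> (1/2) ^ k" for i j
    using bound[of i j] by eventually_elim auto
  have unif: "uniform_limit ?A (\<lambda>n p. \<Sum>k<n. u k i (fst p) * v k j (snd p)) (S i j) sequentially" for i j
    unfolding S_def by (rule Weierstrass_m_test_ev[OF b']) (simp add: summable_geometric)
  have summ: "summable (\<lambda>k. u k i x * v k j y)" if "x \<in> I" for i j x y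
  proof (rule summable_comparison_test_ev)
    show "\<forall>\<^sub>F k in sequentially. norm (u k i x * v k j y) \<le> (1/2) ^ k"
      using bound[of i j] by eventually_elim (use that in auto)
  qed (simp add: summable_geometric)
  have der: "(S i j has_derivative (\<lambda>h. S (Suc i) j p * fst h + S i (Suc j) p * snd h)) (at p)"
    if p: "p \<in> ?A" for i j p
  proof -
    obtain x0 where x0: "x0 \<in> I" using I by blast
    define f' where "f' k q h = u k (Suc i) (fst q) * v k j (snd q) * fst h + u k i (fst q) * v k (Suc j) (snd q) * snd h"
      for k and q h :: "real \<times> real"
    have "\<exists>g. \<forall>q\<in>?A. (\<lambda>k. u k i (fst q) * v k j (snd q)) sums (g q) \<and>
        (g has_derivative (\<lambda>h. S (Suc i) j q * fst h + S i (Suc j) q * snd h)) (at q within ?A)"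
    proof (rule has_derivative_series[OF cA, where f'=f'])
      fix k and q :: "real \<times> real" assume q: "q \<in> ?A"
      have "((\<lambda>q. u k i (fst q)) has_derivative (\<lambda>h. u k (Suc i) (fst q) * fst h)) (at q)"
        using has_derivative_compose[OF has_derivative_fst[OF has_derivative_ident]
            u[of "fst q", unfolded has_field_derivative_def]] q by auto
      moreover have "((\<lambda>q. v k j (snd q)) has_derivative (\<lambda>h. v k (Suc j) (snd q) * snd h)) (at q)"
        using has_derivative_compose[OF has_derivative_snd[OF has_derivative_ident]
            v[of k j "snd q", unfolded has_field_derivative_def]] by auto
      ultimately have "((\<lambda>q. u k i (fst q) * v k j (snd q)) has_derivative f' k q) (at q)"
        by (rule has_derivative_eq_rhs[OF has_derivative_mult]) (auto simp: f'_def algebra_simps)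
      then show "((\<lambda>q. u k i (fst q) * v k j (snd q)) has_derivative f' k q) (at q within ?A)"
        by (rule has_derivative_at_withinI)
    next
      fix e :: real assume e: "e > 0"
      have "\<forall>\<^sub>F n in sequentially. \<forall>q\<in>?A. dist (\<Sum>k<n. u k (Suc i) (fst q) * v k j (snd q)) (S (Suc i) j q) < e / 2"
        by (rule uniform_limitD[OF unif]) (use e in simp)
      moreover have "\<forall>\<^sub>F n in sequentially. \<forall>q\<in>?A. dist (\<Sum>k<n. u k i (fst q) * v k (Suc j) (snd q)) (S i (Suc j) q) < e / 2"
        by (rule uniform_limitD[OF unif]) (use e in simp)
      ultimately show "\<forall>\<^sub>F n in sequentially. \<forall>q\<in>?A. \<forall>h. norm ((\<Sum>k<n. f' k q h) -
          (S (Suc i) j q * fst h + S i (Suc j) q * snd h)) \<le> e * norm h"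
      proof (eventually_elim, intro ballI allI)
        case (elim n)
        fix q h :: "real \<times> real" assume q: "q \<in> ?A"
        let ?a = "(\<Sum>k<n. u k (Suc i) (fst q) * v k j (snd q)) - S (Suc i) j q"
        let ?b = "(\<Sum>k<n. u k i (fst q) * v k (Suc j) (snd q)) - S i (Suc j) q"
        have "(\<Sum>k<n. f' k q h) - (S (Suc i) j q * fst h + S i (Suc j) q * snd h) = ?a * fst h + ?b * snd h"
          by (simp only: f'_def sum.distrib sum_distrib_right[symmetric] left_diff_distrib add_diff_add)
        moreover have "\<bar>?a * fst h + ?b * snd h\<bar> \<le> e / 2 * norm h + e / 2 * norm h"
        proof -
          have "\<bar>?a\<bar> < e / 2" "\<bar>?b\<bar> < e / 2"
            using elim(1)[rule_format, OF q] elim(2)[rule_format, OF q] by (simp_all add: dist_real_def)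
          moreover have "\<bar>fst h\<bar> \<le> norm h" "\<bar>snd h\<bar> \<le> norm h"
            by (metis norm_fst_le prod.collapse real_norm_def) (metis norm_snd_le prod.collapse real_norm_def)
          ultimately have "\<bar>?a\<bar> * \<bar>fst h\<bar> + \<bar>?b\<bar> * \<bar>snd h\<bar> \<le> e / 2 * norm h + e / 2 * norm h"
            using e by (intro add_mono mult_mono) auto
          then show ?thesis using abs_triangle_ineq[of "?a * fst h" "?b * snd h"] by (simp only: abs_mult)
        qed
        ultimately have "\<bar>(\<Sum>k<n. f' k q h) - (S (Suc i) j q * fst h + S i (Suc j) q * snd h)\<bar>
            \<le> e / 2 * norm h + e / 2 * norm h" by (simp only:)
        then show "norm ((\<Sum>k<n. f' k q h) - (S (Suc i) j q * fst h + S i (Suc j) q * snd h)) \<le> e * norm h"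
          by simp
      qed
    next
      show "(x0, 0) \<in> ?A" using x0 by simp
      show "(\<lambda>k. u k i (fst (x0, 0::real)) * v k j (snd (x0, 0::real))) sums S i j (x0, 0)"
        using summable_sums[OF summ[OF x0, of i j 0]] by (simp add: S_def)
    qed
    then obtain g where g: "\<And>q. q \<in> ?A \<Longrightarrow> (\<lambda>k. u k i (fst q) * v k j (snd q)) sums (g q)"
      "\<And>q. q \<in> ?A \<Longrightarrow> (g has_derivative (\<lambda>h. S (Suc i) j q * fst h + S i (Suc j) q * snd h)) (at q within ?A)"
      by blast
    have "(g has_derivative (\<lambda>h. S (Suc i) j p * fst h + S i (Suc j) p * snd h)) (at p)"
      using g(2)[OF p] at_within_open[OF p oA] by simp
    then show ?thesis
      by (rule has_derivative_transform_within_open[OF _ oA p]) (use g(1) in \<open>auto simp: S_def sums_iff\<close>)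
  qed
  have "ck n ?A (S i j)" for n i j
  proof (induction n arbitrary: i j)
    case 0
    show ?case using der
      by (auto intro!: continuous_at_imp_continuous_on has_derivative_continuous)
  next
    case (Suc n)
    show ?case by (rule ck_Suc_pdI[OF oA der Suc Suc])
  qed
  then have "smooth_on ?A (S 0 0)" using oA smooth_on_iff_ck by blast
  then show "smooth_on ?A (\<lambda>p. \<Sum>k. u k 0 (fst p) * v k 0 (snd p))" unfolding S_def[abs_def] .
  show "x \<in> I \<Longrightarrow> summable (\<lambda>k. u k i x * v k j y)" by (rule summ)
qed

text \<open>Near 0 the numerator is identically 0, and away from 0 every factor is smooth.\<close>

lemma bump_quotient_smooth:
  assumes "\<epsilon> > 0"
  shows "smooth_on UNIV (\<lambda>y. (bump (y / \<epsilon>) - 1) * inverse y ^ m)"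
proof -
  have lin: "smooth_on (- {0}) (\<lambda>y. y / \<epsilon>)"
    by (intro smooth_on_linear bounded_linear_divide) auto
  have "smooth_on (- {0}) (\<lambda>y. (bump (y / \<epsilon>) - 1) * inverse y ^ m)"
    by (intro smooth_on_mult smooth_on_diff smooth_on_power smooth_on_inverse smooth_on_const
        smooth_on_compose[OF smooth_on_bump] lin) auto
  moreover have "smooth_on {-\<epsilon><..<\<epsilon>} (\<lambda>y. (bump (y / \<epsilon>) - 1) * inverse y ^ m)"
  proof (rule smooth_on_cong[OF smooth_on_const[of _ 0]])
    fix y assume "y \<in> {-\<epsilon><..<\<epsilon>}"
    then have "\<bar>y / \<epsilon>\<bar> \<le> 1" using assms by (simp add: abs_le_iff field_simps)
    then show "0 = (bump (y / \<epsilon>) - 1) * inverse y ^ m" using bump_eq_1 by simp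
  qed auto
  moreover have "UNIV = (- {0}) \<union> {-\<epsilon><..<\<epsilon>}" using assms by auto
  ultimately show ?thesis using smooth_on_Un by metis
qed

text \<open>The function is the sum of \<open>e k x * y ^ k * bump (y / \<epsilon> k)\<close> with
  \<epsilon> k decreasing fast enough for all differentiated series to converge. The conclusion
  offers smooth remainders \<open>B n\<close> instead of Taylor coefficients, because this is the
  form in which flatness is tested later. Halving the interval makes the derivatives of each
  \<open>e k\<close> bounded.\<close>

lemma borel_with_parameter:
  fixes e :: "nat \<Rightarrow> real \<Rightarrow> real"
  assumes r: "r > 0" and e: "\<And>k. smooth_on {-r<..<r} (e k)"
  obtains b B where "smooth_on ({-r/2<..<r/2} \<times> UNIV) b"
    "\<And>n. smooth_on ({-r/2<..<r/2} \<times> UNIV) (B n)"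
    "\<And>n x y. \<bar>x\<bar> < r/2 \<Longrightarrow> b (x, y) = (\<Sum>k<n. e k x * y ^ k) + y ^ n * B n (x, y)"
proof -
  \<comment> \<open>Fixed profiles: y^k bump(y / \<epsilon>) = \<epsilon>^k m_k(y / \<epsilon>), so
    a j-th derivative still retains the factor \<epsilon>^(k - j).\<close>
  define m where "m l t = t ^ l * bump t" for l and t :: real
  have "smooth_on UNIV (m l)" for l
    unfolding m_def[abs_def]
    by (intro smooth_on_mult smooth_on_power smooth_on_ident smooth_on_bump open_UNIV)
  note m_smooth = this
  have *: "\<exists>B\<ge>0. \<forall>t. \<bar>(deriv ^^ j) (m l) t\<bar> \<le> B" for l j
    by (rule compact_support_derivs_bounded[OF m_smooth, of 2]) (simp add: m_def bump_eq_0)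
  obtain C where C: "\<And>l j. C l j \<ge> 0" "\<And>l j t. \<bar>(deriv ^^ j) (m l) t\<bar> \<le> C l j"
  proof -
    have "\<forall>l. \<forall>j. \<exists>B. 0 \<le> B \<and> (\<forall>t. \<bar>(deriv ^^ j) (m l) t\<bar> \<le> B)" using * by blast
    then show ?thesis unfolding choice_iff using that by blast
  qed
  have *: "\<exists>B\<ge>0. \<forall>x\<in>{-r/2..r/2}. \<bar>(deriv ^^ i) (e k) x\<bar> \<le> B" for k i
  proof -
    have "continuous_on {-r/2..r/2} ((deriv ^^ i) (e k))"
      by (rule continuous_on_subset[OF smooth_on_continuous[OF smooth_on_funpow_deriv[OF e]]]) (use r in auto)
    then have "bounded ((deriv ^^ i) (e k) ` {-r/2..r/2})"
      by (intro compact_imp_bounded compact_continuous_image) auto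
    then obtain B where "\<forall>x\<in>{-r/2..r/2}. \<bar>(deriv ^^ i) (e k) x\<bar> \<le> B" unfolding bounded_iff real_norm_def by blast
    then show ?thesis by (intro exI[of _ "max B 0"]) force
  qed
  obtain A where A: "\<And>k i. A k i \<ge> 0" "\<And>k i x. x \<in> {-r/2..r/2} \<Longrightarrow> \<bar>(deriv ^^ i) (e k) x\<bar> \<le> A k i"
  proof -
    have "\<forall>k. \<forall>i. \<exists>B. 0 \<le> B \<and> (\<forall>x\<in>{-r/2..r/2}. \<bar>(deriv ^^ i) (e k) x\<bar> \<le> B)" using * by blast
    then show ?thesis unfolding choice_iff using that by blast
  qed
  \<comment> \<open>The sum over l is there for the tails: after division by y^n the coefficient
    with index k + n is paired with the profile of index k, and one \<open>M (k + n)\<close> must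
    cover both.\<close>
  define M where "M k = (\<Sum>i\<le>k. A k i) * (\<Sum>l\<le>k. \<Sum>j\<le>k. C l j)" for k
  have M0: "M k \<ge> 0" for k unfolding M_def by (intro mult_nonneg_nonneg sum_nonneg A C)
  have M: "A k i * C l j \<le> M k" if "i \<le> k" "j \<le> k" "l \<le> k" for i j k l
  proof -
    have "A k i \<le> (\<Sum>i\<le>k. A k i)" by (rule member_le_sum) (use that A in auto)
    moreover have "C l j \<le> (\<Sum>j\<le>k. C l j)" by (rule member_le_sum) (use that C in auto)
    moreover have "\<dots> \<le> (\<Sum>l\<le>k. \<Sum>j\<le>k. C l j)"
      by (rule member_le_sum[of l "{..k}" "\<lambda>l. \<Sum>j\<le>k. C l j"]) (use that C in \<open>auto intro: sum_nonneg\<close>)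
    ultimately show ?thesis unfolding M_def using A C by (intro mult_mono) (auto intro: order_trans)
  qed
  define \<epsilon> where "\<epsilon> k = (1/2) ^ k / (1 + M k)" for k
  have \<epsilon>0: "\<epsilon> k > 0" for k using M0[of k] by (simp add: \<epsilon>_def add_pos_nonneg)
  have \<epsilon>1: "\<epsilon> k \<le> 1" for k
  proof -
    have "(1/2::real) ^ k \<le> 1" by (simp add: power_le_one)
    then show ?thesis using M0[of k] by (simp add: \<epsilon>_def)
  qed
  have \<epsilon>M: "\<epsilon> k * M k \<le> (1/2) ^ k" for k
  proof -
    have "\<epsilon> k * M k = (1/2)^k * (M k / (1 + M k))" by (simp add: \<epsilon>_def)
    also have "\<dots> \<le> (1/2)^k * 1" using M0[of k] by (intro mult_left_mono) auto
    finally show ?thesis by simp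
  qed
  let ?J = "{-r/2<..<r/2}"
  \<comment> \<open>The index n selects the tail of the series from term n on, divided by y^n; n = 0
    is the whole series.\<close>
  define u where "u n k i = (deriv ^^ i) (e (k + n))" for n k i
  define v where "v n k j y = \<epsilon> (k + n) ^ k / \<epsilon> (k + n) ^ j * (deriv ^^ j) (m k) (y / \<epsilon> (k + n))" for n k j y
  have du: "(u n k i has_real_derivative u n k (Suc i) x) (at x)" if "x \<in> ?J" for n k i x
    using smooth_on_real_has_derivative[OF smooth_on_funpow_deriv[OF e], of x i "k + n"] that r
    by (simp add: u_def)
  have dv: "(v n k j has_real_derivative v n k (Suc j) y) (at y)" for n k j y
  proof -
    have "((deriv ^^ j) (m k) has_real_derivative (deriv ^^ Suc j) (m k) (y / \<epsilon> (k + n))) (at (y / \<epsilon> (k + n)))"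
      using smooth_on_real_has_derivative[OF smooth_on_funpow_deriv[OF m_smooth], of "y / \<epsilon> (k + n)" j k]
      by simp
    from DERIV_chain2[of "(deriv ^^ j) (m k)" _ "\<lambda>y. y / \<epsilon> (k + n)" y, OF this]
    have "((\<lambda>y. (deriv ^^ j) (m k) (y / \<epsilon> (k + n))) has_real_derivative
       (deriv ^^ Suc j) (m k) (y / \<epsilon> (k + n)) * (1 / \<epsilon> (k + n))) (at y)"
    proof this
      show "((\<lambda>y. y / \<epsilon> (k + n)) has_real_derivative 1 / \<epsilon> (k + n)) (at y)"
        using \<epsilon>0[of "k + n"] by (auto intro!: derivative_eq_intros)
    qed
    from DERIV_cmult[OF this, of "\<epsilon> (k + n) ^ k / \<epsilon> (k + n) ^ j"]
    show ?thesis unfolding v_def[abs_def] by (rule DERIV_cong) simp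
  qed
  have bound: "\<forall>\<^sub>F k in sequentially. \<forall>x\<in>?J. \<forall>y. \<bar>u n k i x * v n k j y\<bar> \<le> (1/2) ^ k" for n i j
    unfolding eventually_sequentially
  \<comment> \<open>For k > j at least one factor \<open>\<epsilon> (k + n)\<close> survives the j
    derivatives, and this single factor absorbs \<open>M (k + n)\<close>.\<close>
  proof (intro exI[of _ "max i (Suc j)"] allI impI ballI)
    fix k x y assume k: "max i (Suc j) \<le> k" and x: "x \<in> ?J"
    let ?\<epsilon> = "\<epsilon> (k + n)"
    have e1: "?\<epsilon> ^ k / ?\<epsilon> ^ j \<le> ?\<epsilon>"
    proof -
      have "?\<epsilon> ^ k / ?\<epsilon> ^ j = ?\<epsilon> ^ (k - j)" using k \<epsilon>0[of "k+n"] by (simp add: power_diff)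
      also have "\<dots> \<le> ?\<epsilon> ^ 1" using k \<epsilon>0[of "k+n"] \<epsilon>1[of "k+n"] by (intro power_decreasing) auto
      finally show ?thesis by simp
    qed
    have "\<bar>u n k i x * v n k j y\<bar> = \<bar>(deriv ^^ i) (e (k + n)) x\<bar> * (?\<epsilon> ^ k / ?\<epsilon> ^ j * \<bar>(deriv ^^ j) (m k) (y / ?\<epsilon>)\<bar>)"
      using \<epsilon>0[of "k+n"] by (simp add: u_def v_def abs_mult)
    also have "\<dots> \<le> A (k + n) i * (?\<epsilon> * C k j)"
      using A C e1 \<epsilon>0[of "k+n"] x by (intro mult_mono) (auto simp: less_imp_le)
    also have "\<dots> = ?\<epsilon> * (A (k + n) i * C k j)" by simp
    also have "\<dots> \<le> ?\<epsilon> * M (k + n)" using k \<epsilon>0[of "k+n"] by (intro mult_left_mono M) auto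
    also have "\<dots> \<le> (1/2) ^ (k + n)" by (rule \<epsilon>M)
    also have "\<dots> \<le> (1/2) ^ k" by (intro power_decreasing) auto
    finally show "\<bar>u n k i x * v n k j y\<bar> \<le> (1/2) ^ k" .
  qed
  define T where "T n p = (\<Sum>k. u n k 0 (fst p) * v n k 0 (snd p))" for n and p :: "real \<times> real"
  have J: "open ?J" "convex ?J" "?J \<noteq> {}" using r by (auto simp: greaterThanLessThan_empty_iff2)
  have series: "summable (\<lambda>k. u n k i x * v n k j y)" if "x \<in> ?J" for n i j x y
    by (rule product_series_smooth(2)[where u="u n" and v="v n", OF J du dv bound that])
  have T_smooth: "smooth_on (?J \<times> UNIV) (T n)" for n unfolding T_def[abs_def] 
    by (rule product_series_smooth(1)[where u="u n" and v="v n", OF J du dv bound])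
  have v0: "v n k 0 y = y ^ k * bump (y / \<epsilon> (k + n))" for n k y
    using \<epsilon>0[of "k+n"] by (simp add: v_def m_def power_divide)
  \<comment> \<open>For k < n the cut-off term and the plain monomial differ by y^n c, since y^k
    (bump(y / \<epsilon> k) - 1) vanishes near 0. The remainder \<open>B n\<close> collects these
    corrections and the divided tail.\<close>
  define c where "c n k y = (bump (y / \<epsilon> k) - 1) * inverse y ^ (n - k)" for n k y
  define B where "B n p = (\<Sum>k<n. e k (fst p) * c n k (snd p)) + T n p" for n p
  show ?thesis
  proof (rule that[of "T 0" B])
    show "smooth_on (?J \<times> UNIV) (T 0)" by (rule T_smooth)
    have o: "open (?J \<times> (UNIV :: real set))" by (intro open_Times) auto
    show "smooth_on (?J \<times> UNIV) (B n)" for n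
      unfolding B_def[abs_def] c_def
      by (intro smooth_on_add smooth_on_sum T_smooth o smooth_on_mult
          smooth_on_compose[OF bump_quotient_smooth[OF \<epsilon>0]] smooth_on_compose[OF e]
          smooth_on_fst smooth_on_snd) (use r in auto)
    fix n and x y :: real assume "\<bar>x\<bar> < r/2"
    then have x: "x \<in> ?J" by (auto simp: abs_less_iff)
    let ?f = "\<lambda>k. e k x * (y ^ k * bump (y / \<epsilon> k))"
    have f: "?f = (\<lambda>k. u 0 k 0 x * v 0 k 0 y)" by (simp add: v0 u_def)
    have s: "summable ?f" unfolding f by (rule series[OF x])
    have tail: "summable (\<lambda>k. u n k 0 x * v n k 0 y)" by (rule series[OF x])
    have "T 0 (x, y) = suminf ?f" by (simp add: T_def f)
    also have "\<dots> = (\<Sum>k. ?f (k + n)) + (\<Sum>k<n. ?f k)" by (rule suminf_split_initial_segment[OF s])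
    also have "(\<Sum>k. ?f (k + n)) = (\<Sum>k. y ^ n * (u n k 0 x * v n k 0 y))"
      by (simp add: u_def v0 power_add mult_ac)
    also have "\<dots> = y ^ n * T n (x, y)" unfolding T_def using suminf_mult[OF tail] by simp
    also have "(\<Sum>k<n. ?f k) = (\<Sum>k<n. e k x * y ^ k + y ^ n * (e k x * c n k y))"
    proof (rule sum.cong)
      fix k assume "k \<in> {..<n}"
      then have k: "n = k + (n - k)" "n - k > 0" by auto
      have "y ^ n * c n k y = y ^ k * (bump (y / \<epsilon> k) - 1)"
      proof (cases "y = 0")
        case True
        then show ?thesis using k by (auto simp: c_def bump_eq_1)
      next
        case False
        have "y ^ n * c n k y = y ^ k * (y ^ (n - k) * inverse y ^ (n - k)) * (bump (y / \<epsilon> k) - 1)"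
          by (subst k(1)) (simp only: power_add c_def mult_ac)
        also have "y ^ (n - k) * inverse y ^ (n - k) = 1" using False by (simp flip: power_mult_distrib)
        finally show ?thesis by simp
      qed
      then have "y ^ n * (e k x * c n k y) = e k x * (y ^ k * (bump (y / \<epsilon> k) - 1))" by (simp add: mult_ac)
      then show "?f k = e k x * y ^ k + y ^ n * (e k x * c n k y)" by (simp add: algebra_simps)
    qed simp
    finally show "T 0 (x, y) = (\<Sum>k<n. e k x * y ^ k) + y ^ n * B n (x, y)"
      by (simp add: B_def sum.distrib sum_distrib_left algebra_simps)
  qed
qed

subsection \<open>Whitney's theorem on even functions\<close>

lemma hadamard_division_box:
  fixes f :: "real \<times> real \<Rightarrow> real"
  assumes "smooth_on ({-r<..<r} \<times> {-r<..<r}) f" "\<And>x. f (x, 0) = 0"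
  obtains g where "smooth_on ({-r<..<r} \<times> {-r<..<r}) g"
    "\<And>x y. \<bar>x\<bar> < r \<Longrightarrow> \<bar>y\<bar> < r \<Longrightarrow> f (x, y) = y * g (x, y)"
proof -
  let ?U = "{-r<..<r} \<times> {-r<..<r}"
  have "convex ?U" by (intro convex_Times) auto
  moreover have "(x, t * y) \<in> ?U" if "(x, y) \<in> ?U" "0 \<le> t" "t \<le> 1" for x y t
    using that by (rule star_box)
  ultimately obtain g where "smooth_on ?U g" "\<And>x y. (x, y) \<in> ?U \<Longrightarrow> f (x, y) = y * g (x, y)"
    using hadamard_division[OF _ _ assms(1)] assms(2) by metis
  then show ?thesis using that[of g] by (simp add: abs_less_iff)
qed

text \<open>Two Hadamard divisions by y. The quotients are controlled only inside the box, so the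
  first is replaced by its odd part, which vanishes on y = 0 and can be divided again, and the
  second by its even part, which has the symmetry needed for the next step.\<close>

lemma even_division_step:
  fixes f :: "real \<times> real \<Rightarrow> real"
  assumes r: "r > 0" and f: "smooth_on ({-r<..<r} \<times> {-r<..<r}) f" and even: "\<And>x y. f (x, -y) = f (x, y)"
  obtains h where "smooth_on ({-r<..<r} \<times> {-r<..<r}) h" "\<And>x y. h (x, -y) = h (x, y)"
    "\<And>x y. \<bar>x\<bar> < r \<Longrightarrow> \<bar>y\<bar> < r \<Longrightarrow> f (x, y) = f (x, 0) + y\<^sup>2 * h (x, y)"
proof -
  let ?U = "{-r<..<r} \<times> {-r<..<r}"
  have o: "open ?U" by (intro open_Times) auto
  have refl: "smooth_on ?U (\<lambda>p. g (fst p, - snd p))" if "smooth_on ?U g" for g :: "real \<times> real \<Rightarrow> real"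
    by (rule smooth_on_compose[OF that])
       (auto intro!: smooth_on_Pair smooth_on_minus smooth_on_fst smooth_on_snd o)
  have "smooth_on ?U (\<lambda>p. f (fst p, 0))"
    by (rule smooth_on_compose[OF f])
       (use r in \<open>auto intro!: smooth_on_Pair smooth_on_const smooth_on_fst o\<close>)
  then have s0: "smooth_on ?U (\<lambda>p. f p - f (fst p, 0))" by (rule smooth_on_diff[OF f])
  obtain g where g: "smooth_on ?U g" "\<And>x y. \<bar>x\<bar> < r \<Longrightarrow> \<bar>y\<bar> < r \<Longrightarrow> f (x, y) - f (x, 0) = y * g (x, y)"
  proof (rule hadamard_division_box[OF s0])
    show "f (x, 0) - f (fst (x, 0), 0) = 0" for x by simp
  qed (rule that, assumption, simp)
  define g' where "g' p = (g p - g (fst p, - snd p)) * (1/2)" for p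
  have s1: "smooth_on ?U g'" unfolding g'_def[abs_def]
    by (intro smooth_on_mult smooth_on_diff refl[OF g(1)] g(1) smooth_on_const o)
  obtain h where h: "smooth_on ?U h" "\<And>x y. \<bar>x\<bar> < r \<Longrightarrow> \<bar>y\<bar> < r \<Longrightarrow> g' (x, y) = y * h (x, y)"
  proof (rule hadamard_division_box[OF s1])
    show "g' (x, 0) = 0" for x by (simp add: g'_def)
  qed (rule that)
  define h' where "h' p = (h p + h (fst p, - snd p)) * (1/2)" for p
  show ?thesis
  proof (rule that[of h'])
    show "smooth_on ?U h'" unfolding h'_def[abs_def]
      by (intro smooth_on_mult smooth_on_add refl[OF h(1)] h(1) smooth_on_const o)
    show "h' (x, -y) = h' (x, y)" for x y by (simp add: h'_def)
    fix x y :: real assume xy: "\<bar>x\<bar> < r" "\<bar>y\<bar> < r"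
    then have xy': "\<bar>- y\<bar> < r" by simp
    have "g' (x, -y) = - g' (x, y)" unfolding g'_def fst_conv snd_conv minus_minus by (simp only: minus_mult_left minus_diff_eq)
    then have "y * h (x, -y) = y * h (x, y)" using h(2)[OF xy] h(2)[OF xy(1) xy'] by simp
    then have 1: "y * h' (x, y) = g' (x, y)" using h(2)[OF xy] by (cases "y = 0") (auto simp: h'_def)
    have "y * g (x, -y) = - (y * g (x, y))" using g(2)[OF xy] g(2)[OF xy(1) xy'] even[of x y] by simp
    then have "y * g' (x, y) = f (x, y) - f (x, 0)" using g(2)[OF xy] by (simp add: g'_def algebra_simps)
    then show "f (x, y) = f (x, 0) + y\<^sup>2 * h' (x, y)"
      using 1 by (simp add: power2_eq_square mult.assoc)
  qed
qed

text \<open>For Y > 0 the value a(x, Y) = f (x, sqrt Y) is forced. Subtracting a Borel function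
  \<open>b\<close> with the same coefficients in powers of Y = y^2 leaves a flat function, and a
  flat function extends smoothly by 0 to Y < 0.\<close>

lemma whitney_even:
  fixes f :: "real \<times> real \<Rightarrow> real"
  assumes r: "r > 0" and f: "smooth_on ({-r<..<r} \<times> {-r<..<r}) f" and even: "\<And>x y. f (x, -y) = f (x, y)"
  obtains a where "smooth_germ a" "\<forall>\<^sub>F p in nhds 0. f p = a (fst p, (snd p)\<^sup>2)"
proof -
  let ?U = "{-r<..<r} \<times> {-r<..<r}"
  \<comment> \<open>\<open>P\<close> pins the start of the sequence to \<open>f\<close> and keeps
    the symmetry; \<open>Q\<close> links successive quotients. The values \<open>E k (x, 0)\<close>
    are then the Taylor coefficients of \<open>f\<close> in powers of y^2.\<close>
  define P where "P (k::nat) g \<longleftrightarrow> (k = 0 \<longrightarrow> g = f) \<and> smooth_on ?U g \<and> (\<forall>x y. g (x, -y) = g (x, y))"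
    for k and g :: "real \<times> real \<Rightarrow> real"
  define Q where "Q (k::nat) g h \<longleftrightarrow> (\<forall>x y. \<bar>x\<bar> < r \<longrightarrow> \<bar>y\<bar> < r \<longrightarrow> g (x, y) = g (x, 0) + y\<^sup>2 * h (x, y))"
    for k and g h :: "real \<times> real \<Rightarrow> real"
  have "\<exists>E. \<forall>k. P k (E k) \<and> Q k (E k) (E (Suc k))"
  proof (rule dependent_nat_choice)
    show "\<exists>g. P 0 g" unfolding P_def using f even by blast
    fix g k assume g: "P k g"
    obtain h where "smooth_on ?U h" "\<And>x y. h (x, -y) = h (x, y)"
      "\<And>x y. \<bar>x\<bar> < r \<Longrightarrow> \<bar>y\<bar> < r \<Longrightarrow> g (x, y) = g (x, 0) + y\<^sup>2 * h (x, y)"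
    proof (rule even_division_step[OF r])
      show "smooth_on ?U g" using g by (simp add: P_def)
      show "g (x, -y) = g (x, y)" for x y using g unfolding P_def by blast
    qed (rule that)
    then show "\<exists>h. P (Suc k) h \<and> Q k g h" unfolding P_def Q_def by blast
  qed
  then obtain E where E: "\<And>k. P k (E k)" "\<And>k. Q k (E k) (E (Suc k))" by blast
  have E0: "E 0 = f" using E(1)[of 0] by (simp add: P_def)
  have Es: "smooth_on ?U (E k)" for k using E(1)[of k] by (simp add: P_def)
  have taylor: "f (x, y) = (\<Sum>k<n. E k (x, 0) * (y\<^sup>2) ^ k) + (y\<^sup>2) ^ n * E n (x, y)"
    if "\<bar>x\<bar> < r" "\<bar>y\<bar> < r" for x y n
  proof (induction n)
    case 0
    then show ?case by (simp add: E0)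
  next
    case (Suc n)
    have "E n (x, y) = E n (x, 0) + y\<^sup>2 * E (Suc n) (x, y)" using E(2)[of n] that unfolding Q_def by blast
    then show ?case using Suc by (simp add: algebra_simps)
  qed
  have e: "smooth_on {-r<..<r} (\<lambda>x. E k (x, 0))" for k
    by (rule smooth_on_compose[OF Es])
       (use r in \<open>auto intro!: smooth_on_Pair smooth_on_const smooth_on_ident\<close>)
  let ?J = "{-r/2<..<r/2}"
  obtain b B where b: "smooth_on (?J \<times> UNIV) b" and B: "\<And>n. smooth_on (?J \<times> UNIV) (B n)"
    and bB: "\<And>n x y. \<bar>x\<bar> < r/2 \<Longrightarrow> b (x, y) = (\<Sum>k<n. E k (x, 0) * y ^ k) + y ^ n * B n (x, y)"
    by (rule borel_with_parameter[where e="\<lambda>k x. E k (x, 0)", OF r e]) (rule that)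
  define z where "z p = f p - b (fst p, (snd p)\<^sup>2)" for p
  let ?V = "?J \<times> {-r<..<r}"
  have oV: "open ?V" by (intro open_Times) auto
  have flat: "flat_on ?V z"
    unfolding flat_on_def
  proof
    fix n
    \<comment> \<open>The two expansions share their first n terms, so the difference is divisible
      by y^(2n). Half of this power is what flatness asks for; the other half is kept in
      \<open>w\<close>.\<close>
    define w where "w p = snd p ^ n * (E n p - B n (fst p, (snd p)\<^sup>2))" for p
    have "smooth_on ?V (E n)" by (rule smooth_on_subset[OF Es oV]) (use r in auto)
    moreover have "smooth_on ?V (\<lambda>p. B n (fst p, (snd p)\<^sup>2))"
      by (rule smooth_on_compose[OF B])
         (auto intro!: smooth_on_Pair smooth_on_power smooth_on_fst smooth_on_snd open_Times)
    ultimately have "smooth_on ?V w" unfolding w_def[abs_def]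
      by (intro smooth_on_mult smooth_on_diff smooth_on_power smooth_on_snd oV)
    moreover have "z p = snd p ^ n * w p" if "p \<in> ?V" for p
    proof -
      obtain x y where p: "p = (x, y)" by (cases p)
      have "\<bar>x\<bar> < r/2" "\<bar>x\<bar> < r" "\<bar>y\<bar> < r" using that p by auto
      then have "z p = (y\<^sup>2) ^ n * (E n (x, y) - B n (x, y\<^sup>2))"
        using taylor[of x y n] bB[of x "y\<^sup>2" n] by (simp add: z_def p algebra_simps)
      also have "(y\<^sup>2) ^ n = y ^ n * y ^ n" by (simp add: power2_eq_square power_mult_distrib)
      finally show ?thesis by (simp add: w_def p mult_ac)
    qed
    ultimately show "\<exists>w. smooth_on ?V w \<and> (\<forall>p\<in>?V. z p = snd p ^ n * w p)" by blast
  qed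
  let ?W = "?J \<times> {..<r\<^sup>2}"
  have "smooth_on ?W (half_plane_glue z)" by (rule half_plane_glue_smooth[OF r _ flat]) simp
  moreover have "smooth_on ?W b" by (rule smooth_on_subset[OF b]) (auto intro: open_Times)
  ultimately have "smooth_on ?W (\<lambda>p. b p + half_plane_glue z p)" by (intro smooth_on_add)
  then have a: "smooth_germ (\<lambda>p. b p + half_plane_glue z p)"
    by (rule smooth_germI) (use r in \<open>auto simp: zero_prod_def\<close>)
  have "\<forall>\<^sub>F p in nhds 0. f p = b (fst p, (snd p)\<^sup>2) + half_plane_glue z (fst p, (snd p)\<^sup>2)"
  proof (rule eventually_box[of "r/2"])
    fix x y :: real assume xy: "\<bar>x\<bar> < r/2" "\<bar>y\<bar> < r/2"
    \<comment> \<open>On y = 0 the glued part is 0 and \<open>b\<close> has the value of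
      \<open>f\<close>, its coefficient of order 0. Elsewhere sqrt(y^2) is the absolute value of y,
      and evenness of \<open>f\<close> removes it.\<close>
    show "f (x, y) = b (fst (x, y), (snd (x, y))\<^sup>2) + half_plane_glue z (fst (x, y), (snd (x, y))\<^sup>2)"
    proof (cases "y = 0")
      case True
      then show ?thesis using bB[where n=1 and x=x and y=0] xy by (simp add: half_plane_glue_def E0)
    next
      case False
      have "f (x, \<bar>y\<bar>) = f (x, y)" using even[of x y] by (cases "y \<ge> 0") auto
      then show ?thesis using False by (simp add: half_plane_glue_def z_def)
    qed
  qed (use r in auto)
  then show ?thesis using that[OF a] by simp
qed

text \<open>The even part and the odd part divided by y are both even, and Whitney's theorem applies
  to each. This exhibits 1 and y as generators of the smooth germs in (x, y) over those in (x,
  y^2).\<close>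

lemma whitney_decomposition:
  fixes g :: "real \<times> real \<Rightarrow> real"
  assumes "smooth_germ g"
  obtains a b where "smooth_germ a" "smooth_germ b"
    "\<forall>\<^sub>F p in nhds 0. g p = a (fst p, (snd p)\<^sup>2) + snd p * b (fst p, (snd p)\<^sup>2)"
proof -
  obtain r where r: "r > 0" and g: "smooth_on ({-r<..<r} \<times> {-r<..<r}) g" by (rule smooth_germ_box[OF assms])
  let ?U = "{-r<..<r} \<times> {-r<..<r}"
  have o: "open ?U" by (intro open_Times) auto
  have refl: "smooth_on ?U (\<lambda>p. g (fst p, - snd p))" if "smooth_on ?U g" for g :: "real \<times> real \<Rightarrow> real"
    by (rule smooth_on_compose[OF that])
       (auto intro!: smooth_on_Pair smooth_on_minus smooth_on_fst smooth_on_snd o)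
  define ev od where "ev p = (g p + g (fst p, - snd p)) * (1/2)"
    and "od p = (g p - g (fst p, - snd p)) * (1/2)" for p
  have s: "smooth_on ?U ev" "smooth_on ?U od" unfolding ev_def[abs_def] od_def[abs_def]
    by (intro smooth_on_mult smooth_on_diff smooth_on_add refl[OF g] g smooth_on_const o)+
  obtain h where h: "smooth_on ?U h" "\<And>x y. \<bar>x\<bar> < r \<Longrightarrow> \<bar>y\<bar> < r \<Longrightarrow> od (x, y) = y * h (x, y)"
  proof (rule hadamard_division_box[OF s(2)])
    show "od (x, 0) = 0" for x by (simp add: od_def)
  qed (rule that)
  define h' where "h' p = (h p + h (fst p, - snd p)) * (1/2)" for p
  have h': "smooth_on ?U h'" unfolding h'_def[abs_def]
    by (intro smooth_on_mult smooth_on_add refl[OF h(1)] h(1) smooth_on_const o)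
  obtain a where a: "smooth_germ a" "\<forall>\<^sub>F p in nhds 0. ev p = a (fst p, (snd p)\<^sup>2)"
  proof (rule whitney_even[OF r s(1)])
    show "ev (x, -y) = ev (x, y)" for x y by (simp add: ev_def)
  qed (rule that)
  obtain b where b: "smooth_germ b" "\<forall>\<^sub>F p in nhds 0. h' p = b (fst p, (snd p)\<^sup>2)"
  proof (rule whitney_even[OF r h'])
    show "h' (x, -y) = h' (x, y)" for x y by (simp add: h'_def)
  qed (rule that)
  have "\<forall>\<^sub>F p in nhds 0. g p = ev p + snd p * h' p"
  proof (rule eventually_box[OF r])
    fix x y :: real assume xy: "\<bar>x\<bar> < r" "\<bar>y\<bar> < r"
    then have xy': "\<bar>- y\<bar> < r" by simp
    have "od (x, -y) = - od (x, y)" unfolding od_def fst_conv snd_conv minus_minus by (simp only: minus_mult_left minus_diff_eq)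
    then have "y * h (x, -y) = y * h (x, y)" using h(2)[OF xy] h(2)[OF xy(1) xy'] by simp
    then have "y * h' (x, y) = od (x, y)" using h(2)[OF xy] by (cases "y = 0") (auto simp: h'_def)
    then show "g (x, y) = ev (x, y) + snd (x, y) * h' (x, y)" by (simp add: ev_def od_def field_simps)
  qed
  with a(2) b(2) have "\<forall>\<^sub>F p in nhds 0. g p = a (fst p, (snd p)\<^sup>2) + snd p * b (fst p, (snd p)\<^sup>2)"
    by eventually_elim simp
  then show ?thesis by (rule that[OF a(1) b(1)])
qed

subsection \<open>A linear functional equation\<close>

text \<open>The map \<open>p\<close> is only required not to expand; convergence comes from a
  coefficient bounded by 1/4. The bound on \<open>deriv p\<close> ensures that the coefficient a p'
  of the differentiated equation satisfies the same bound.\<close>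

locale contracting_equation =
  fixes R :: real and p :: "real \<Rightarrow> real"
  assumes p_smooth: "smooth_on {-R<..<R} p"
    and p_le: "\<And>y. \<bar>y\<bar> < R \<Longrightarrow> \<bar>p y\<bar> \<le> \<bar>y\<bar>"
    and p'_le: "\<And>y. \<bar>y\<bar> < R \<Longrightarrow> \<bar>deriv p y\<bar> \<le> 1"
begin

abbreviation I where "I \<equiv> {-R<..<R}"

lemma p_in: "y \<in> I \<Longrightarrow> p y \<in> I"
  using p_le[of y] by (auto simp: abs_le_iff abs_less_iff)

text \<open>Continuity on the open interval gives no uniform bound, so estimates are made on
  symmetric compact intervals, each of which \<open>p\<close> maps into itself.\<close>

lemma bounded_on_subinterval:
  fixes g :: "real \<Rightarrow> real"
  assumes "continuous_on I g" "c < R"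
  obtains M where "M \<ge> 0" "\<And>y. \<bar>y\<bar> \<le> c \<Longrightarrow> \<bar>g y\<bar> \<le> M"
proof -
  have "continuous_on {-c..c} g" by (rule continuous_on_subset[OF assms(1)]) (use assms(2) in auto)
  then have "bounded (g ` {-c..c})" by (intro compact_imp_bounded compact_continuous_image) auto
  then obtain M where M: "\<forall>y\<in>{-c..c}. \<bar>g y\<bar> \<le> M" unfolding bounded_iff real_norm_def by blast
  have "\<bar>g y\<bar> \<le> max M 0" if "\<bar>y\<bar> \<le> c" for y
    using M[rule_format, of y] that by (auto simp: abs_le_iff)
  then show ?thesis by (intro that[of "max M 0"]) auto
qed

text \<open>The difference of two solutions satisfies the homogeneous equation; n iterations bound
  it by (1/4)^n times its maximum on an invariant interval. This identifies an arbitrary continuous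
  solution with the series, whose derivative is known.\<close>

lemma solution_unique:
  fixes a \<rho> k l :: "real \<Rightarrow> real"
  assumes a: "\<And>y. y \<in> I \<Longrightarrow> \<bar>a y\<bar> \<le> 1/4"
    and k: "continuous_on I k" "\<And>y. y \<in> I \<Longrightarrow> k y = \<rho> y + a y * k (p y)"
    and l: "continuous_on I l" "\<And>y. y \<in> I \<Longrightarrow> l y = \<rho> y + a y * l (p y)"
    and y: "y \<in> I"
  shows "k y = l y"
proof -
  have c: "\<bar>y\<bar> < R" using y by auto
  have "continuous_on I (\<lambda>y. k y - l y)" by (intro continuous_intros k l)
  from bounded_on_subinterval[OF this c] obtain M where M: "M \<ge> 0" "\<And>t. \<bar>t\<bar> \<le> \<bar>y\<bar> \<Longrightarrow> \<bar>k t - l t\<bar> \<le> M"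
    by blast
  have bound: "\<bar>k t - l t\<bar> \<le> (1/4) ^ n * M" if "\<bar>t\<bar> \<le> \<bar>y\<bar>" for n t
    using that
  proof (induction n arbitrary: t)
    case 0
    then show ?case using M by simp
  next
    case (Suc n)
    have t: "t \<in> I" using Suc.prems c by auto
    have "\<bar>p t\<bar> \<le> \<bar>y\<bar>" using p_le[of t] Suc.prems c by linarith
    then have IH: "\<bar>k (p t) - l (p t)\<bar> \<le> (1/4) ^ n * M" by (rule Suc.IH)
    have "k t - l t = a t * (k (p t) - l (p t))" using k(2)[OF t] l(2)[OF t] by (simp add: algebra_simps)
    then have "\<bar>k t - l t\<bar> = \<bar>a t\<bar> * \<bar>k (p t) - l (p t)\<bar>" by (simp add: abs_mult)
    also have "\<dots> \<le> 1/4 * ((1/4) ^ n * M)" using a[OF t] IH by (intro mult_mono) auto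
    finally show ?case by simp
  qed
  have "(\<lambda>n. (1/4) ^ n * M) \<longlonglongrightarrow> 0 * M" by (intro tendsto_intros LIMSEQ_realpow_zero) auto
  then have "\<bar>k y - l y\<bar> \<le> 0 * M"
    by (rule LIMSEQ_le_const) (use bound[of y] in auto)
  then show ?thesis by simp
qed

text \<open>The n-th term of the series obtained by substituting the equation into itself: a(y) a(p
  y) ... a(p^(n-1) y) \<rho>(p^n y), with powers of \<open>p\<close> meaning iterates.\<close>

primrec W :: "(real \<Rightarrow> real) \<Rightarrow> (real \<Rightarrow> real) \<Rightarrow> nat \<Rightarrow> real \<Rightarrow> real" where
  "W a \<rho> 0 y = \<rho> y"
| "W a \<rho> (Suc n) y = a y * W a \<rho> n (p y)"

primrec W' :: "(real \<Rightarrow> real) \<Rightarrow> (real \<Rightarrow> real) \<Rightarrow> nat \<Rightarrow> real \<Rightarrow> real" where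
  "W' a \<rho> 0 y = deriv \<rho> y"
| "W' a \<rho> (Suc n) y = deriv a y * W a \<rho> n (p y) + a y * (W' a \<rho> n (p y) * deriv p y)"

lemma p_cont: "continuous_on I p" "continuous_on I (deriv p)"
  using p_smooth smooth_on_deriv smooth_on_continuous by blast+

lemma W_cont: "continuous_on I a \<Longrightarrow> continuous_on I \<rho> \<Longrightarrow> continuous_on I (W a \<rho> n)"
  by (induction n) (auto intro!: continuous_intros p_cont intro: continuous_on_compose2 p_in)

lemma W'_cont:
  "continuous_on I a \<Longrightarrow> continuous_on I \<rho> \<Longrightarrow> continuous_on I (deriv a) \<Longrightarrow> continuous_on I (deriv \<rho>)
    \<Longrightarrow> continuous_on I (W' a \<rho> n)"
proof (induction n)
  case (Suc n)
  have "continuous_on I (\<lambda>y. W a \<rho> n (p y))" "continuous_on I (\<lambda>y. W' a \<rho> n (p y))"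
    using continuous_on_compose2[OF W_cont p_cont(1)] continuous_on_compose2[OF Suc.IH p_cont(1)]
      Suc.prems p_in by blast+
  then show ?case using Suc.prems by (auto intro!: continuous_intros p_cont)
qed auto

lemma W_has_derivative:
  assumes a: "\<And>y. y \<in> I \<Longrightarrow> (a has_real_derivative deriv a y) (at y)"
    and \<rho>: "\<And>y. y \<in> I \<Longrightarrow> (\<rho> has_real_derivative deriv \<rho> y) (at y)"
    and "y \<in> I"
  shows "(W a \<rho> n has_real_derivative W' a \<rho> n y) (at y)"
  using assms(3)
proof (induction n arbitrary: y)
  case 0
  then show ?case using \<rho> by (simp add: fun_eq_iff[symmetric])
next
  case (Suc n)
  have "((\<lambda>y. W a \<rho> n (p y)) has_real_derivative W' a \<rho> n (p y) * deriv p y) (at y)"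
    by (rule DERIV_chain2[OF Suc.IH[OF p_in[OF Suc.prems]] smooth_on_real_has_derivative[OF p_smooth Suc.prems]])
  from DERIV_mult[OF a[OF Suc.prems] this]
  show ?case by (simp add: algebra_simps)
qed

lemma W_bound:
  assumes a: "\<And>y. y \<in> I \<Longrightarrow> \<bar>a y\<bar> \<le> 1/4" and M: "\<And>y. \<bar>y\<bar> \<le> c \<Longrightarrow> \<bar>\<rho> y\<bar> \<le> M" and c: "c < R"
    and y: "\<bar>y\<bar> \<le> c"
  shows "\<bar>W a \<rho> n y\<bar> \<le> (1/4) ^ n * M"
  using y
proof (induction n arbitrary: y)
  case 0
  then show ?case using M by simp
next
  case (Suc n)
  have "y \<in> I" using Suc.prems c by auto
  moreover have "\<bar>p y\<bar> \<le> c" using p_le[of y] Suc.prems c by linarith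
  ultimately have "\<bar>a y\<bar> * \<bar>W a \<rho> n (p y)\<bar> \<le> 1/4 * ((1/4) ^ n * M)"
    using a Suc.IH by (intro mult_mono) auto
  then show ?case by (simp add: abs_mult)
qed

text \<open>Differentiating the product produces terms of size n / 4^n, so the rate 1/4 is relaxed
  to 1/2. Each of the two summands of the recursion is then at most (1/2)^n B / 4; for the one
  containing a' this is the condition 4 A M \<le> B.\<close>

lemma W'_bound:
  assumes a: "\<And>y. y \<in> I \<Longrightarrow> \<bar>a y\<bar> \<le> 1/4" and M: "\<And>y. \<bar>y\<bar> \<le> c \<Longrightarrow> \<bar>\<rho> y\<bar> \<le> M" and c: "c < R"
    and A: "\<And>y. \<bar>y\<bar> \<le> c \<Longrightarrow> \<bar>deriv a y\<bar> \<le> A"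
    and B: "\<And>y. \<bar>y\<bar> \<le> c \<Longrightarrow> \<bar>deriv \<rho> y\<bar> \<le> B" "4 * (A * M) \<le> B" and pos: "A \<ge> 0" "M \<ge> 0" "B \<ge> 0"
    and y: "\<bar>y\<bar> \<le> c"
  shows "\<bar>W' a \<rho> n y\<bar> \<le> (1/2) ^ n * B"
  using y
proof (induction n arbitrary: y)
  case 0
  then show ?case using B by simp
next
  case (Suc n)
  have y: "y \<in> I" "\<bar>y\<bar> < R" using Suc.prems c by auto
  have py: "\<bar>p y\<bar> \<le> c" using p_le[of y] Suc.prems c by linarith
  have "\<bar>deriv a y * W a \<rho> n (p y)\<bar> \<le> A * ((1/4) ^ n * M)"
    unfolding abs_mult using A[OF Suc.prems] W_bound[OF a M c py] pos by (intro mult_mono) auto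
  also have "\<dots> = (1/4) ^ n * (A * M)" by simp
  also have "\<dots> \<le> (1/2) ^ n * (A * M)" using pos by (intro mult_right_mono power_mono) auto
  also have "\<dots> \<le> (1/2) ^ n * (B / 4)" using B(2) by (intro mult_left_mono) auto
  finally have 1: "\<bar>deriv a y * W a \<rho> n (p y)\<bar> \<le> (1/2) ^ n * (B / 4)" .
  have "\<bar>W' a \<rho> n (p y)\<bar> * \<bar>deriv p y\<bar> \<le> ((1/2) ^ n * B) * 1"
    using Suc.IH[OF py] p'_le[OF y(2)] pos by (intro mult_mono) auto
  then have "\<bar>W' a \<rho> n (p y)\<bar> * \<bar>deriv p y\<bar> \<le> (1/2) ^ n * B" by simp
  then have "\<bar>a y\<bar> * (\<bar>W' a \<rho> n (p y)\<bar> * \<bar>deriv p y\<bar>) \<le> 1/4 * ((1/2) ^ n * B)"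
    by (rule mult_mono[OF a[OF y(1)]]) auto
  then have 2: "\<bar>a y * (W' a \<rho> n (p y) * deriv p y)\<bar> \<le> (1/2) ^ n * (B / 4)"
    by (simp add: abs_mult)
  have "\<bar>W' a \<rho> (Suc n) y\<bar> \<le> (1/2) ^ n * (B / 4) + (1/2) ^ n * (B / 4)"
    unfolding W'.simps using 1 2 abs_triangle_ineq by (meson add_mono order_trans)
  also have "\<dots> = (1/2) ^ Suc n * B" by simp
  finally show ?case .
qed

definition sol :: "(real \<Rightarrow> real) \<Rightarrow> (real \<Rightarrow> real) \<Rightarrow> real \<Rightarrow> real" where
  "sol a \<rho> y = (\<Sum>n. W a \<rho> n y)"

lemma
  fixes a \<rho> :: "real \<Rightarrow> real"
  assumes a: "\<And>y. y \<in> I \<Longrightarrow> \<bar>a y\<bar> \<le> 1/4" "continuous_on I a" and \<rho>: "continuous_on I \<rho>"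
  shows W_summable: "y \<in> I \<Longrightarrow> summable (\<lambda>n. W a \<rho> n y)"
    and sol_cont: "continuous_on I (sol a \<rho>)"
    and sol_eq: "y \<in> I \<Longrightarrow> sol a \<rho> y = \<rho> y + a y * sol a \<rho> (p y)"
proof -
  have unif: "uniform_limit {-c..c} (\<lambda>N y. \<Sum>n<N. W a \<rho> n y) (sol a \<rho>) sequentially" if c: "c < R" for c
  proof -
    obtain M where M: "M \<ge> 0" "\<And>y. \<bar>y\<bar> \<le> c \<Longrightarrow> \<bar>\<rho> y\<bar> \<le> M"
      by (rule bounded_on_subinterval[OF \<rho> c]) (rule that)
    show ?thesis unfolding sol_def
      by (rule Weierstrass_m_test[where M="\<lambda>n. (1/4) ^ n * M"])
         (auto intro!: W_bound[OF a(1) M(2) c] summable_mult2 summable_geometric)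
  qed
  have summ: "summable (\<lambda>n. W a \<rho> n y)" if "y \<in> I" for y
  proof -
    have c: "\<bar>y\<bar> < R" using that by auto
    obtain M where M: "M \<ge> 0" "\<And>t. \<bar>t\<bar> \<le> \<bar>y\<bar> \<Longrightarrow> \<bar>\<rho> t\<bar> \<le> M"
      by (rule bounded_on_subinterval[OF \<rho> c]) (rule that)
    show ?thesis
      by (rule summable_comparison_test'[where g="\<lambda>n. (1/4) ^ n * M"])
         (auto intro!: W_bound[OF a(1) M(2) c] summable_mult2 summable_geometric)
  qed
  then show "y \<in> I \<Longrightarrow> summable (\<lambda>n. W a \<rho> n y)" .
  show "continuous_on I (sol a \<rho>)"
  proof (rule continuous_at_imp_continuous_on, rule ballI)
    fix y assume y: "y \<in> I"
    \<comment> \<open>A midpoint: y is interior to [-c, c], which still lies in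
      \<open>I\<close>.\<close>
    define c where "c = (\<bar>y\<bar> + R) / 2"
    have c: "c < R" "\<bar>y\<bar> < c" using y by (auto simp: c_def)
    have "continuous_on {-c..c} (sol a \<rho>)"
    proof (rule uniform_limit_theorem[OF _ unif[OF c(1)]])
      have "continuous_on {-c..c} (W a \<rho> n)" for n
        by (rule continuous_on_subset[OF W_cont[OF a(2) \<rho>]]) (use c in auto)
      then show "\<forall>\<^sub>F N in sequentially. continuous_on {-c..c} (\<lambda>y. \<Sum>n<N. W a \<rho> n y)"
        by (intro always_eventually allI continuous_on_sum)
    qed simp
    then show "isCont (sol a \<rho>) y" by (rule continuous_on_interior) (use c in auto)
  qed
  show "y \<in> I \<Longrightarrow> sol a \<rho> y = \<rho> y + a y * sol a \<rho> (p y)"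
    unfolding sol_def using suminf_split_head[OF summ, of y] suminf_mult[OF summ[OF p_in], of y "a y"]
    by simp
qed

lemma
  fixes a \<rho> :: "real \<Rightarrow> real"
  assumes a: "\<And>y. y \<in> I \<Longrightarrow> \<bar>a y\<bar> \<le> 1/4" "smooth_on I a" and \<rho>: "ck (Suc 0) I \<rho>"
  shows sol_deriv: "y \<in> I \<Longrightarrow> (sol a \<rho> has_real_derivative deriv (sol a \<rho>) y) (at y)"
    and sol_deriv_cont: "continuous_on I (deriv (sol a \<rho>))"
proof -
  have da: "(a has_real_derivative deriv a y) (at y)" if "y \<in> I" for y
    by (rule smooth_on_real_has_derivative[OF a(2) that])
  have d\<rho>: "(\<rho> has_real_derivative deriv \<rho> y) (at y)" if "y \<in> I" for y
  proof -
    have "\<rho> differentiable (at y)" using \<rho> that by simp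
    then show ?thesis by (auto simp: real_differentiable_def dest: DERIV_imp_deriv)
  qed
  have c\<rho>: "continuous_on I \<rho>" using \<rho> ck_imp_continuous_on by blast
  have cd\<rho>: "continuous_on I (deriv \<rho>)"
  proof -
    have "continuous_on I (\<lambda>x. frechet_derivative \<rho> (at x) 1)" using \<rho> by simp
    moreover have "frechet_derivative \<rho> (at y) 1 = deriv \<rho> y" if "y \<in> I" for y
      using frechet_derivative_at[OF d\<rho>[OF that, unfolded has_field_derivative_def]]
      by (metis mult.right_neutral)
    ultimately show ?thesis by (metis (no_types, lifting) continuous_on_cong)
  qed
  have ca: "continuous_on I a" "continuous_on I (deriv a)"
    using a(2) smooth_on_deriv smooth_on_continuous by blast+
  define s' where "s' y = (\<Sum>n. W' a \<rho> n y)" for y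
  have unif: "uniform_limit {-c..c} (\<lambda>N y. \<Sum>n<N. W' a \<rho> n y) s' sequentially" if c: "c < R" for c
  proof -
    obtain M where M: "M \<ge> 0" "\<And>y. \<bar>y\<bar> \<le> c \<Longrightarrow> \<bar>\<rho> y\<bar> \<le> M"
      by (rule bounded_on_subinterval[OF c\<rho> c]) (rule that)
    obtain A where A: "A \<ge> 0" "\<And>y. \<bar>y\<bar> \<le> c \<Longrightarrow> \<bar>deriv a y\<bar> \<le> A"
      by (rule bounded_on_subinterval[OF ca(2) c]) (rule that)
    obtain B0 where B0: "B0 \<ge> 0" "\<And>y. \<bar>y\<bar> \<le> c \<Longrightarrow> \<bar>deriv \<rho> y\<bar> \<le> B0"
      by (rule bounded_on_subinterval[OF cd\<rho> c]) (rule that)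
    define B where "B = B0 + 4 * (A * M)"
    have AM: "A * M \<ge> 0" using A M by simp
    have B: "B \<ge> 0" "4 * (A * M) \<le> B" "\<And>y. \<bar>y\<bar> \<le> c \<Longrightarrow> \<bar>deriv \<rho> y\<bar> \<le> B"
      using B0 AM by (auto simp: B_def intro: add_increasing2)
    show ?thesis unfolding s'_def
      by (rule Weierstrass_m_test[where M="\<lambda>n. (1/2) ^ n * B"])
         (auto intro!: W'_bound[OF a(1) M(2) c A(2) B(3,2) A(1) M(1) B(1)] summable_mult2 summable_geometric)
  qed
  have der: "(sol a \<rho> has_real_derivative s' y) (at y)" if y: "y \<in> I" for y
  proof -
    define c where "c = (\<bar>y\<bar> + R) / 2"
    have c: "c < R" "\<bar>y\<bar> < c" using y by (auto simp: c_def)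
    have "((\<lambda>y. \<Sum>n. W a \<rho> n y) has_real_derivative (\<Sum>n. W' a \<rho> n y)) (at y)"
    proof (rule has_field_derivative_series'(2)[where S="{-c..c}"])
      show "(W a \<rho> n has_real_derivative W' a \<rho> n t) (at t within {-c..c})" if "t \<in> {-c..c}" for n t
        by (rule has_field_derivative_at_within[OF W_has_derivative[OF da d\<rho>]]) (use that c in auto)
      show "uniformly_convergent_on {-c..c} (\<lambda>N y. \<Sum>n<N. W' a \<rho> n y)"
        using unif[OF c(1)] unfolding uniformly_convergent_on_def by blast
      show "y \<in> {-c..c}" "y \<in> interior {-c..c}" using c by auto
      show "summable (\<lambda>n. W a \<rho> n y)" by (rule W_summable[OF a(1) ca(1) c\<rho> y])
    qed simp
    then show ?thesis by (simp add: sol_def[abs_def] s'_def)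
  qed
  then have eq: "deriv (sol a \<rho>) y = s' y" if "y \<in> I" for y using DERIV_imp_deriv that by blast
  show "y \<in> I \<Longrightarrow> (sol a \<rho> has_real_derivative deriv (sol a \<rho>) y) (at y)" using der eq by simp
  have "continuous_on I s'"
  proof (rule continuous_at_imp_continuous_on, rule ballI)
    fix y assume y: "y \<in> I"
    define c where "c = (\<bar>y\<bar> + R) / 2"
    have c: "c < R" "\<bar>y\<bar> < c" using y by (auto simp: c_def)
    have "continuous_on {-c..c} s'"
    proof (rule uniform_limit_theorem[OF _ unif[OF c(1)]])
      have "continuous_on {-c..c} (W' a \<rho> n)" for n
        by (rule continuous_on_subset[OF W'_cont[OF ca(1) c\<rho> ca(2) cd\<rho>]]) (use c in auto)
      then show "\<forall>\<^sub>F N in sequentially. continuous_on {-c..c} (\<lambda>y. \<Sum>n<N. W' a \<rho> n y)"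
        by (intro always_eventually allI continuous_on_sum)
    qed simp
    then show "isCont s' y" by (rule continuous_on_interior) (use c in auto)
  qed
  then show "continuous_on I (deriv (sol a \<rho>))"
    using eq by (metis (no_types, lifting) continuous_on_cong)
qed

text \<open>The derivative of a solution solves an equation of the same kind, with coefficient
  \<open>a p'\<close> and inhomogeneity \<open>\<rho>' + a' (k \<circ> p)\<close>; this is why the coefficient \<open>a\<close> is not constant.\<close>

lemma solution_ck:
  fixes a \<rho> k :: "real \<Rightarrow> real"
  assumes "smooth_on I a" "\<And>y. y \<in> I \<Longrightarrow> \<bar>a y\<bar> \<le> 1/4" "ck n I \<rho>"
    and "continuous_on I k" "\<And>y. y \<in> I \<Longrightarrow> k y = \<rho> y + a y * k (p y)"
  shows "ck n I k"
  using assms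
proof (induction n arbitrary: a \<rho> k)
  case 0
  then show ?case by simp
next
  case (Suc n)
  have \<rho>1: "ck (Suc 0) I \<rho>" by (rule ck_mono[OF Suc.prems(3)]) simp
  have c\<rho>: "continuous_on I \<rho>" using Suc.prems(3) ck_imp_continuous_on by blast
  have ca: "continuous_on I a" using Suc.prems(1) smooth_on_continuous by blast
  have \<rho>n: "ck n I \<rho>" using Suc.prems(3) ck_Suc_imp_ck by blast
  \<comment> \<open>First use of the induction hypothesis, for \<open>k\<close> itself: it makes the
    new inhomogeneity, which contains k \<circ> p, of class C^n. The second use, for the derivative,
    gains one order.\<close>
  have kn: "ck n I k" by (rule Suc.IH[OF Suc.prems(1,2) \<rho>n Suc.prems(4,5)])
  let ?s = "sol a \<rho>"
  have ks: "k y = ?s y" if "y \<in> I" for y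
    by (rule solution_unique[OF Suc.prems(2) Suc.prems(4,5) sol_cont[OF Suc.prems(2) ca c\<rho>]
          sol_eq[OF Suc.prems(2) ca c\<rho>] that])
  have sd: "(?s has_real_derivative deriv ?s y) (at y)" if "y \<in> I" for y
    by (rule sol_deriv[OF Suc.prems(2,1) \<rho>1 that])
  have kd: "(k has_real_derivative deriv ?s y) (at y)" if "y \<in> I" for y
    by (rule has_field_derivative_transform_within_open[OF sd[OF that], of I]) (use that ks in auto)
  have d\<rho>: "(\<rho> has_real_derivative deriv \<rho> y) (at y)" if "y \<in> I" for y
  proof -
    have "\<rho> differentiable (at y)" using \<rho>1 that by simp
    then show ?thesis by (auto simp: real_differentiable_def dest: DERIV_imp_deriv)
  qed
  have eq: "deriv ?s y = (deriv \<rho> y + deriv a y * k (p y)) + (a y * deriv p y) * deriv ?s (p y)"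
    if y: "y \<in> I" for y
  proof -
    have "((\<lambda>y. \<rho> y + a y * k (p y)) has_real_derivative
        deriv \<rho> y + (deriv a y * k (p y) + (deriv ?s (p y) * deriv p y) * a y)) (at y)"
      by (intro DERIV_add DERIV_mult d\<rho>[OF y] smooth_on_real_has_derivative[OF Suc.prems(1) y]
          DERIV_chain2[OF kd[OF p_in[OF y]] smooth_on_real_has_derivative[OF p_smooth y]])
    then have "(k has_real_derivative
        deriv \<rho> y + (deriv a y * k (p y) + (deriv ?s (p y) * deriv p y) * a y)) (at y)"
      by (rule has_field_derivative_transform_within_open[of _ _ _ I]) (use y Suc.prems(5) in auto)
    from DERIV_unique[OF kd[OF y] this] show ?thesis by (simp add: algebra_simps)
  qed
  have "ck n I (deriv ?s)"
  proof (rule Suc.IH[OF _ _ _ sol_deriv_cont[OF Suc.prems(2,1) \<rho>1] eq])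
    show "smooth_on I (\<lambda>y. a y * deriv p y)"
      by (intro smooth_on_mult smooth_on_deriv p_smooth Suc.prems(1))
    show "\<bar>a y * deriv p y\<bar> \<le> 1/4" if "y \<in> I" for y
    proof -
      have "\<bar>a y\<bar> * \<bar>deriv p y\<bar> \<le> 1/4 * 1"
        using Suc.prems(2)[OF that] p'_le[of y] that by (intro mult_mono) auto
      then show ?thesis by (simp add: abs_mult)
    qed
    have "ck n I (\<lambda>y. frechet_derivative \<rho> (at y) 1)" using Suc.prems(3) by simp
    then have "ck n I (deriv \<rho>)"
    proof (rule ck_cong[rotated 2])
      show "frechet_derivative \<rho> (at y) 1 = deriv \<rho> y" if "y \<in> I" for y
        using frechet_derivative_at[OF d\<rho>[OF that, unfolded has_field_derivative_def]]
        by (metis mult.right_neutral)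
    qed simp
    moreover have "ck n I (deriv a)" using smooth_on_deriv[OF Suc.prems(1)] smooth_on_iff_ck by blast
    moreover have "ck n I (\<lambda>y. k (p y))"
      by (rule ck_compose[OF _ _ kn]) (use p_smooth p_in in \<open>auto simp: smooth_on_iff_ck\<close>)
    ultimately show "ck n I (\<lambda>y. deriv \<rho> y + deriv a y * k (p y))"
      by (intro ck_add ck_mult) auto
  qed
  then show ?case by (intro ck_Suc_realI[OF _ kd]) auto
qed

lemma solution_smooth:
  fixes \<rho> :: "real \<Rightarrow> real"
  assumes "smooth_on I \<rho>"
  obtains k where "smooth_on I k" "\<And>y. y \<in> I \<Longrightarrow> k y = \<rho> y + 1/4 * k (p y)"
proof
  let ?k = "sol (\<lambda>_. 1/4) \<rho>"
  have c: "continuous_on I \<rho>" using assms smooth_on_continuous by blast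
  show eq: "?k y = \<rho> y + 1/4 * ?k (p y)" if "y \<in> I" for y
    by (rule sol_eq[OF _ _ c that]) auto
  have cont: "continuous_on I ?k" by (rule sol_cont[OF _ _ c]) auto
  have "ck n I ?k" for n
  proof (rule solution_ck[where a="\<lambda>_. 1/4" and \<rho>=\<rho>, OF _ _ _ cont])
    show "ck n I \<rho>" using assms by (simp add: smooth_on_iff_ck)
    show "?k y = \<rho> y + 1/4 * ?k (p y)" if "y \<in> I" for y by (rule eq[OF that])
  qed (auto intro: smooth_on_const)
  then show "smooth_on I ?k" by (simp add: smooth_on_iff_ck)
qed

end

text \<open>Since \<open>deriv p\<close> is continuous and 0 at 0, it is below 1 in absolute value
  on a small interval; the mean value inequality and p(0) = 0 then make \<open>p\<close>
  non-expanding there.\<close>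

lemma functional_equation_germ:
  fixes p \<rho> :: "real \<Rightarrow> real"
  assumes p: "smooth_germ p" "p 0 = 0" "(p has_real_derivative 0) (at 0)" and \<rho>: "smooth_germ \<rho>"
  obtains k where "smooth_germ k" "\<forall>\<^sub>F y in nhds 0. k y = \<rho> y + 1/4 * k (p y)"
proof -
  obtain U where U: "0 \<in> U" "smooth_on U p" "smooth_on U \<rho>" by (rule smooth_germ_common_domain[OF p(1) \<rho>])
  have "isCont (deriv p) 0"
    using smooth_on_continuous[OF smooth_on_deriv[OF U(2)]] smooth_on_open[OF U(2)] U(1)
      continuous_on_eq_continuous_at by blast
  moreover have "deriv p 0 = 0" using p(3) by (rule DERIV_imp_deriv)
  ultimately have "\<forall>e>0. \<exists>d>0. \<forall>y. \<bar>y\<bar> < d \<longrightarrow> \<bar>deriv p y\<bar> < e"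
    by (simp add: continuous_at_eps_delta dist_real_def)
  then obtain d where d: "d > 0" "\<And>y. \<bar>y\<bar> < d \<Longrightarrow> \<bar>deriv p y\<bar> < 1"
    using zero_less_one by blast
  obtain c where c: "c > 0" "\<And>y. \<bar>y\<bar> < c \<Longrightarrow> y \<in> U"
    using smooth_on_open[OF U(2)] U(1) unfolding open_dist dist_real_def by auto
  define R where "R = min c d"
  have R: "R > 0" using c d by (simp add: R_def)
  have sub: "{-R<..<R} \<subseteq> U" using c(2) by (auto simp: R_def)
  interpret contracting_equation R p
  proof
    show sm: "smooth_on {-R<..<R} p" by (rule smooth_on_subset[OF U(2) _ sub]) simp
    show "\<bar>deriv p y\<bar> \<le> 1" if "\<bar>y\<bar> < R" for y using d(2)[of y] that by (simp add: R_def)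
    show "\<bar>p y\<bar> \<le> \<bar>y\<bar>" if "\<bar>y\<bar> < R" for y
    proof -
      have "norm (p y - p 0) \<le> 1 * norm (y - 0)"
      proof (rule field_differentiable_bound[of "{-R<..<R}"])
        show "(p has_real_derivative deriv p t) (at t within {-R<..<R})" if "t \<in> {-R<..<R}" for t
          by (rule has_field_derivative_at_within[OF smooth_on_real_has_derivative[OF sm that]])
        show "norm (deriv p t) \<le> 1" if "t \<in> {-R<..<R}" for t
        proof -
          have "\<bar>t\<bar> < d" using that by (auto simp: R_def min_def split: if_splits)
          then show ?thesis using d(2)[of t] by simp
        qed
      qed (use that R in auto)
      then show ?thesis using p(2) by simp
    qed
  qed
  obtain k where k: "smooth_on I k" "\<And>y. y \<in> I \<Longrightarrow> k y = \<rho> y + 1/4 * k (p y)"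
    by (rule solution_smooth[OF smooth_on_subset[OF U(3) open_greaterThanLessThan sub]]) (rule that)
  have "\<forall>\<^sub>F y in nhds 0. y \<in> I" by (rule eventually_nhds_in_open) (use R in auto)
  then have "\<forall>\<^sub>F y in nhds 0. k y = \<rho> y + 1/4 * k (p y)" by eventually_elim (rule k(2))
  moreover have "smooth_germ k" by (rule smooth_germI[OF k(1)]) (use R in auto)
  ultimately show ?thesis by (rule that[rotated])
qed

subsection \<open>Geometry of a type (III) germ\<close>

abbreviation fold_map :: "real \<times> real \<Rightarrow> real \<times> real" where
  "fold_map p \<equiv> (fst p, (snd p)\<^sup>2)"

lemma has_derivative_cong_ev:
  assumes "(f has_derivative D) (at p)" "\<forall>\<^sub>F q in nhds p. f q = g q"
  shows "(g has_derivative D) (at p)"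
proof -
  obtain S where S: "open S" "p \<in> S" "\<And>q. q \<in> S \<Longrightarrow> f q = g q"
    using assms(2) unfolding eventually_nhds by blast
  show ?thesis by (rule has_derivative_transform_within_open[OF assms(1) S(1,2)]) (use S in auto)
qed

lemma smooth_germ_ev_has_derivative:
  assumes "smooth_germ f"
  shows "\<forall>\<^sub>F p in nhds 0. (f has_derivative frechet_derivative f (at p)) (at p)"
proof -
  obtain U where U: "0 \<in> U" "smooth_on U f" using assms unfolding smooth_germ_def by blast
  then have "\<forall>\<^sub>F p in nhds 0. p \<in> U" by (intro eventually_nhds_in_open smooth_on_open)
  then show ?thesis by eventually_elim (rule smooth_on_has_derivative[OF U(2)])
qed

lemma fold_map_has_derivative:
  "(fold_map has_derivative (\<lambda>v. (fst v, 2 * snd q * snd v))) (at q)"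
  by (auto intro!: derivative_eq_intros)

text \<open>The derivative of the fold composed with \<open>H\<close> is injective where the second
  coordinate of H p is nonzero. It factors through the derivative of \<gamma>, which is therefore
  injective and, by equality of dimensions, surjective.\<close>

lemma sing_set_fold:
  assumes \<gamma>: "smooth_germ \<gamma>" "\<gamma> 0 = 0" and H: "diffeo_germ H" and K: "smooth_germ K"
    and eq: "\<forall>\<^sub>F p in nhds 0. K (\<gamma> p) = fold_map (H p)"
  shows "\<forall>\<^sub>F p in nhds 0. p \<in> sing_set \<gamma> \<longrightarrow> snd (H p) = 0"
proof -
  obtain G where G: "diffeo_germ G" "\<forall>\<^sub>F p in nhds 0. G (H p) = p" "\<forall>\<^sub>F p in nhds 0. H (G p) = p"
    by (rule diffeo_germ_inverse[OF H])
  have ev: "\<forall>\<^sub>F p in nhds 0. \<forall>\<^sub>F q in nhds p. K (\<gamma> q) = fold_map (H q)"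
    "\<forall>\<^sub>F p in nhds 0. \<forall>\<^sub>F q in nhds p. G (H q) = q"
    using eq G(2) by (simp_all add: eventually_eventually)
  have dH: "\<forall>\<^sub>F p in nhds 0. (H has_derivative frechet_derivative H (at p)) (at p)"
    by (rule smooth_germ_ev_has_derivative[OF diffeo_germ_smooth[OF H]])
  have d\<gamma>: "\<forall>\<^sub>F p in nhds 0. (\<gamma> has_derivative frechet_derivative \<gamma> (at p)) (at p)"
    by (rule smooth_germ_ev_has_derivative[OF \<gamma>(1)])
  have dG: "\<forall>\<^sub>F p in nhds 0. (G has_derivative frechet_derivative G (at (H p))) (at (H p))"
    by (rule smooth_germ_eventually_compose[OF diffeo_germ_smooth[OF H] diffeo_germ_zero[OF H]
          smooth_germ_ev_has_derivative[OF diffeo_germ_smooth[OF G(1)]]])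
  have dK: "\<forall>\<^sub>F p in nhds 0. (K has_derivative frechet_derivative K (at (\<gamma> p))) (at (\<gamma> p))"
    by (rule smooth_germ_eventually_compose[OF \<gamma> smooth_germ_ev_has_derivative[OF K]])
  show ?thesis
    using ev dH d\<gamma> dG dK
  proof eventually_elim
    case (elim p)
    show ?case
    proof (intro impI, rule ccontr)
      assume p: "p \<in> sing_set \<gamma>" and nz: "snd (H p) \<noteq> 0"
      let ?H = "frechet_derivative H (at p)" and ?G = "frechet_derivative G (at (H p))"
        and ?\<gamma> = "frechet_derivative \<gamma> (at p)" and ?K = "frechet_derivative K (at (\<gamma> p))"
      have "((\<lambda>q. q) has_derivative (\<lambda>v. ?G (?H v))) (at p)"
        by (rule has_derivative_cong_ev[OF has_derivative_compose[OF elim(3,5)] elim(2)])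
      then have GH: "?G (?H v) = v" for v using has_derivative_unique[OF _ has_derivative_ident] by metis
      have d1: "((\<lambda>q. fold_map (H q)) has_derivative (\<lambda>v. ?K (?\<gamma> v))) (at p)"
        by (rule has_derivative_cong_ev[OF has_derivative_compose[OF elim(4,6)] elim(1)])
      have d2: "((\<lambda>q. fold_map (H q)) has_derivative (\<lambda>v. (fst (?H v), 2 * snd (H p) * snd (?H v)))) (at p)"
        by (rule has_derivative_compose[OF elim(3) fold_map_has_derivative])
      have K\<gamma>: "?K (?\<gamma> v) = (fst (?H v), 2 * snd (H p) * snd (?H v))" for v
        using has_derivative_unique[OF d1 d2] by (rule fun_cong[where x=v])
      have lin: "linear ?\<gamma>" using elim(4) has_derivative_linear by blast
      have "inj ?\<gamma>"
      proof (rule injI)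
        fix v w assume "?\<gamma> v = ?\<gamma> w"
        then have "(fst (?H v), 2 * snd (H p) * snd (?H v)) = (fst (?H w), 2 * snd (H p) * snd (?H w))"
          using K\<gamma> by metis
        then have "?H v = ?H w" using nz by (simp add: prod_eq_iff)
        then show "v = w" using GH by metis
      qed
      then have "surj ?\<gamma>" using lin linear_injective_imp_surjective by blast
      then show False using p by (simp add: sing_set_def)
    qed
  qed
qed

lemma sing_curve_tangent:
  assumes \<gamma>: "smooth_germ \<gamma>" "\<gamma> 0 = 0" and H: "diffeo_germ H" and K: "smooth_germ K"
    and eq: "\<forall>\<^sub>F p in nhds 0. K (\<gamma> p) = fold_map (H p)"
    and c: "param_curve (sing_set \<gamma>) c"
  shows "snd (frechet_derivative H (at 0) (frechet_derivative c (at 0) 1)) = 0"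
proof -
  from c have c0: "c 0 = 0" and cs: "smooth_germ c" by (auto simp: param_curve_def)
  from c obtain U \<epsilon> where "\<epsilon> > 0" "sing_set \<gamma> \<inter> U = c ` {-\<epsilon><..<\<epsilon>}"
    unfolding param_curve_def by blast
  then have "c t \<in> sing_set \<gamma>" if "t \<in> {-\<epsilon><..<\<epsilon>}" for t using that by blast
  moreover have "\<forall>\<^sub>F t in nhds 0. t \<in> {-\<epsilon><..<\<epsilon>}"
    by (rule eventually_nhds_in_open) (use \<open>\<epsilon> > 0\<close> in auto)
  ultimately have "\<forall>\<^sub>F t in nhds 0. c t \<in> sing_set \<gamma>" by (auto elim: eventually_mono)
  with smooth_germ_eventually_compose[OF cs c0 sing_set_fold[OF \<gamma> H K eq]]
  have z: "\<forall>\<^sub>F t in nhds 0. snd (H (c t)) = 0" by eventually_elim simp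
  have "(H has_derivative frechet_derivative H (at 0)) (at (c 0))"
    unfolding c0 by (rule smooth_germ_has_derivative[OF diffeo_germ_smooth[OF H]])
  from has_derivative_snd[OF has_derivative_compose[OF smooth_germ_has_derivative[OF cs] this]]
  have "((\<lambda>t. snd (H (c t))) has_derivative
     (\<lambda>v. snd (frechet_derivative H (at 0) (frechet_derivative c (at 0) v)))) (at 0)" .
  from has_derivative_cong_ev[OF this z]
  have "((\<lambda>t. 0) has_derivative
     (\<lambda>v. snd (frechet_derivative H (at 0) (frechet_derivative c (at 0) v)))) (at 0)" .
  from has_derivative_unique[OF this has_derivative_const] show ?thesis by metis
qed

lemma fold_derivative_at_0:
  assumes \<gamma>: "smooth_germ \<gamma>" "\<gamma> 0 = 0" and H: "diffeo_germ H" and K: "smooth_germ K"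
    and eq: "\<forall>\<^sub>F p in nhds 0. K (\<gamma> p) = fold_map (H p)"
  shows "frechet_derivative K (at 0) (frechet_derivative \<gamma> (at 0) v) = (fst (frechet_derivative H (at 0) v), 0)"
proof -
  have "(K has_derivative frechet_derivative K (at 0)) (at (\<gamma> 0))"
    unfolding \<gamma>(2) by (rule smooth_germ_has_derivative[OF K])
  from has_derivative_compose[OF smooth_germ_has_derivative[OF \<gamma>(1)] this] eq
  have d1: "((\<lambda>p. fold_map (H p)) has_derivative
      (\<lambda>v. frechet_derivative K (at 0) (frechet_derivative \<gamma> (at 0) v))) (at 0)"
    by (rule has_derivative_cong_ev)
  have d2: "((\<lambda>p. fold_map (H p)) has_derivative (\<lambda>v. (fst (frechet_derivative H (at 0) v),
      2 * snd (H 0) * snd (frechet_derivative H (at 0) v)))) (at 0)"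
    by (rule has_derivative_compose[OF smooth_germ_has_derivative[OF diffeo_germ_smooth[OF H]] fold_map_has_derivative])
  show ?thesis
    using fun_cong[OF has_derivative_unique[OF d1 d2], of v] diffeo_germ_zero[OF H] by simp
qed

lemma diffeo_germ_inverse_derivative:
  fixes H G :: "'a::euclidean_space \<Rightarrow> 'a"
  assumes "diffeo_germ H" "diffeo_germ G" "\<forall>\<^sub>F p in nhds 0. G (H p) = p"
  shows "frechet_derivative G (at 0) (frechet_derivative H (at 0) v) = v"
proof -
  have "(G has_derivative frechet_derivative G (at 0)) (at (H 0))"
    unfolding diffeo_germ_zero[OF assms(1)] by (rule smooth_germ_has_derivative[OF diffeo_germ_smooth[OF assms(2)]])
  from has_derivative_cong_ev[OF has_derivative_compose[OF
        smooth_germ_has_derivative[OF diffeo_germ_smooth[OF assms(1)]] this] assms(3)]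
  show ?thesis using has_derivative_unique[OF _ has_derivative_ident] by metis
qed

text \<open>In fold coordinates the singular set is tangent to the x direction, so regularity of f
  on it is the first claim. The kernel of the derivative of \<gamma> is the y direction, so
  regularity of (f, \<gamma>) forces the second.\<close>

lemma typeIII_partials:
  assumes t: "typeIII f \<gamma>" and H: "diffeo_germ H" and K: "diffeo_germ K"
    and eq: "\<forall>\<^sub>F p in nhds 0. K (\<gamma> p) = fold_map (H p)"
    and G: "diffeo_germ G" "\<forall>\<^sub>F p in nhds 0. G (H p) = p" "\<forall>\<^sub>F p in nhds 0. H (G p) = p"
  shows "pdx (\<lambda>p. f (G p)) 0 \<noteq> 0" "pdy (\<lambda>p. f (G p)) 0 \<noteq> 0"
proof -
  from t have f: "smooth_germ f" "f 0 = 0" and \<gamma>: "smooth_germ \<gamma>" "\<gamma> 0 = 0"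
    and inj: "inj (frechet_derivative (\<lambda>p. (f p, \<gamma> p)) (at 0))"
    unfolding typeIII_def fold_germ_def by blast+
  from t obtain c where c: "param_curve (sing_set \<gamma>) c" "frechet_derivative (f \<circ> c) (at 0) 1 \<noteq> 0"
    unfolding typeIII_def by blast
  let ?f = "frechet_derivative f (at 0)" and ?\<gamma> = "frechet_derivative \<gamma> (at 0)"
    and ?G = "frechet_derivative G (at 0)" and ?H = "frechet_derivative H (at 0)"
    and ?K = "frechet_derivative K (at 0)"
  have "(f has_derivative ?f) (at (G 0))"
    unfolding diffeo_germ_zero[OF G(1)] by (rule smooth_germ_has_derivative[OF f(1)])
  from has_derivative_compose[OF smooth_germ_has_derivative[OF diffeo_germ_smooth[OF G(1)]] this]
  have "((\<lambda>p. f (G p)) has_derivative (\<lambda>v. ?f (?G v))) (at 0)" .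
  from frechet_derivative_at[OF this, symmetric]
  have pd: "pdx (\<lambda>p. f (G p)) 0 = ?f (?G (1, 0))" "pdy (\<lambda>p. f (G p)) 0 = ?f (?G (0, 1))"
    by (simp_all add: pdx_def pdy_def)
  have GH: "?G (?H v) = v" for v by (rule diffeo_germ_inverse_derivative[OF H G(1,2)])
  have HG: "?H (?G v) = v" for v by (rule diffeo_germ_inverse_derivative[OF G(1) H G(3)])
  have lin: "linear ?f" "linear ?\<gamma>" "linear ?G" "linear ?K"
    using smooth_germ_has_derivative has_derivative_linear f(1) \<gamma>(1) diffeo_germ_smooth G(1) K by blast+
  show "pdx (\<lambda>p. f (G p)) 0 \<noteq> 0"
  proof
    assume 0: "pdx (\<lambda>p. f (G p)) 0 = 0"
    from c have c0: "c 0 = 0" and cs: "smooth_germ c" by (auto simp: param_curve_def)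
    let ?w = "frechet_derivative c (at 0) 1"
    have "snd (?H ?w) = 0" by (rule sing_curve_tangent[OF \<gamma> H diffeo_germ_smooth[OF K] eq c(1)])
    then have "?H ?w = fst (?H ?w) *\<^sub>R (1, 0)" by (simp add: prod_eq_iff)
    then have "?w = fst (?H ?w) *\<^sub>R ?G (1, 0)" using GH linear_cmul[OF lin(3)] by metis
    then have "?f ?w = fst (?H ?w) *\<^sub>R ?f (?G (1, 0))" using linear_cmul[OF lin(1)] by metis
    then have "?f ?w = 0" using 0 pd(1) by simp
    moreover have "(f has_derivative ?f) (at (c 0))"
      unfolding c0 by (rule smooth_germ_has_derivative[OF f(1)])
    from has_derivative_compose[OF smooth_germ_has_derivative[OF cs] this]
    have "frechet_derivative (f \<circ> c) (at 0) = (\<lambda>v. ?f (frechet_derivative c (at 0) v))"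
      unfolding comp_def by (rule frechet_derivative_at[symmetric])
    ultimately show False using c(2) by simp
  qed
  show "pdy (\<lambda>p. f (G p)) 0 \<noteq> 0"
  proof
    assume 0: "pdy (\<lambda>p. f (G p)) 0 = 0"
    have "?K (?\<gamma> (?G (0, 1))) = (0, 0)"
      using fold_derivative_at_0[OF \<gamma> H diffeo_germ_smooth[OF K] eq] HG by simp
    moreover have "?K 0 = 0" by (rule linear_0[OF lin(4)])
    ultimately have \<gamma>0: "?\<gamma> (?G (0, 1)) = 0"
      using diffeo_germ_inj_derivative(1)[OF K smooth_germ_has_derivative[OF diffeo_germ_smooth[OF K]]]
      by (metis injD zero_prod_def)
    have "frechet_derivative (\<lambda>p. (f p, \<gamma> p)) (at 0) = (\<lambda>v. (?f v, ?\<gamma> v))"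
      by (rule frechet_derivative_at[symmetric])
         (intro has_derivative_Pair smooth_germ_has_derivative f(1) \<gamma>(1))
    then have "inj (\<lambda>v. (?f v, ?\<gamma> v))" using inj by simp
    from injD[OF this, of "?G (0, 1)" 0] have "?G (0, 1) = 0"
      using \<gamma>0 0 pd(2) linear_0[OF lin(1)] linear_0[OF lin(2)] by simp
    then show False using HG[of "(0, 1)"] GH[of 0]
      by (metis HG linear_0 lin(3) prod.inject zero_neq_one zero_prod_def)
  qed
qed

text \<open>In the coordinates \<psi>1 and \<psi>2 each discriminant is tangent to the first axis at
  0. Were this partial derivative 0, the transition map \<psi>1 \<circ> \<xi> would preserve that
  direction and the two tangents would be parallel.\<close>

lemma discr_transversal_partial:
  assumes tr: "discr_transversal \<gamma>1 \<gamma>2"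
    and \<gamma>1: "smooth_germ \<gamma>1" "\<gamma>1 0 = 0" and \<gamma>2: "smooth_germ \<gamma>2" "\<gamma>2 0 = 0"
    and \<phi>1: "diffeo_germ \<phi>1" and \<psi>1: "diffeo_germ \<psi>1"
    and eq1: "\<forall>\<^sub>F p in nhds 0. \<psi>1 (\<gamma>1 p) = fold_map (\<phi>1 p)"
    and \<phi>2: "diffeo_germ \<phi>2" and \<psi>2: "diffeo_germ \<psi>2"
    and eq2: "\<forall>\<^sub>F p in nhds 0. \<psi>2 (\<gamma>2 p) = fold_map (\<phi>2 p)"
    and \<xi>: "diffeo_germ \<xi>" "\<forall>\<^sub>F p in nhds 0. \<xi> (\<psi>2 p) = p"
  shows "pdx (\<lambda>p. snd (\<psi>1 (\<xi> p))) 0 \<noteq> 0"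
proof
  assume 0: "pdx (\<lambda>p. snd (\<psi>1 (\<xi> p))) 0 = 0"
  let ?\<psi>1 = "frechet_derivative \<psi>1 (at 0)" and ?\<psi>2 = "frechet_derivative \<psi>2 (at 0)"
    and ?\<xi> = "frechet_derivative \<xi> (at 0)"
  have lin: "linear ?\<psi>1" "linear ?\<xi>"
    using smooth_germ_has_derivative has_derivative_linear diffeo_germ_smooth \<psi>1 \<xi>(1) by blast+
  have "(\<psi>1 has_derivative ?\<psi>1) (at (\<xi> 0))"
    unfolding diffeo_germ_zero[OF \<xi>(1)] by (rule smooth_germ_has_derivative[OF diffeo_germ_smooth[OF \<psi>1]])
  from has_derivative_snd[OF has_derivative_compose[OF smooth_germ_has_derivative[OF diffeo_germ_smooth[OF \<xi>(1)]] this]]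
  have "((\<lambda>p. snd (\<psi>1 (\<xi> p))) has_derivative (\<lambda>v. snd (?\<psi>1 (?\<xi> v)))) (at 0)" .
  from frechet_derivative_at[OF this, symmetric] 0
  have Q: "snd (?\<psi>1 (?\<xi> (1, 0))) = 0" by (simp add: pdx_def)
  obtain c1 c2 where c: "param_curve (sing_set \<gamma>1) c1" "param_curve (sing_set \<gamma>2) c2"
    and det: "fst (frechet_derivative (\<gamma>1 \<circ> c1) (at 0) 1) * snd (frechet_derivative (\<gamma>2 \<circ> c2) (at 0) 1)
      - snd (frechet_derivative (\<gamma>1 \<circ> c1) (at 0) 1) * fst (frechet_derivative (\<gamma>2 \<circ> c2) (at 0) 1) \<noteq> 0"
    using tr unfolding discr_transversal_def Let_def by blast
  have chain: "frechet_derivative (\<gamma> \<circ> c) (at 0) = (\<lambda>v. frechet_derivative \<gamma> (at 0) (frechet_derivative c (at 0) v))"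
    if "smooth_germ \<gamma>" "param_curve (sing_set \<gamma>) c" for \<gamma> c
  proof -
    have c0: "c 0 = 0" and cs: "smooth_germ c" using that(2) by (auto simp: param_curve_def)
    have "(\<gamma> has_derivative frechet_derivative \<gamma> (at 0)) (at (c 0))"
      unfolding c0 by (rule smooth_germ_has_derivative[OF that(1)])
    from has_derivative_compose[OF smooth_germ_has_derivative[OF cs] this]
    show ?thesis unfolding comp_def by (rule frechet_derivative_at[symmetric])
  qed
  define u v where "u = frechet_derivative (\<gamma>1 \<circ> c1) (at 0) 1" and "v = frechet_derivative (\<gamma>2 \<circ> c2) (at 0) 1"
  have u: "snd (?\<psi>1 u) = 0"
    unfolding u_def chain[OF \<gamma>1(1) c(1)]
    using fold_derivative_at_0[OF \<gamma>1 \<phi>1 diffeo_germ_smooth[OF \<psi>1] eq1] by simp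
  have "snd (?\<psi>2 v) = 0"
    unfolding v_def chain[OF \<gamma>2(1) c(2)]
    using fold_derivative_at_0[OF \<gamma>2 \<phi>2 diffeo_germ_smooth[OF \<psi>2] eq2] by simp
  then have "?\<psi>2 v = fst (?\<psi>2 v) *\<^sub>R (1, 0)" by (simp add: prod_eq_iff)
  then have "v = ?\<xi> (fst (?\<psi>2 v) *\<^sub>R (1, 0))"
    using diffeo_germ_inverse_derivative[OF \<psi>2 \<xi>(1,2), of v] by simp
  then have "?\<psi>1 v = fst (?\<psi>2 v) *\<^sub>R ?\<psi>1 (?\<xi> (1, 0))"
    using linear_cmul[OF lin(1)] linear_cmul[OF lin(2)] by metis
  then have v: "snd (?\<psi>1 v) = 0" using Q by simp
  have inj: "inj ?\<psi>1"
    by (rule diffeo_germ_inj_derivative(1)[OF \<psi>1 smooth_germ_has_derivative[OF diffeo_germ_smooth[OF \<psi>1]]])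
  let ?a = "fst (?\<psi>1 u)" and ?b = "fst (?\<psi>1 v)"
  have "?\<psi>1 (?b *\<^sub>R u) = ?\<psi>1 (?a *\<^sub>R v)"
    unfolding linear_cmul[OF lin(1)] using u v by (simp add: prod_eq_iff)
  then have buav: "?b *\<^sub>R u = ?a *\<^sub>R v" using inj by (simp add: inj_eq)
  then have "?b * fst u = ?a * fst v" "?b * snd u = ?a * snd v"
    by (metis fst_scaleR real_scaleR_def) (metis buav snd_scaleR real_scaleR_def)
  \<comment> \<open>As the determinant is nonzero, \<open>?a\<close> must be 0; but then
    \<open>u\<close> is 0, and so is the determinant.\<close>
  then have "?a * (fst u * snd v - snd u * fst v) = 0" by algebra
  then have "?a = 0" using det unfolding u_def v_def by simp
  then have "?\<psi>1 u = ?\<psi>1 0" using u linear_0[OF lin(1)] by (simp add: prod_eq_iff)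
  then have "u = 0" using inj by (simp add: inj_eq)
  then show False using det unfolding u_def v_def by simp
qed

subsection \<open>Straightening both discriminants\<close>

abbreviation fold_map' :: "real \<times> real \<Rightarrow> real \<times> real" where
  "fold_map' p \<equiv> ((fst p)\<^sup>2, snd p)"

lemma axis_derivatives:
  assumes "smooth_germ g"
  shows "((\<lambda>x. g (x, 0)) has_real_derivative pdx g 0) (at 0)"
    and "((\<lambda>y. g (0, y)) has_real_derivative pdy g 0) (at 0)"
proof -
  have g: "(g has_derivative (\<lambda>v. pdx g 0 * fst v + pdy g 0 * snd v)) (at (0, 0))"
    using smooth_germ_has_derivative_pd[OF assms] by (simp add: zero_prod_def)
  have "((\<lambda>x. (x, 0)) has_derivative (\<lambda>x. (x, 0))) (at (0::real))"
    by (auto intro!: derivative_eq_intros)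
  from has_derivative_compose[OF this g]
  show "((\<lambda>x. g (x, 0)) has_real_derivative pdx g 0) (at 0)" by (simp add: has_field_derivative_def)
  have "((\<lambda>x. (0, x)) has_derivative (\<lambda>x. (0, x))) (at (0::real))"
    by (auto intro!: derivative_eq_intros)
  from has_derivative_compose[OF this g]
  show "((\<lambda>y. g (0, y)) has_real_derivative pdy g 0) (at 0)" by (simp add: has_field_derivative_def)
qed

lemma smooth_germ_axes:
  assumes "smooth_germ (g :: real \<times> real \<Rightarrow> real)"
  shows "smooth_germ (\<lambda>x. g (x, 0))" "smooth_germ (\<lambda>y. g (0, y))"
  by (auto intro!: smooth_germ_compose[OF assms] smooth_germ_intros simp: zero_prod_def)

lemma pd_fst_mult:
  assumes "smooth_germ A"
  shows "pdx (\<lambda>p. fst p * A p) 0 = A 0" "pdy (\<lambda>p. fst p * A p) 0 = 0"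
proof -
  have "((\<lambda>p. fst p * A p) has_derivative (\<lambda>v. A 0 * fst v + 0 * snd v)) (at 0)"
    by (rule has_derivative_eq_rhs[OF has_derivative_mult[OF has_derivative_fst[OF has_derivative_ident]
            smooth_germ_has_derivative[OF assms]]]) auto
  from pd_eqI[OF this] show "pdx (\<lambda>p. fst p * A p) 0 = A 0" "pdy (\<lambda>p. fst p * A p) 0 = 0" .
qed

lemma pd_snd_mult:
  assumes "smooth_germ A"
  shows "pdx (\<lambda>p. snd p * A p) 0 = 0" "pdy (\<lambda>p. snd p * A p) 0 = A 0"
proof -
  have "((\<lambda>p. snd p * A p) has_derivative (\<lambda>v. 0 * fst v + A 0 * snd v)) (at 0)"
    by (rule has_derivative_eq_rhs[OF has_derivative_mult[OF has_derivative_snd[OF has_derivative_ident]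
            smooth_germ_has_derivative[OF assms]]]) auto
  from pd_eqI[OF this] show "pdx (\<lambda>p. snd p * A p) 0 = 0" "pdy (\<lambda>p. snd p * A p) 0 = A 0" .
qed

lemma pd_snd: "pdx snd 0 = 0" "pdy snd 0 = 1"
proof -
  have "(snd has_derivative (\<lambda>v. 0 * fst v + 1 * snd v)) (at (0 :: real \<times> real))"
    by (auto intro!: derivative_eq_intros)
  from pd_eqI[OF this] show "pdx snd 0 = 0" "pdy snd 0 = 1" .
qed

lemma pd_affine_in_fst:
  assumes "smooth_germ d"
  shows "pdx (\<lambda>p. \<sigma> * (fst p - d (snd p))) 0 = \<sigma>"
proof -
  have "((\<lambda>x. \<sigma> * (fst (x, 0::real) - d (snd (x, 0::real)))) has_real_derivative \<sigma>) (at 0)"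
    by (auto intro!: derivative_eq_intros)
  moreover have "smooth_germ (\<lambda>p. \<sigma> * (fst p - d (snd p)))"
    by (intro smooth_germ_intros smooth_germ_compose[OF assms]) auto
  ultimately show ?thesis using axis_derivatives(1) DERIV_unique by blast
qed

text \<open>After the shear the first coordinate of \<gamma>2 vanishes on its discriminant, so in
  fold coordinates it is y^2 times a function nonzero at 0; the square root of that function, up to
  sign, turns it into a perfect square. A shear depending on Y only lifts through the first fold and
  leaves \<gamma>1 in normal form.\<close>

lemma straighten_discriminants:
  assumes \<gamma>1: "smooth_germ \<gamma>1" "\<gamma>1 0 = 0" and \<gamma>2: "smooth_germ \<gamma>2" "\<gamma>2 0 = 0"
    and \<phi>1: "diffeo_germ \<phi>1" and \<psi>1: "diffeo_germ \<psi>1"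
    and eq1: "\<forall>\<^sub>F p in nhds 0. \<psi>1 (\<gamma>1 p) = fold_map (\<phi>1 p)"
    and \<phi>2: "diffeo_germ \<phi>2" and \<psi>2: "diffeo_germ \<psi>2"
    and eq2: "\<forall>\<^sub>F p in nhds 0. \<psi>2 (\<gamma>2 p) = fold_map (\<phi>2 p)"
    and tr: "discr_transversal \<gamma>1 \<gamma>2"
  obtains K H1 H2 where "diffeo_germ K" "diffeo_germ H1" "diffeo_germ H2"
    "\<forall>\<^sub>F p in nhds 0. K (\<gamma>1 p) = fold_map (H1 p)" "\<forall>\<^sub>F p in nhds 0. K (\<gamma>2 p) = fold_map' (H2 p)"
proof -
  obtain \<xi> where \<xi>: "diffeo_germ \<xi>" "\<forall>\<^sub>F p in nhds 0. \<xi> (\<psi>2 p) = p"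
    by (rule diffeo_germ_inverse[OF \<psi>2])
  define \<Psi> where "\<Psi> p = \<psi>1 (\<xi> p)" for p
  have \<Psi>: "diffeo_germ \<Psi>" unfolding \<Psi>_def[abs_def] by (rule diffeo_germ_compose[OF \<xi>(1) \<psi>1])
  define P Q where "P p = fst (\<Psi> p)" and "Q p = snd (\<Psi> p)" for p
  have \<Psi>0: "\<Psi> 0 = 0" by (rule diffeo_germ_zero[OF \<Psi>])
  have P: "smooth_germ P" "P 0 = 0" and Q: "smooth_germ Q" "Q 0 = 0"
    unfolding P_def[abs_def] Q_def[abs_def] using \<Psi>0 diffeo_germ_smooth[OF \<Psi>]
    by (auto intro!: smooth_germ_fst smooth_germ_snd)
  have Qx: "pdx Q 0 \<noteq> 0"
    unfolding Q_def[abs_def] \<Psi>_def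
    by (rule discr_transversal_partial[OF tr \<gamma>1 \<gamma>2 \<phi>1 \<psi>1 eq1 \<phi>2 \<psi>2 eq2 \<xi>])
  define q where "q x = Q (x, 0)" for x
  have q: "diffeo_germ q" unfolding q_def[abs_def]
    by (rule diffeo_germ_realI[OF smooth_germ_axes(1)[OF Q(1)] _ axis_derivatives(1)[OF Q(1)] Qx])
       (use Q(2) in \<open>simp add: zero_prod_def\<close>)
  obtain qi where qi: "diffeo_germ qi" "\<forall>\<^sub>F x in nhds 0. qi (q x) = x" by (rule diffeo_germ_inverse[OF q])
  define d where "d y = P (qi y, 0)" for y
  have d: "smooth_germ d" "d 0 = 0" unfolding d_def[abs_def]
    using smooth_germ_compose[OF smooth_germ_axes(1)[OF P(1)] diffeo_germ_smooth[OF qi(1)] diffeo_germ_zero[OF qi(1)]]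
      diffeo_germ_zero[OF qi(1)] P(2) by (auto simp: zero_prod_def)
  define A0 where "A0 p = P p - d (Q p)" for p
  have A0: "smooth_germ A0" "A0 0 = 0" unfolding A0_def[abs_def]
    using P Q d by (auto intro!: smooth_germ_diff smooth_germ_compose[OF d(1)])
  have A0x: "\<forall>\<^sub>F x in nhds 0. A0 (x, 0) = 0"
    using qi(2) by eventually_elim (simp add: A0_def d_def q_def)
  obtain A1 where A1: "smooth_germ A1" "\<forall>\<^sub>F p in nhds 0. A0 p = snd p * A1 p" "A1 0 = pdy A0 0"
    by (rule hadamard_division_germ[OF A0(1) A0x])
  have T: "diffeo_germ (\<lambda>p. (\<sigma> * (fst p - d (snd p)), snd p))" if "\<sigma> \<noteq> 0" for \<sigma> :: real
    by (rule diffeo_germ_PairI)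
       (use d that in \<open>auto simp: pd_affine_in_fst pd_snd intro!: smooth_germ_intros smooth_germ_compose[OF d(1)]\<close>)
  have "diffeo_germ (\<lambda>p. (A0 p, Q p))"
    using diffeo_germ_compose[OF \<Psi> T[of 1]] by (simp add: A0_def P_def Q_def)
  moreover have "((\<lambda>p. (A0 p, Q p)) has_derivative
      (\<lambda>v. (pdx A0 0 * fst v + pdy A0 0 * snd v, pdx Q 0 * fst v + pdy Q 0 * snd v))) (at 0)"
    by (intro has_derivative_Pair smooth_germ_has_derivative_pd A0 Q)
  ultimately have inj: "inj (\<lambda>v. (pdx A0 0 * fst v + pdy A0 0 * snd v, pdx Q 0 * fst v + pdy Q 0 * snd v))"
    by (rule diffeo_germ_inj_derivative)
  have "((\<lambda>x. 0) has_real_derivative pdx A0 0) (at 0)"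
    using axis_derivatives(1)[OF A0(1)] unfolding has_field_derivative_def
    by (rule has_derivative_cong_ev[OF _ A0x])
  then have A0x0: "pdx A0 0 = 0" using DERIV_const DERIV_unique by blast
  \<comment> \<open>The x derivative of \<open>A0\<close> is 0 because \<open>A0\<close> vanishes on
    the x axis; invertibility of (A0, Q) then leaves no choice but a nonzero y derivative.\<close>
  have A10: "A1 0 \<noteq> 0"
  proof
    assume "A1 0 = 0"
    then have "(\<lambda>v. (pdx A0 0 * fst v + pdy A0 0 * snd v, pdx Q 0 * fst v + pdy Q 0 * snd v)) (pdy Q 0, - pdx Q 0)
      = (\<lambda>v. (pdx A0 0 * fst v + pdy A0 0 * snd v, pdx Q 0 * fst v + pdy Q 0 * snd v)) 0"
      using A1(3) A0x0 by simp
    from injD[OF inj this] show False using Qx by (simp add: zero_prod_def)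
  qed
  \<comment> \<open>The image of the second fold may lie on either side of X = d(Y). This sign moves
    it to the side X \<ge> 0, where the root exists.\<close>
  define \<sigma> where "\<sigma> = sgn (A1 0)"
  have \<sigma>: "\<sigma> \<noteq> 0" "\<sigma> * A1 0 > 0" using A10 by (auto simp: \<sigma>_def sgn_if)
  define S where "S p = (\<sigma> * (fst p - d (snd p)), snd p)" for p
  have S: "diffeo_germ S" unfolding S_def[abs_def] by (rule T[OF \<sigma>(1)])
  \<comment> \<open>The lift of \<open>S\<close> through the first fold: d(Y) becomes
    d(y^2).\<close>
  define N where "N p = (\<sigma> * (fst p - d ((snd p)\<^sup>2)), snd p)" for p :: "real \<times> real"
  have N: "diffeo_germ N" unfolding N_def[abs_def]
  proof (rule diffeo_germ_PairI)
    have "smooth_germ (\<lambda>y. d (y\<^sup>2))" by (intro smooth_germ_compose[OF d(1)] smooth_germ_intros) simp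
    from pd_affine_in_fst[OF this]
    show "pdx (\<lambda>p. \<sigma> * (fst p - d ((snd p)\<^sup>2))) 0 * pdy snd 0 - pdy (\<lambda>p. \<sigma> * (fst p - d ((snd p)\<^sup>2))) 0 * pdx snd 0 \<noteq> 0"
      using \<sigma> by (simp add: pd_snd)
  qed (use d in \<open>auto intro!: smooth_germ_intros smooth_germ_compose[OF d(1)]\<close>)
  define Rt where "Rt p = sqrt (\<sigma> * A1 (fold_map p))" for p
  have fold0: "smooth_germ fold_map" "fold_map 0 = 0" by (auto intro!: smooth_germ_intros simp: zero_prod_def)
  have Rt: "smooth_germ Rt" "Rt 0 > 0" unfolding Rt_def[abs_def]
    using \<sigma>(2) fold0(2)
    by (auto intro!: smooth_germ_sqrt smooth_germ_mult smooth_germ_const smooth_germ_compose[OF A1(1) fold0(1)])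
  have Qf: "smooth_germ (\<lambda>p. Q (fold_map p))" by (rule smooth_germ_compose[OF Q(1) fold0])
  have "((\<lambda>x. Q (fold_map (x, 0))) has_real_derivative pdx Q 0) (at 0)"
    using axis_derivatives(1)[OF Q(1)] by simp
  then have Qfx: "pdx (\<lambda>p. Q (fold_map p)) 0 = pdx Q 0"
    using axis_derivatives(1)[OF Qf] DERIV_unique by blast
  define E where "E p = (snd p * Rt p, Q (fold_map p))" for p
  have E: "diffeo_germ E" unfolding E_def[abs_def]
    by (rule diffeo_germ_PairI)
       (use Rt Q(2) fold0 Qf Qx in \<open>auto simp: pd_snd_mult Qfx intro!: smooth_germ_intros\<close>)
  show ?thesis
  proof (rule that[of "\<lambda>p. S (\<psi>1 p)" "\<lambda>p. N (\<phi>1 p)" "\<lambda>p. E (\<phi>2 p)"])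
    show "diffeo_germ (\<lambda>p. S (\<psi>1 p))" by (rule diffeo_germ_compose[OF \<psi>1 S])
    show "diffeo_germ (\<lambda>p. N (\<phi>1 p))" by (rule diffeo_germ_compose[OF \<phi>1 N])
    show "diffeo_germ (\<lambda>p. E (\<phi>2 p))" by (rule diffeo_germ_compose[OF \<phi>2 E])
    show "\<forall>\<^sub>F p in nhds 0. S (\<psi>1 (\<gamma>1 p)) = fold_map (N (\<phi>1 p))"
      using eq1 by eventually_elim (simp add: S_def N_def)
    have pos: "\<forall>\<^sub>F p in nhds 0. \<sigma> * A1 p > 0"
    proof -
      have "((\<lambda>p. \<sigma> * A1 p) \<longlongrightarrow> \<sigma> * A1 0) (nhds 0)"
        by (intro tendsto_intros smooth_germ_tendsto A1)
      then show ?thesis using \<sigma>(2) by (rule order_tendstoD)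
    qed
    have f\<phi>: "smooth_germ (\<lambda>p. fold_map (\<phi>2 p))" "fold_map (\<phi>2 0) = 0"
      using smooth_germ_compose[OF fold0(1) diffeo_germ_smooth[OF \<phi>2] diffeo_germ_zero[OF \<phi>2]]
        diffeo_germ_zero[OF \<phi>2] fold0(2) by auto
    note ev = smooth_germ_eventually_compose[OF f\<phi>]
    show "\<forall>\<^sub>F p in nhds 0. S (\<psi>1 (\<gamma>2 p)) = fold_map' (E (\<phi>2 p))"
      using eq2 smooth_germ_eventually_compose[OF \<gamma>2 \<xi>(2)] ev[OF A1(2)] ev[OF pos]
    proof eventually_elim
      case (elim p)
      let ?F = "fold_map (\<phi>2 p)"
      have "\<psi>1 (\<gamma>2 p) = \<Psi> ?F" unfolding \<Psi>_def using elim(1,2) by metis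
      then have "S (\<psi>1 (\<gamma>2 p)) = (\<sigma> * A0 ?F, Q ?F)" by (simp add: S_def A0_def P_def Q_def)
      also have "\<sigma> * A0 ?F = (snd (\<phi>2 p))\<^sup>2 * (\<sigma> * A1 ?F)" using elim(3) by simp
      also have "\<dots> = (snd (\<phi>2 p) * Rt (\<phi>2 p))\<^sup>2"
        using elim(4) by (simp add: Rt_def power_mult_distrib)
      finally show ?case by (simp add: E_def)
    qed
  qed
qed

text \<open>The reflection of y does not change y^2 but reverses the y derivative. The positive
  product provides the positive quotients whose roots and logarithms are taken later.\<close>

lemma normalise_sign:
  assumes t: "typeIII f \<gamma>" and H: "diffeo_germ H" and K: "diffeo_germ K"
    and eq: "\<forall>\<^sub>F p in nhds 0. K (\<gamma> p) = fold_map (H p)"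
  obtains H' g where "diffeo_germ H'" "\<forall>\<^sub>F p in nhds 0. K (\<gamma> p) = fold_map (H' p)"
    "smooth_germ g" "g 0 = 0" "\<forall>\<^sub>F p in nhds 0. g (H' p) = f p" "pdx g 0 * pdy g 0 > 0"
proof -
  obtain G where G: "diffeo_germ G" "\<forall>\<^sub>F p in nhds 0. G (H p) = p" "\<forall>\<^sub>F p in nhds 0. H (G p) = p"
    by (rule diffeo_germ_inverse[OF H])
  have f: "smooth_germ f" "f 0 = 0" using t by (auto simp: typeIII_def)
  define g where "g p = f (G p)" for p
  have g: "smooth_germ g" "g 0 = 0" unfolding g_def[abs_def]
    using smooth_germ_compose[OF f(1) diffeo_germ_smooth[OF G(1)] diffeo_germ_zero[OF G(1)]]
      diffeo_germ_zero[OF G(1)] f(2) by auto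
  have gH: "\<forall>\<^sub>F p in nhds 0. g (H p) = f p" using G(2) by eventually_elim (simp add: g_def)
  have nz: "pdx g 0 \<noteq> 0" "pdy g 0 \<noteq> 0" using typeIII_partials[OF t H K eq G] by (simp_all add: g_def[abs_def])
  show ?thesis
  proof (cases "pdx g 0 * pdy g 0 > 0")
    case True
    then show ?thesis by (rule that[OF H eq g gH])
  next
    case False
    define F where "F p = (fst p, - snd p)" for p :: "real \<times> real"
    have F: "bounded_linear F" unfolding F_def[abs_def] by (intro bounded_linear_Pair bounded_linear_minus bounded_linear_fst bounded_linear_snd)
    have F0: "F 0 = 0" by (simp add: F_def zero_prod_def)
    have dF: "diffeo_germ F" unfolding diffeo_germ_def
      using smooth_germ_linear[OF F] F0 by (intro conjI exI[of _ F]) (auto simp: F_def)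
    have gF: "smooth_germ (\<lambda>p. g (F p))" by (rule smooth_germ_compose[OF g(1) smooth_germ_linear[OF F] F0])
    have "(g has_derivative (\<lambda>v. pdx g 0 * fst v + pdy g 0 * snd v)) (at (F 0))"
      unfolding F0 by (rule smooth_germ_has_derivative_pd[OF g(1)])
    from has_derivative_compose[OF bounded_linear_imp_has_derivative[OF F] this]
    have "((\<lambda>p. g (F p)) has_derivative (\<lambda>v. pdx g 0 * fst v + (- pdy g 0) * snd v)) (at 0)"
      by (simp add: F_def)
    note pd = pd_eqI[OF this]
    show ?thesis
    proof (rule that[of "\<lambda>p. F (H p)" "\<lambda>p. g (F p)"])
      show "diffeo_germ (\<lambda>p. F (H p))" by (rule diffeo_germ_compose[OF H dF])
      show "\<forall>\<^sub>F p in nhds 0. K (\<gamma> p) = fold_map (F (H p))" using eq by eventually_elim (simp add: F_def)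
      show "\<forall>\<^sub>F p in nhds 0. g (F (F (H p))) = f p" using gH by eventually_elim (simp add: F_def)
      show "pdx (\<lambda>p. g (F p)) 0 * pdy (\<lambda>p. g (F p)) 0 > 0"
        unfolding pd using False nz by (metis linorder_neqE_linordered_idom mult_eq_0_iff mult_minus_right neg_0_less_iff_less)
    qed (use gF F0 g in auto)
  qed
qed

subsection \<open>Normalising the two functions\<close>

lemma hadamard_division_real:
  fixes r :: "real \<Rightarrow> real"
  assumes r: "smooth_germ r" "r 0 = 0" and d: "(r has_real_derivative c) (at 0)"
  obtains R where "smooth_germ R" "\<forall>\<^sub>F x in nhds 0. r x = x * R x" "R 0 = c"
proof -
  have s: "smooth_germ (\<lambda>p::real\<times>real. r (snd p))" by (intro smooth_germ_compose[OF r(1)] smooth_germ_intros) simp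
  have zero: "\<forall>\<^sub>F x::real in nhds 0. r (snd (x, 0::real)) = 0" using r(2) by simp
  obtain g :: "real \<times> real \<Rightarrow> real" where g: "smooth_germ g" "\<forall>\<^sub>F p in nhds 0. r (snd p) = snd p * g p" "g 0 = pdy (\<lambda>p. r (snd p)) 0"
    by (rule hadamard_division_germ[OF s zero])
  have emb: "smooth_germ (\<lambda>x::real. (0::real, x))" by (intro smooth_germ_intros)
  show ?thesis
  proof (rule that)
    show "smooth_germ (\<lambda>x. g (0, x))" by (rule smooth_germ_axes(2)[OF g(1)])
    show "\<forall>\<^sub>F x in nhds 0. r x = x * g (0, x)"
      using smooth_germ_eventually_compose[OF emb _ g(2)] by (simp add: zero_prod_def)
    have "pdy (\<lambda>p. r (snd p)) 0 = c"
      using axis_derivatives(2)[OF s] d DERIV_unique by fastforce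
    then show "g (0, 0) = c" using g(3) by (simp add: zero_prod_def)
  qed
qed

lemma real_inverse_derivative:
  fixes u v :: "real \<Rightarrow> real"
  assumes u: "(u has_real_derivative c) (at 0)" "u 0 = 0" and v: "smooth_germ v" "\<forall>\<^sub>F x in nhds 0. v (u x) = x"
  shows "(v has_real_derivative inverse c) (at 0)"
proof -
  obtain e where e: "(v has_real_derivative e) (at 0)"
    using smooth_germ_has_derivative[OF v(1)] differentiable_def real_differentiable_def by blast
  have "((\<lambda>x. v (u x)) has_real_derivative e * c) (at 0)"
    using DERIV_chain2[of v e u 0] e u by simp
  then have "((\<lambda>x. x) has_real_derivative e * c) (at 0)"
    unfolding has_field_derivative_def by (rule has_derivative_cong_ev[OF _ v(2)])
  then have "e * c = 1" using DERIV_ident DERIV_unique by blast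
  then show ?thesis using e by (metis inverse_unique mult.commute)
qed

text \<open>Away from 0 one divides by x; the values at 0 agree by continuity.\<close>

lemma cancel_ident_germ:
  fixes f g :: "real \<Rightarrow> real"
  assumes "smooth_germ f" "smooth_germ g" "\<forall>\<^sub>F x in nhds 0. x * f x = x * g x"
  shows "\<forall>\<^sub>F x in nhds 0. f x = g x"
proof -
  have at: "\<forall>\<^sub>F x in at 0. f x = g x"
    using assms(3) by (auto simp: eventually_at_filter elim: eventually_mono)
  have "(f \<longlongrightarrow> f 0) (at 0)" "(g \<longlongrightarrow> g 0) (at 0)"
    using smooth_germ_tendsto[OF assms(1)] smooth_germ_tendsto[OF assms(2)] by (simp_all add: tendsto_at_iff_tendsto_nhds)
  then have "f 0 = g 0"
    using tendsto_cong[OF at] tendsto_unique[of "at (0::real)"] by (metis at_neq_bot)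
  with at show ?thesis by (auto simp: eventually_at_filter elim: eventually_mono)
qed

lemma diffeo_ident_mult:
  fixes A :: "real \<Rightarrow> real"
  assumes "smooth_germ A" "A 0 \<noteq> 0"
  shows "diffeo_germ (\<lambda>x. x * A x)"
proof (rule diffeo_germ_realI)
  show "smooth_germ (\<lambda>x. x * A x)" by (intro smooth_germ_intros assms)
  obtain e where "(A has_real_derivative e) (at 0)"
    using smooth_germ_has_derivative[OF assms(1)] differentiable_def real_differentiable_def by blast
  from DERIV_mult[OF DERIV_ident this] show "((\<lambda>x. x * A x) has_real_derivative A 0) (at 0)" by simp
qed (use assms in auto)

text \<open>Everything is determined by one positive germ \<open>k\<close>, fixed at the outset: it
  gives \<open>h1\<close>, the Whitney decomposition of h1 \<circ> g1 gives \<open>K\<close> with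
  its two lifts, and the first axis gives \<open>h2\<close>. The equation for \<open>k\<close> is
  set up so that the second axis agrees.\<close>

lemma normalise_functions:
  fixes g1 g2 :: "real \<times> real \<Rightarrow> real"
  assumes g1: "smooth_germ g1" "g1 0 = 0" and s1: "pdx g1 0 * pdy g1 0 > 0"
    and g2: "smooth_germ g2" "g2 0 = 0" and s2: "pdx g2 0 * pdy g2 0 > 0"
  obtains h1 h2 :: "real \<Rightarrow> real" and N1 N2 K :: "real \<times> real \<Rightarrow> real \<times> real" and \<theta> :: "real \<times> real \<Rightarrow> real"
  where "diffeo_germ h1" "diffeo_germ h2" "diffeo_germ N1" "diffeo_germ N2" "diffeo_germ K"
    "smooth_germ \<theta>" "\<theta> 0 = 0" "\<forall>\<^sub>F x in nhds 0. \<theta> (x, 0) = 0" "\<forall>\<^sub>F y in nhds 0. \<theta> (0, y) = 0"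
    "\<forall>\<^sub>F p in nhds 0. h1 (g1 p) = fst (N1 p) + snd (N1 p)"
    "\<forall>\<^sub>F p in nhds 0. h2 (g2 p) = fst (N2 p) + snd (N2 p) + \<theta> (N2 p)"
    "\<forall>\<^sub>F p in nhds 0. K (fold_map p) = fold_map (N1 p)"
    "\<forall>\<^sub>F p in nhds 0. K (fold_map' p) = fold_map' (N2 p)"
proof -
  have nz: "pdx g1 0 \<noteq> 0" "pdy g1 0 \<noteq> 0" "pdx g2 0 \<noteq> 0" "pdy g2 0 \<noteq> 0" using s1 s2 by auto
  have z: "g1 (0, 0) = 0" "g2 (0, 0) = 0" using g1(2) g2(2) by (simp_all add: zero_prod_def)
  define u where "u y = g1 (0, y)" for y
  define v where "v x = g2 (x, 0)" for x
  define w where "w y = g2 (0, y)" for y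
  have u: "diffeo_germ u" unfolding u_def[abs_def]
    by (rule diffeo_germ_realI[OF smooth_germ_axes(2)[OF g1(1)] z(1) axis_derivatives(2)[OF g1(1)] nz(2)])
  have v: "diffeo_germ v" unfolding v_def[abs_def]
    by (rule diffeo_germ_realI[OF smooth_germ_axes(1)[OF g2(1)] z(2) axis_derivatives(1)[OF g2(1)] nz(3)])
  obtain ui where ui: "diffeo_germ ui" "\<forall>\<^sub>F x in nhds 0. ui (u x) = x" by (rule diffeo_germ_inverse[OF u])
  obtain vi where vi: "diffeo_germ vi" "\<forall>\<^sub>F x in nhds 0. vi (v x) = x" by (rule diffeo_germ_inverse[OF v])
  note uis = diffeo_germ_smooth[OF ui(1)] diffeo_germ_zero[OF ui(1)]
  note vis = diffeo_germ_smooth[OF vi(1)] diffeo_germ_zero[OF vi(1)]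
  have dui: "(ui has_real_derivative inverse (pdy g1 0)) (at 0)"
    by (rule real_inverse_derivative[OF _ diffeo_germ_zero[OF u] uis(1) ui(2)])
       (simp add: u_def[abs_def] axis_derivatives(2)[OF g1(1)])
  have dvi: "(vi has_real_derivative inverse (pdx g2 0)) (at 0)"
    by (rule real_inverse_derivative[OF _ diffeo_germ_zero[OF v] vis(1) vi(2)])
       (simp add: v_def[abs_def] axis_derivatives(1)[OF g2(1)])
  \<comment> \<open>\<open>r\<close> reads the values of \<open>g1\<close> on the x axis in the
    parameter of the y axis; \<open>s\<close> reads those of \<open>g2\<close> on the y axis in the
    parameter of the x axis.\<close>
  define r where "r x = ui (g1 (x, 0))" for x
  define s where "s y = vi (w y)" for y
  have r: "smooth_germ r" "r 0 = 0" unfolding r_def[abs_def]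
    using smooth_germ_compose[OF uis(1) smooth_germ_axes(1)[OF g1(1)]] z uis(2) by auto
  have s: "smooth_germ s" "s 0 = 0" unfolding s_def[abs_def] w_def
    using smooth_germ_compose[OF vis(1) smooth_germ_axes(2)[OF g2(1)]] z vis(2) by auto
  have dr: "(r has_real_derivative inverse (pdy g1 0) * pdx g1 0) (at 0)"
    unfolding r_def[abs_def]
    using DERIV_chain2[of ui _ "\<lambda>x. g1 (x, 0)" 0, OF _ axis_derivatives(1)[OF g1(1)]] dui z by simp
  have ds: "(s has_real_derivative inverse (pdx g2 0) * pdy g2 0) (at 0)"
    unfolding s_def[abs_def] w_def
    using DERIV_chain2[of vi _ "\<lambda>x. g2 (0, x)" 0, OF _ axis_derivatives(2)[OF g2(1)]] dvi z by simp
  obtain R where R: "smooth_germ R" "\<forall>\<^sub>F x in nhds 0. r x = x * R x" and R0: "R 0 = inverse (pdy g1 0) * pdx g1 0"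
    by (rule hadamard_division_real[OF r dr])
  obtain S where S: "smooth_germ S" "\<forall>\<^sub>F x in nhds 0. s x = x * S x" and S0: "S 0 = inverse (pdx g2 0) * pdy g2 0"
    by (rule hadamard_division_real[OF s ds])
  have Rpos: "R 0 > 0" and Spos: "S 0 > 0"
    using s1 s2 by (auto simp: R0 S0 zero_less_mult_iff)
  have s2: "smooth_germ (\<lambda>y. (s y)\<^sup>2)" "(s 0)\<^sup>2 = 0" using s by (auto intro: smooth_germ_power)
  have rs: "smooth_germ (\<lambda>y. r ((s y)\<^sup>2))" by (rule smooth_germ_compose[OF r(1) s2])
  \<comment> \<open>The factor of \<open>K\<close> on the x axis involves k at r(X)^2, and the
    second function evaluates it at X = s(y)^2.\<close>
  define p where "p y = (r ((s y)\<^sup>2))\<^sup>2" for y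
  have p: "smooth_germ p" "p 0 = 0" unfolding p_def[abs_def] using rs r s by (auto intro: smooth_germ_power)
  have dp: "(p has_real_derivative 0) (at 0)"
  proof -
    obtain e where "((\<lambda>y. r ((s y)\<^sup>2)) has_real_derivative e) (at 0)"
      using smooth_germ_has_derivative[OF rs] differentiable_def real_differentiable_def by blast
    from DERIV_mult[OF this this] show ?thesis
      unfolding p_def[abs_def] power2_eq_square using r s by simp
  qed
  \<comment> \<open>Half the logarithm of S(y) sqrt(R(s(y)^2)), the part of the compatibility
    condition that is free of \<open>k\<close>; the half comes from solving for ln k in an equation
    for k^2.\<close>
  define \<rho> where "\<rho> y = 1/2 * ln (S y * sqrt (R ((s y)\<^sup>2)))" for y
  have Rs: "smooth_germ (\<lambda>y. R ((s y)\<^sup>2))" by (rule smooth_germ_compose[OF R(1) s2])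
  have \<rho>: "smooth_germ \<rho>" unfolding \<rho>_def[abs_def]
    by (intro smooth_germ_mult smooth_germ_const smooth_germ_ln smooth_germ_sqrt S(1) Rs)
       (use Rpos Spos s in auto)
  obtain \<kappa> where \<kappa>: "smooth_germ \<kappa>" "\<forall>\<^sub>F y in nhds 0. \<kappa> y = \<rho> y + 1/4 * \<kappa> (p y)"
    by (rule functional_equation_germ[OF p dp \<rho>])
  define k where "k y = exp (\<kappa> y)" for y
  have k: "smooth_germ k" unfolding k_def[abs_def] by (rule smooth_germ_exp[OF \<kappa>(1)])
  have kpos: "k y > 0" for y by (simp add: k_def)
  \<comment> \<open>An odd diffeomorphism: it will be h1 \<circ> g1 on the y axis, so its even part
    there is 0 and its odd part is y times k(y^2).\<close>
  define \<eta> where "\<eta> y = y * k (y\<^sup>2)" for y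
  have k2: "smooth_germ (\<lambda>y. k (y\<^sup>2))" by (intro smooth_germ_compose[OF k] smooth_germ_intros) simp
  have \<eta>: "diffeo_germ \<eta>" unfolding \<eta>_def[abs_def]
    by (rule diffeo_ident_mult[OF k2]) (use kpos in \<open>simp add: less_imp_neq[symmetric]\<close>)
  define h1 where "h1 t = \<eta> (ui t)" for t
  have h1: "diffeo_germ h1" unfolding h1_def[abs_def] by (rule diffeo_germ_compose[OF ui(1) \<eta>])
  obtain a0 b0 where a0: "smooth_germ a0" and b0: "smooth_germ b0"
    and ab0: "\<forall>\<^sub>F p in nhds 0. h1 (g1 p) = a0 (fst p, (snd p)\<^sup>2) + snd p * b0 (fst p, (snd p)\<^sup>2)"
    by (rule whitney_decomposition[OF smooth_germ_compose[OF diffeo_germ_smooth[OF h1] g1]])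
  \<comment> \<open>The fold determines a0 and b0 for Y \<ge> 0 only. These corrections do not
    change the decomposition along the fold, but give a(0, Y) = 0 and b(0, Y) = k(Y) for negative Y
    too, where \<gamma>2 takes values as well.\<close>
  define a where "a p = a0 p - a0 (0, snd p)" for p :: "real \<times> real"
  define b where "b p = b0 p + k (snd p) - b0 (0, snd p)" for p :: "real \<times> real"
  have proj: "smooth_germ (\<lambda>p::real\<times>real. (0::real, snd p))" by (intro smooth_germ_intros)
  have a: "smooth_germ a" unfolding a_def[abs_def]
    by (intro smooth_germ_diff a0 smooth_germ_compose[OF a0 proj]) (simp add: zero_prod_def)
  have b: "smooth_germ b" unfolding b_def[abs_def]
    by (intro smooth_germ_diff smooth_germ_add b0 smooth_germ_compose[OF k] smooth_germ_compose[OF b0 proj] smooth_germ_intros)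
       (simp_all add: zero_prod_def)
  have b0k: "b (0, y) = k y" for y by (simp add: b_def)
  have emb1: "smooth_germ (\<lambda>x::real. (x, 0::real))" and emb2: "smooth_germ (\<lambda>x::real. (0::real, x))"
    by (intro smooth_germ_intros)+
  have neg: "smooth_germ (\<lambda>x::real. (0::real, - x))" by (intro smooth_germ_intros)
  have axis: "\<forall>\<^sub>F y in nhds 0. a0 (0, y\<^sup>2) = 0 \<and> y * b0 (0, y\<^sup>2) = y * k (y\<^sup>2)"
  proof -
    have uu: "\<forall>\<^sub>F y in nhds 0. h1 (g1 (0, y)) = \<eta> y"
      using ui(2) by eventually_elim (simp add: h1_def u_def)
    have "\<forall>\<^sub>F y in nhds 0. h1 (g1 (0, - y)) = \<eta> (- y)"
      by (rule smooth_germ_eventually_compose[OF _ _ uu]) (auto intro: smooth_germ_intros)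
    moreover have "\<forall>\<^sub>F y in nhds 0. h1 (g1 (0, y)) = a0 (0, y\<^sup>2) + y * b0 (0, y\<^sup>2)"
      using smooth_germ_eventually_compose[OF emb2 _ ab0] by (simp add: zero_prod_def)
    moreover have "\<forall>\<^sub>F y in nhds 0. h1 (g1 (0, - y)) = a0 (0, y\<^sup>2) - y * b0 (0, y\<^sup>2)"
      using smooth_germ_eventually_compose[OF neg _ ab0] by (simp add: zero_prod_def)
    ultimately show ?thesis using uu by eventually_elim (auto simp: \<eta>_def)
  qed
  have ab: "\<forall>\<^sub>F p in nhds 0. h1 (g1 p) = a (fst p, (snd p)\<^sup>2) + snd p * b (fst p, (snd p)\<^sup>2)"
  proof -
    have "smooth_germ (\<lambda>p::real\<times>real. snd p)" by (intro smooth_germ_intros)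
    from smooth_germ_eventually_compose[OF this _ axis]
    have "\<forall>\<^sub>F p::real\<times>real in nhds 0. a0 (0, (snd p)\<^sup>2) = 0 \<and> snd p * b0 (0, (snd p)\<^sup>2) = snd p * k ((snd p)\<^sup>2)"
      by simp
    with ab0 show ?thesis by eventually_elim (simp add: a_def b_def algebra_simps)
  qed
  define sw where "sw p = (snd p, fst p)" for p :: "real \<times> real"
  have sw: "smooth_germ sw" "sw 0 = 0" unfolding sw_def[abs_def] by (auto intro!: smooth_germ_intros simp: zero_prod_def)
  \<comment> \<open>Division by x is reduced to division by the second variable by swapping the
    coordinates.\<close>
  obtain A' where A': "smooth_germ A'" "\<forall>\<^sub>F p in nhds 0. a (sw p) = snd p * A' p"
    by (rule hadamard_division_germ[OF smooth_germ_compose[OF a sw]]) (auto simp: a_def sw_def)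
  define A where "A p = A' (sw p)" for p
  have A: "smooth_germ A" unfolding A_def[abs_def] by (rule smooth_germ_compose[OF A'(1) sw])
  have aA: "\<forall>\<^sub>F p in nhds 0. a p = fst p * A p"
    using smooth_germ_eventually_compose[OF sw A'(2)] by (simp add: A_def sw_def)
  have rk: "smooth_germ (\<lambda>x. R x * k ((r x)\<^sup>2))"
    using r by (intro smooth_germ_mult R(1) smooth_germ_compose[OF k] smooth_germ_power) auto
  \<comment> \<open>On the x axis h1 \<circ> g1 equals \<eta>(r x) = x R(x) k(r(x)^2) on the one
    hand and x A(x, 0) on the other.\<close>
  have Ax: "\<forall>\<^sub>F x in nhds 0. A (x, 0) = R x * k ((r x)\<^sup>2)"
  proof (rule cancel_ident_germ[OF smooth_germ_axes(1)[OF A] rk])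
    have "\<forall>\<^sub>F x in nhds 0. h1 (g1 (x, 0)) = a (x, 0)"
      using smooth_germ_eventually_compose[OF emb1 _ ab] by (simp add: zero_prod_def)
    moreover have "\<forall>\<^sub>F x in nhds 0. a (x, 0) = x * A (x, 0)"
      using smooth_germ_eventually_compose[OF emb1 _ aA] by (simp add: zero_prod_def)
    ultimately show "\<forall>\<^sub>F x in nhds 0. x * A (x, 0) = x * (R x * k ((r x)\<^sup>2))"
      using R(2) by eventually_elim (auto simp: h1_def \<eta>_def r_def[symmetric])
  qed
  have A0: "A 0 > 0"
    using eventually_nhds_x_imp_x[OF Ax] Rpos kpos by (simp add: zero_prod_def)
  have bpos: "b 0 > 0" using b0k[of 0] kpos by (simp add: zero_prod_def)
  \<comment> \<open>Since a = x A, this is (a, Y b^2). Its lift through the first fold takes the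
    root of b^2, giving \<open>N1\<close>; its lift through the second takes the root of A, giving
    \<open>N2\<close>.\<close>
  define K where "K p = (fst p * A p, snd p * (b p)\<^sup>2)" for p
  have K: "diffeo_germ K" unfolding K_def[abs_def]
    by (rule diffeo_germ_PairI)
       (use A b A0 bpos in \<open>auto simp: pd_fst_mult pd_snd_mult smooth_germ_power intro!: smooth_germ_intros\<close>)
  have fold0: "smooth_germ fold_map" "fold_map 0 = 0" by (auto intro!: smooth_germ_intros simp: zero_prod_def)
  have fold0': "smooth_germ fold_map'" "fold_map' 0 = 0" by (auto intro!: smooth_germ_intros simp: zero_prod_def)
  have Af: "smooth_germ (\<lambda>p. A (fold_map p))" "smooth_germ (\<lambda>p. b (fold_map p))"
    by (rule smooth_germ_compose[OF _ fold0]; fact)+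
  have Af': "smooth_germ (\<lambda>p. A (fold_map' p))" "smooth_germ (\<lambda>p. b (fold_map' p))"
    by (rule smooth_germ_compose[OF _ fold0']; fact)+
  define N1 where "N1 p = (fst p * A (fold_map p), snd p * b (fold_map p))" for p
  have N1: "diffeo_germ N1" unfolding N1_def[abs_def]
    by (rule diffeo_germ_PairI)
       (use Af A0 bpos fold0(2) in \<open>auto simp: pd_fst_mult[OF Af(1)] pd_snd_mult[OF Af(2)] intro!: smooth_germ_intros\<close>)
  have sq: "smooth_germ (\<lambda>p. sqrt (A (fold_map' p)))"
    by (rule smooth_germ_sqrt[OF Af'(1)]) (use A0 fold0'(2) in simp)
  have b2: "smooth_germ (\<lambda>p. (b (fold_map' p))\<^sup>2)" by (rule smooth_germ_power[OF Af'(2)])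
  define N2 where "N2 p = (fst p * sqrt (A (fold_map' p)), snd p * (b (fold_map' p))\<^sup>2)" for p
  have N2: "diffeo_germ N2" unfolding N2_def[abs_def]
    by (rule diffeo_germ_PairI)
       (use sq b2 A0 bpos fold0'(2) in \<open>auto simp: pd_fst_mult[OF sq] pd_snd_mult[OF b2] intro!: smooth_germ_intros\<close>)
  obtain M where M: "diffeo_germ M" "\<forall>\<^sub>F p in nhds 0. M (N2 p) = p" by (rule diffeo_germ_inverse[OF N2])
  \<comment> \<open>\<alpha> and \<beta> are the restrictions of \<open>N2\<close> to the two axes.
    With h2 = \<alpha> \<circ> vi one has h2 (g2 (x, 0)) = \<alpha>(x), as the x axis requires; on
    the y axis h2 (g2 (0, y)) = \<alpha>(s y), which has to be \<beta>(y).\<close>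
  define \<alpha> where "\<alpha> x = x * sqrt (A (x\<^sup>2, 0))" for x
  have \<alpha>: "diffeo_germ \<alpha>" unfolding \<alpha>_def[abs_def]
    using diffeo_ident_mult[OF smooth_germ_axes(1)[OF sq]] A0 by (simp add: zero_prod_def)
  define \<beta> where "\<beta> y = y * (k y)\<^sup>2" for y
  have \<beta>: "diffeo_germ \<beta>" unfolding \<beta>_def[abs_def]
    by (rule diffeo_ident_mult[OF smooth_germ_power[OF k]]) (use kpos[of 0] in simp)
  define h2 where "h2 t = \<alpha> (vi t)" for t
  have h2: "diffeo_germ h2" unfolding h2_def[abs_def] by (rule diffeo_germ_compose[OF vi(1) \<alpha>])
  have Apos: "\<forall>\<^sub>F p in nhds 0. A p > 0"
    using smooth_germ_tendsto[OF A] A0 by (rule order_tendstoD)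
  \<comment> \<open>The functional equation for \<open>\<kappa>\<close> is exactly the compatibility of \<open>h2\<close> with both axes.\<close>
  have \<alpha>\<beta>: "\<forall>\<^sub>F y in nhds 0. \<alpha> (s y) = \<beta> y"
  proof -
    have pos: "\<forall>\<^sub>F y in nhds 0. S y > 0" "\<forall>\<^sub>F y in nhds 0. R ((s y)\<^sup>2) > 0"
      using smooth_germ_tendsto[OF S(1)] Spos smooth_germ_tendsto[OF Rs] Rpos s2(2)
      by (auto intro: order_tendstoD)
    show ?thesis
      using \<kappa>(2) S(2) pos smooth_germ_eventually_compose[OF s2 Ax]
    proof eventually_elim
      case (elim y)
      let ?c = "S y * sqrt (R ((s y)\<^sup>2))"
      have c: "?c > 0" using elim by simp
      have "\<alpha> (s y) = y * (?c * sqrt (k (p y)))"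
        using elim(2,5) by (simp add: \<alpha>_def p_def real_sqrt_mult)
      also have "sqrt (k (p y)) = exp (\<kappa> (p y) / 2)"
        unfolding k_def by (rule real_sqrt_unique) (simp_all flip: exp_double)
      also have "?c * exp (\<kappa> (p y) / 2) = exp (ln ?c + \<kappa> (p y) / 2)"
        using c by (simp add: exp_add)
      also have "ln ?c + \<kappa> (p y) / 2 = 2 * \<kappa> y" using elim(1) by (simp add: \<rho>_def)
      also have "exp (2 * \<kappa> y) = (k y)\<^sup>2" by (simp add: k_def exp_double)
      finally show ?case by (simp add: \<beta>_def)
    qed
  qed
  \<comment> \<open>The deviation of the transformed second function from x + y, in the new source
    coordinates; it vanishes on both axes by the choice of \<open>h2\<close> and of
    \<open>k\<close>.\<close>
  define \<theta> where "\<theta> p = h2 (g2 (M p)) - (fst p + snd p)" for p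
  have gM: "smooth_germ (\<lambda>p. g2 (M p))" "g2 (M 0) = 0"
    using smooth_germ_compose[OF g2(1) diffeo_germ_smooth[OF M(1)] diffeo_germ_zero[OF M(1)]]
      diffeo_germ_zero[OF M(1)] g2(2) by auto
  show ?thesis
  proof (rule that[OF h1 h2 N1 N2 K])
    show "smooth_germ \<theta>" unfolding \<theta>_def[abs_def]
      by (intro smooth_germ_diff smooth_germ_compose[OF diffeo_germ_smooth[OF h2] gM] smooth_germ_intros)
    show "\<theta> 0 = 0" using gM(2) diffeo_germ_zero[OF h2] by (simp add: \<theta>_def)
    show "\<forall>\<^sub>F x in nhds 0. \<theta> (x, 0) = 0"
    proof -
      obtain \<alpha>i where \<alpha>i: "diffeo_germ \<alpha>i" "\<forall>\<^sub>F x in nhds 0. \<alpha> (\<alpha>i x) = x"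
        by (rule diffeo_germ_inverse[OF \<alpha>])
      have M': "\<forall>\<^sub>F x in nhds 0. M (N2 (x, 0)) = (x, 0)"
        using smooth_germ_eventually_compose[OF emb1 _ M(2)] by (simp add: zero_prod_def)
      note ev = smooth_germ_eventually_compose[OF diffeo_germ_smooth[OF \<alpha>i(1)] diffeo_germ_zero[OF \<alpha>i(1)]]
      show ?thesis
        using \<alpha>i(2) ev[OF M'] ev[OF vi(2)]
      proof eventually_elim
        case (elim x)
        have "N2 (\<alpha>i x, 0) = (x, 0)" using elim(1) by (simp add: N2_def \<alpha>_def)
        then have "M (x, 0) = (\<alpha>i x, 0)" using elim(2) by simp
        then show ?case using elim(1,3) by (simp add: \<theta>_def h2_def v_def)
      qed
    qed
    show "\<forall>\<^sub>F y in nhds 0. \<theta> (0, y) = 0"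
    proof -
      obtain \<beta>i where \<beta>i: "diffeo_germ \<beta>i" "\<forall>\<^sub>F x in nhds 0. \<beta> (\<beta>i x) = x"
        by (rule diffeo_germ_inverse[OF \<beta>])
      have M': "\<forall>\<^sub>F x in nhds 0. M (N2 (0, x)) = (0, x)"
        using smooth_germ_eventually_compose[OF emb2 _ M(2)] by (simp add: zero_prod_def)
      note ev = smooth_germ_eventually_compose[OF diffeo_germ_smooth[OF \<beta>i(1)] diffeo_germ_zero[OF \<beta>i(1)]]
      show ?thesis
        using \<beta>i(2) ev[OF M'] ev[OF \<alpha>\<beta>]
      proof eventually_elim
        case (elim y)
        have "N2 (0, \<beta>i y) = (0, y)" using elim(1) by (simp add: N2_def \<beta>_def b0k)
        then have "M (0, y) = (0, \<beta>i y)" using elim(2) by simp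
        then show ?case using elim(1,3) by (simp add: \<theta>_def h2_def s_def w_def)
      qed
    qed
    show "\<forall>\<^sub>F p in nhds 0. h1 (g1 p) = fst (N1 p) + snd (N1 p)"
      using ab smooth_germ_eventually_compose[OF fold0 aA] by eventually_elim (simp add: N1_def)
    show "\<forall>\<^sub>F p in nhds 0. h2 (g2 p) = fst (N2 p) + snd (N2 p) + \<theta> (N2 p)"
      using M(2) by eventually_elim (simp add: \<theta>_def)
    show "\<forall>\<^sub>F p in nhds 0. K (fold_map p) = fold_map (N1 p)"
      by (simp add: K_def N1_def power_mult_distrib)
    show "\<forall>\<^sub>F p in nhds 0. K (fold_map' p) = fold_map' (N2 p)"
      using smooth_germ_eventually_compose[OF fold0' Apos]
      by eventually_elim (simp add: K_def N2_def power_mult_distrib)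
  qed
qed

theorem theoremA:
  fixes f1 f2 :: "real \<times> real \<Rightarrow> real" and \<gamma>1 \<gamma>2 :: "real \<times> real \<Rightarrow> real \<times> real"
  assumes "typeIII_III f1 \<gamma>1 f2 \<gamma>2"
  shows "\<exists>\<theta> :: real \<times> real \<Rightarrow> real.
           smooth_germ \<theta> \<and> \<theta> 0 = 0 \<and>
           (\<forall>\<^sub>F x in nhds 0. \<theta> (x, 0) = 0) \<and> (\<forall>\<^sub>F y in nhds 0. \<theta> (0, y) = 0) \<and>
           diagram_equiv f1 \<gamma>1 f2 \<gamma>2
             (\<lambda>(x, y). x + y) (\<lambda>(x, y). (x, y ^ 2))
             (\<lambda>(x, y). x + y + \<theta> (x, y)) (\<lambda>(x, y). (x ^ 2, y))"
proof -
  from assms have t1: "typeIII f1 \<gamma>1" and t2: "typeIII f2 \<gamma>2" and tr: "discr_transversal \<gamma>1 \<gamma>2"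
    by (auto simp: typeIII_III_def)
  have "fold_germ \<gamma>1" "fold_germ \<gamma>2" using t1 t2 by (auto simp: typeIII_def)
  then obtain \<phi>1 \<psi>1 \<phi>2 \<psi>2 where \<gamma>1: "smooth_germ \<gamma>1" "\<gamma>1 0 = 0" and \<gamma>2: "smooth_germ \<gamma>2" "\<gamma>2 0 = 0"
    and d1: "diffeo_germ \<phi>1" "diffeo_germ \<psi>1" and eq1: "\<forall>\<^sub>F p in nhds 0. \<psi>1 (\<gamma>1 p) = fold_map (\<phi>1 p)"
    and d2: "diffeo_germ \<phi>2" "diffeo_germ \<psi>2" and eq2: "\<forall>\<^sub>F p in nhds 0. \<psi>2 (\<gamma>2 p) = fold_map (\<phi>2 p)"
    unfolding fold_germ_def case_prod_unfold by blast
  obtain K0 H1 H2 where K0: "diffeo_germ K0" and H1: "diffeo_germ H1" and H2: "diffeo_germ H2"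
    and e1: "\<forall>\<^sub>F p in nhds 0. K0 (\<gamma>1 p) = fold_map (H1 p)"
    and e2: "\<forall>\<^sub>F p in nhds 0. K0 (\<gamma>2 p) = fold_map' (H2 p)"
    by (rule straighten_discriminants[OF \<gamma>1 \<gamma>2 d1 eq1 d2 eq2 tr])
  \<comment> \<open>The sign lemma is stated for folds that square the second coordinate. Swapping
    source and target coordinates brings \<gamma>2 into that form, and a second swap in the source
    undoes this.\<close>
  define sw where "sw p = (snd p, fst p)" for p :: "real \<times> real"
  have sw_lin: "bounded_linear sw"
    unfolding sw_def[abs_def] by (intro bounded_linear_Pair bounded_linear_fst bounded_linear_snd)
  have sw0: "sw 0 = 0" by (simp add: sw_def zero_prod_def)
  have sw: "diffeo_germ sw" unfolding diffeo_germ_def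
    using smooth_germ_linear[OF sw_lin] sw0 by (intro conjI exI[of _ sw]) (auto simp: sw_def)
  obtain H1' g1 where H1': "diffeo_germ H1'" and e1': "\<forall>\<^sub>F p in nhds 0. K0 (\<gamma>1 p) = fold_map (H1' p)"
    and g1: "smooth_germ g1" "g1 0 = 0" and g1H: "\<forall>\<^sub>F p in nhds 0. g1 (H1' p) = f1 p"
    and pos1: "pdx g1 0 * pdy g1 0 > 0"
    by (rule normalise_sign[OF t1 H1 K0 e1])
  have "\<forall>\<^sub>F p in nhds 0. sw (K0 (\<gamma>2 p)) = fold_map (sw (H2 p))"
    using e2 by eventually_elim (simp add: sw_def)
  from normalise_sign[OF t2 diffeo_germ_compose[OF H2 sw] diffeo_germ_compose[OF K0 sw] this]
  obtain H2' g2 where H2': "diffeo_germ H2'" and e2': "\<forall>\<^sub>F p in nhds 0. sw (K0 (\<gamma>2 p)) = fold_map (H2' p)"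
    and g2: "smooth_germ g2" "g2 0 = 0" and g2H: "\<forall>\<^sub>F p in nhds 0. g2 (H2' p) = f2 p"
    and pos2: "pdx g2 0 * pdy g2 0 > 0" .
  have g2s: "smooth_germ (\<lambda>p. g2 (sw p))" "g2 (sw 0) = 0"
    using smooth_germ_compose[OF g2(1) diffeo_germ_smooth[OF sw] sw0] sw0 g2(2) by auto
  have "(g2 has_derivative (\<lambda>v. pdx g2 0 * fst v + pdy g2 0 * snd v)) (at (sw 0))"
    unfolding sw0 by (rule smooth_germ_has_derivative_pd[OF g2(1)])
  from has_derivative_compose[OF bounded_linear_imp_has_derivative[OF sw_lin] this]
  have "((\<lambda>p. g2 (sw p)) has_derivative (\<lambda>v. pdy g2 0 * fst v + pdx g2 0 * snd v)) (at 0)"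
    by (simp add: sw_def add.commute)
  note pd = pd_eqI[OF this]
  obtain h1 h2 :: "real \<Rightarrow> real" and N1 N2 K \<theta> where h: "diffeo_germ h1" "diffeo_germ h2"
    and N: "diffeo_germ N1" "diffeo_germ N2" "diffeo_germ K"
    and \<theta>: "smooth_germ \<theta>" "\<theta> 0 = 0" "\<forall>\<^sub>F x in nhds 0. \<theta> (x, 0) = 0" "\<forall>\<^sub>F y in nhds 0. \<theta> (0, y) = 0"
    and c1: "\<forall>\<^sub>F p in nhds 0. h1 (g1 p) = fst (N1 p) + snd (N1 p)"
    and c2: "\<forall>\<^sub>F p in nhds 0. h2 (g2 (sw p)) = fst (N2 p) + snd (N2 p) + \<theta> (N2 p)"
    and c3: "\<forall>\<^sub>F p in nhds 0. K (fold_map p) = fold_map (N1 p)"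
    and c4: "\<forall>\<^sub>F p in nhds 0. K (fold_map' p) = fold_map' (N2 p)"
    by (rule normalise_functions[OF g1 pos1 g2s]) (use pos2 pd in \<open>simp_all add: mult.commute\<close>)
  have H2s: "diffeo_germ (\<lambda>p. sw (H2' p))" by (rule diffeo_germ_compose[OF H2' sw])
  note ev1 = smooth_germ_eventually_compose[OF diffeo_germ_smooth[OF H1'] diffeo_germ_zero[OF H1']]
  note ev2 = smooth_germ_eventually_compose[OF diffeo_germ_smooth[OF H2s] diffeo_germ_zero[OF H2s]]
  have "\<forall>\<^sub>F p in nhds 0. h1 (f1 p) = (\<lambda>(x, y). x + y) (N1 (H1' p))"
    using ev1[OF c1] g1H by eventually_elim (simp add: case_prod_unfold)
  moreover have "\<forall>\<^sub>F p in nhds 0. h2 (f2 p) = (\<lambda>(x, y). x + y + \<theta> (x, y)) (N2 (sw (H2' p)))"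
    using ev2[OF c2] g2H by eventually_elim (simp add: case_prod_unfold sw_def)
  moreover have "\<forall>\<^sub>F p in nhds 0. K (K0 (\<gamma>1 p)) = (\<lambda>(x, y). (x, y ^ 2)) (N1 (H1' p))"
    using ev1[OF c3] e1' by eventually_elim (simp add: case_prod_unfold)
  moreover have "\<forall>\<^sub>F p in nhds 0. K (K0 (\<gamma>2 p)) = (\<lambda>(x, y). (x ^ 2, y)) (N2 (sw (H2' p)))"
    using ev2[OF c4] e2'
  proof eventually_elim
    case (elim p)
    have "K0 (\<gamma>2 p) = fold_map' (sw (H2' p))"
      using elim(2) by (simp add: sw_def prod_eq_iff)
    then show ?case using elim(1) by (simp add: case_prod_unfold)
  qed
  ultimately have "diagram_equiv f1 \<gamma>1 f2 \<gamma>2 (\<lambda>(x, y). x + y) (\<lambda>(x, y). (x, y ^ 2))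
      (\<lambda>(x, y). x + y + \<theta> (x, y)) (\<lambda>(x, y). (x ^ 2, y))"
    unfolding diagram_equiv_def
    using h diffeo_germ_compose[OF H1' N(1)] diffeo_germ_compose[OF H2s N(2)] diffeo_germ_compose[OF K0 N(3)]
    by blast
  then show ?thesis using \<theta> by blast
qed

end
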